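(* Let $b:\mathbb{R}\to\mathbb{R}$ be $T$-periodic ($T>0$), continuous, of bounded variation (on a period), with $b(t)>0$ for almost every $t$. The solution $u(t,x)$, $t\ge0$, $x\in\mathbb{R}^n$, of the Cauchy problem $$u_{tt}-\Delta u+2b(t)u_t=0,\qquad u(0,\cdot)=u_1,\quad u_t(0,\cdot)=u_2$$ satisfies the a-priori estimates \begin{align*} \|u(t,\cdot)\|_{L^2}&\lesssim\|u_1\|_{L^2}+\|u_2\|_{H^{-1}},\\ \|\nabla u(t,\cdot)\|_{L^2}&\lesssim(1+t)^{-1/2}\big(\|u_1\|_{H^1}+\|u_2\|_{L^2}\big),\\ \|\partial_tu(t,\cdot)\|_{L^2}&\lesssim(1+t)^{-1}\big(\|u_1\|_{H^1}+\|u_2\|_{L^2}\big) \end{align*} for all $t\ge0$. Furthermore, for any cut-off function $\chi\in C^\infty(\mathbb{R})$ with $\chi(s)=0$ near $s=0$ and $\chi(s)=1$ for large $s$ there exists a constant $\delta>0$ such that the exponential estimate $$\|\chi(D)u(t,\cdot)\|_{L^2}+\|\chi(D)\nabla u(t,\cdot)\|_{L^2}+\|\chi(D)\partial_tu(t,\cdot)\|_{L^2}\lesssim e^{-\delta t}\big(\|u_1\|_{H^1}+\|u_2\|_{L^2}\big)$$ holds for all $t\ge0$.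
   Context: $H^s=H^s(\mathbb{R}^n)$ are the usual ($L^2$-based, inhomogeneous) Sobolev spaces and $L^2=L^2(\mathbb{R}^n)$. The notation $f\lesssim g$ means $f\le Cg$ with a constant $C$ independent of $t\ge0$ and of the data $u_1,u_2$ (in the last estimate $C$ may depend on $\chi$). $\chi(D)$ denotes the Fourier multiplier (in $x$) with symbol $\chi(|\xi|)$. *)

theory Defs
  imports "HOL-Analysis.Analysis"
begin

section \<open>Functions of bounded variation and smooth functions on the real line\<close>

definition bounded_variation_on :: "(real \<Rightarrow> real) \<Rightarrow> real \<Rightarrow> real \<Rightarrow> bool" where
  "bounded_variation_on f p q \<longleftrightarrow>
     (\<exists>M. \<forall>(N::nat) (s :: nat \<Rightarrow> real).
        (\<forall>i\<le>N. s i \<in> {p..q}) \<and> (\<forall>i<N. s i \<le> s (Suc i)) \<longrightarrow>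
        (\<Sum>i<N. \<bar>f (s (Suc i)) - f (s i)\<bar>) \<le> M)"

definition smooth_real :: "(real \<Rightarrow> real) \<Rightarrow> bool" where
  "smooth_real f \<longleftrightarrow> (\<forall>k s. ((deriv ^^ k) f) differentiable (at s))"

definition cutoff :: "(real \<Rightarrow> real) \<Rightarrow> bool" where
  "cutoff \<eta> \<longleftrightarrow> smooth_real \<eta> \<and>
     eventually (\<lambda>s. \<eta> s = 0) (nhds 0) \<and> eventually (\<lambda>s. \<eta> s = 1) at_top"

section \<open>Square integrable functions\<close>

definition L2_fun :: "('a::euclidean_space \<Rightarrow> complex) set" where
  "L2_fun = {f \<in> borel_measurable borel. integrable lborel (\<lambda>x. (cmod (f x))\<^sup>2)}"

definition L2_fun_norm :: "('a::euclidean_space \<Rightarrow> complex) \<Rightarrow> real" where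
  "L2_fun_norm f = sqrt (LINT x|lborel. (cmod (f x))\<^sup>2)"

section \<open>Schwartz functions and the Fourier transform\<close>

definition partial :: "'a::euclidean_space \<Rightarrow> ('a \<Rightarrow> complex) \<Rightarrow> 'a \<Rightarrow> complex" where
  "partial e f x = frechet_derivative f (at x) e"

definition laplacian :: "('a::euclidean_space \<Rightarrow> complex) \<Rightarrow> 'a \<Rightarrow> complex" where
  "laplacian f x = (\<Sum>e\<in>Basis. partial e (partial e f) x)"

text \<open>A list \<^term>\<open>es\<close> of basis vectors stands for the iterated partial derivative
  \<^term>\<open>foldr partial es\<close>.\<close>

definition schwartz :: "('a::euclidean_space \<Rightarrow> complex) set" where
  "schwartz = {f. \<forall>es\<in>lists Basis.
     (\<forall>x. (foldr partial es f) differentiable (at x)) \<and>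
     (\<forall>k::nat. bounded (range (\<lambda>x. (1 + norm x) ^ k *\<^sub>R foldr partial es f x)))}"

definition schwartz_norm :: "nat \<Rightarrow> ('a::euclidean_space \<Rightarrow> complex) \<Rightarrow> real" where
  "schwartz_norm N f =
     (\<Sum>es\<in>{es. set es \<subseteq> Basis \<and> length es \<le> N}.
        SUP x. (1 + norm x) ^ N * cmod (foldr partial es f x))"

definition fourier :: "('a::euclidean_space \<Rightarrow> complex) \<Rightarrow> 'a \<Rightarrow> complex" where
  "fourier f \<xi> = of_real ((2 * pi) powr (- real DIM('a) / 2)) *
     (LINT x|lborel. cis (- (x \<bullet> \<xi>)) * f x)"

definition inverse_fourier :: "('a::euclidean_space \<Rightarrow> complex) \<Rightarrow> 'a \<Rightarrow> complex" where
  "inverse_fourier f x = of_real ((2 * pi) powr (- real DIM('a) / 2)) *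
     (LINT \<xi>|lborel. cis (x \<bullet> \<xi>) * f \<xi>)"

section \<open>Tempered distributions\<close>

text \<open>A distribution is a functional on all functions of which only the values on
  \<^const>\<open>schwartz\<close> are meaningful; every notion below depends on these values only.\<close>

type_synonym 'a distribution = "('a \<Rightarrow> complex) \<Rightarrow> complex"

definition eq_dist :: "'a::euclidean_space distribution \<Rightarrow> 'a distribution \<Rightarrow> bool" where
  "eq_dist v w \<longleftrightarrow> (\<forall>\<phi>\<in>schwartz. v \<phi> = w \<phi>)"

definition tempered :: "'a::euclidean_space distribution set" where
  "tempered = {v.
     (\<forall>\<phi>\<in>schwartz. \<forall>\<psi>\<in>schwartz. \<forall>c. v (\<lambda>x. \<phi> x + c * \<psi> x) = v \<phi> + c * v \<psi>) \<and>
     (\<exists>C N. \<forall>\<phi>\<in>schwartz. cmod (v \<phi>) \<le> C * schwartz_norm N \<phi>)}"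

text \<open>The distribution \<^term>\<open>v\<close> is given by integration against the function \<^term>\<open>g\<close>.
  Such a \<^term>\<open>g\<close> is unique up to a null set, so it does not matter which one
  \<open>density_of\<close> picks.\<close>

definition has_density :: "'a::euclidean_space distribution \<Rightarrow> ('a \<Rightarrow> complex) \<Rightarrow> bool" where
  "has_density v g \<longleftrightarrow> g \<in> borel_measurable borel \<and>
     (\<forall>\<phi>\<in>schwartz. integrable lborel (\<lambda>x. g x * \<phi> x) \<and> v \<phi> = (LINT x|lborel. g x * \<phi> x))"

definition density_of :: "'a::euclidean_space distribution \<Rightarrow> 'a \<Rightarrow> complex" where
  "density_of v = (SOME g. has_density v g)"

definition dist_partial :: "'a::euclidean_space \<Rightarrow> 'a distribution \<Rightarrow> 'a distribution" where
  "dist_partial e v = (\<lambda>\<phi>. - v (partial e \<phi>))"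

definition dist_laplacian :: "'a::euclidean_space distribution \<Rightarrow> 'a distribution" where
  "dist_laplacian v = (\<lambda>\<phi>. v (laplacian \<phi>))"

definition dist_fourier :: "'a::euclidean_space distribution \<Rightarrow> 'a distribution" where
  "dist_fourier v = (\<lambda>\<phi>. v (fourier \<phi>))"

text \<open>The multiplier with symbol \<^term>\<open>m\<close>, for distributions whose Fourier transform is a
  function: the inverse Fourier transform of \<^term>\<open>m\<close> times that function.\<close>

definition fourier_multiplier ::
    "('a::euclidean_space \<Rightarrow> complex) \<Rightarrow> 'a distribution \<Rightarrow> 'a distribution" where
  "fourier_multiplier m v =
     (\<lambda>\<phi>. LINT \<xi>|lborel. m \<xi> * density_of (dist_fourier v) \<xi> * inverse_fourier \<phi> \<xi>)"

definition cutoff_multiplier ::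
    "(real \<Rightarrow> real) \<Rightarrow> 'a::euclidean_space distribution \<Rightarrow> 'a distribution" where
  "cutoff_multiplier \<eta> = fourier_multiplier (\<lambda>\<xi>. of_real (\<eta> (norm \<xi>)))"

section \<open>The spaces \<open>L\<^sup>2\<close> and \<open>H\<^sup>s\<close>\<close>

definition L2 :: "'a::euclidean_space distribution set" where
  "L2 = {v. \<exists>f\<in>L2_fun. has_density v f}"

definition L2_norm :: "'a::euclidean_space distribution \<Rightarrow> real" where
  "L2_norm v = L2_fun_norm (density_of v)"

definition sobolev_weight :: "real \<Rightarrow> ('a::euclidean_space \<Rightarrow> complex) \<Rightarrow> 'a \<Rightarrow> complex" where
  "sobolev_weight s g \<xi> = of_real ((1 + (norm \<xi>)\<^sup>2) powr (s / 2)) * g \<xi>"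

definition sobolev :: "real \<Rightarrow> 'a::euclidean_space distribution set" where
  "sobolev s = {v \<in> tempered. \<exists>g. has_density (dist_fourier v) g \<and> sobolev_weight s g \<in> L2_fun}"

definition sobolev_norm :: "real \<Rightarrow> 'a::euclidean_space distribution \<Rightarrow> real" where
  "sobolev_norm s v = L2_fun_norm (sobolev_weight s (density_of (dist_fourier v)))"

text \<open>\<open>L\<^sup>2\<close> membership and norm of the gradient of \<^term>\<open>v\<close>, to whose components an
  operator \<^term>\<open>A\<close> is applied.\<close>

definition grad_in_L2 ::
    "('a::euclidean_space distribution \<Rightarrow> 'a distribution) \<Rightarrow> 'a distribution \<Rightarrow> bool" where
  "grad_in_L2 A v \<longleftrightarrow> (\<forall>e\<in>Basis. A (dist_partial e v) \<in> L2)"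

definition grad_L2_norm ::
    "('a::euclidean_space distribution \<Rightarrow> 'a distribution) \<Rightarrow> 'a distribution \<Rightarrow> real" where
  "grad_L2_norm A v = sqrt (\<Sum>e\<in>Basis. (L2_norm (A (dist_partial e v)))\<^sup>2)"

section \<open>The Cauchy problem\<close>

definition sobolev_continuous :: "real \<Rightarrow> (real \<Rightarrow> 'a::euclidean_space distribution) \<Rightarrow> bool" where
  "sobolev_continuous s v \<longleftrightarrow> (\<forall>t\<ge>0. v t \<in> sobolev s \<and>
     ((\<lambda>\<tau>. sobolev_norm s (\<lambda>\<phi>. v \<tau> \<phi> - v t \<phi>)) \<longlongrightarrow> 0) (at t within {0..}))"

definition sobolev_derivative ::
    "real \<Rightarrow> (real \<Rightarrow> 'a::euclidean_space distribution) \<Rightarrow> (real \<Rightarrow> 'a distribution) \<Rightarrow> bool" where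
  "sobolev_derivative s v w \<longleftrightarrow> (\<forall>t\<ge>0.
     ((\<lambda>\<tau>. sobolev_norm s (\<lambda>\<phi>. (v \<tau> \<phi> - v t \<phi>) / of_real (\<tau> - t) - w t \<phi>)) \<longlongrightarrow> 0)
       (at t within {0..}))"

text \<open>The function \<^term>\<open>u\<close>, with time derivative \<^term>\<open>ut\<close>, solves
  \<open>u\<^sub>t\<^sub>t - \<Delta>u + 2b(t)u\<^sub>t = 0\<close>, \<open>u(0) = u\<^sub>1\<close>, \<open>u\<^sub>t(0) = u\<^sub>2\<close> for \<open>t \<ge> 0\<close>.
  The solution class is the intersection of \<open>C\<^sup>j([0,\<infinity>); H\<^sup>-\<^sup>j)\<close>, \<open>j = 0, 1, 2\<close>
  (where \<open>H\<^sup>0 = L\<^sup>2\<close>), the natural class for data in \<open>L\<^sup>2 \<times> H\<^sup>-\<^sup>1\<close>.\<close>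

definition damped_wave_solution ::
    "(real \<Rightarrow> real) \<Rightarrow> 'a::euclidean_space distribution \<Rightarrow> 'a distribution \<Rightarrow>
     (real \<Rightarrow> 'a distribution) \<Rightarrow> (real \<Rightarrow> 'a distribution) \<Rightarrow> bool" where
  "damped_wave_solution b u1 u2 u ut \<longleftrightarrow>
     (\<exists>utt.
        sobolev_continuous 0 u \<and>
        sobolev_continuous (-1) ut \<and> sobolev_derivative (-1) u ut \<and>
        sobolev_continuous (-2) utt \<and> sobolev_derivative (-2) ut utt \<and>
        (\<forall>t\<ge>0. eq_dist
           (\<lambda>\<phi>. utt t \<phi> - dist_laplacian (u t) \<phi> + 2 * of_real (b t) * ut t \<phi>) (\<lambda>\<phi>. 0))) \<and>
     eq_dist (u 0) u1 \<and> eq_dist (ut 0) u2"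

end

theory Submission
  imports Defs "HOL-Probability.Probability"
begin

text \<open>
  The Fourier transform in \<open>x\<close> turns the equation into the family of oscillators
  \<open>y'' + r\<^sup>2 y + 2 b(t) y' = 0\<close> with \<open>r = \<bar>\<xi>\<bar>\<close>, and all estimates follow from one decay estimate for
  this family. The energy \<open>\<bar>y'\<bar>\<^sup>2 + r\<^sup>2 \<bar>y\<bar>\<^sup>2\<close> has the derivative \<open>-4 b \<bar>y'\<bar>\<^sup>2\<close>, which does
  not involve \<open>y\<close> and degenerates where \<open>b\<close> is close to zero. Both defects disappear for the functional
  \<open>q = \<alpha> (\<bar>y'\<bar>\<^sup>2 + r\<^sup>2 \<bar>y\<bar>\<^sup>2) + 2 \<gamma> Re (y \<cdot> cnj y') + \<bar>y\<bar>\<^sup>2\<close> with two periodic functions of time: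

  \<^item> \<open>\<gamma>\<close> is the positive periodic solution of \<open>\<gamma>' = 2 b \<gamma> - 1\<close> (\<open>periodic_backward_solution\<close>). Then the
    coefficient of \<open>Re (y \<cdot> cnj y')\<close> in \<open>q'\<close> vanishes for every \<open>r\<close> at once, and
    \<open>q' = (\<alpha>' - 4 b \<alpha> + 2 \<gamma>) \<bar>y'\<bar>\<^sup>2 + (\<alpha>' - 2 \<gamma>) r\<^sup>2 \<bar>y\<bar>\<^sup>2\<close>.
  \<^item> \<open>\<alpha>\<close> stays above a large number \<open>n\<close> and has the derivative \<open>min (2 \<gamma>) (4 b n - 2 \<gamma>) - \<mu>\<close>, where \<open>\<mu>\<close> is the
    mean of the minimum over a period (\<open>periodic_weight\<close>). Since \<open>b > 0\<close> almost everywhere, the minimum tends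
    to \<open>2 \<gamma>\<close> as \<open>n\<close> grows, so that \<open>\<mu> > 0\<close> for some \<open>n\<close>. Both coefficients in \<open>q'\<close> are then at most \<open>-\<mu>\<close>.

  As \<open>q\<close> is comparable to \<open>\<bar>y'\<bar>\<^sup>2 + (1 + r\<^sup>2) \<bar>y\<bar>\<^sup>2\<close>, it decays with the rate \<open>\<kappa> \<rho>\<close>, \<open>\<rho> = r\<^sup>2 / (1 + r\<^sup>2)\<close>,
  uniformly in \<open>r\<close>. The rate is bounded below away from \<open>r = 0\<close>, which gives the exponential estimate.
  Near \<open>r = 0\<close> it is comparable to \<open>r\<^sup>2\<close>, and \<open>\<rho> exp (- \<kappa> \<rho> t) \<lesssim> 1 / (1 + t)\<close> gives the estimate of the gradient.
  At low frequencies \<open>y'\<close> is smaller still, since it relaxes exponentially to a multiple of the force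
  \<open>r\<^sup>2 y\<close>. A second weight \<open>h\<close> with \<open>h' = 4 b h - 1\<close> expresses this (\<open>low_frequency_velocity\<close>).

  A solution consists of distributions whose time derivatives exist in Sobolev norms only; there is
  no differential equation at a single \<open>\<xi>\<close>. All inequalities are therefore integrated over
  \<open>\<bar>\<xi>\<bar> \<le> R\<close> against weights \<open>m(\<xi>) \<ge> 0\<close>, and \<open>R \<rightarrow> \<infinity>\<close> at the end. The factor \<open>exp (\<kappa> \<rho> t)\<close>, which depends on
  \<open>\<xi>\<close> and on \<open>t\<close>, is replaced by its Taylor polynomial of degree two (\<open>polynomial_decay\<close>), whose terms are
  powers of \<open>t\<close> times such weights.

  The passage to the frequency side rests on three facts about the Fourier transform: inversion on
  Schwartz functions (\<open>fourier_inversion\<close>), the bounded extension to \<open>L\<^sup>2\<close> (\<open>fourier_L2_extension\<close>), and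
  the uniqueness of densities (\<open>density_zero_unique\<close>).
\<close>

section \<open>Schwartz functions\<close>

text \<open>Iterated derivatives never have to be computed: it suffices to exhibit a class of decaying functions
  that is closed under partial derivatives. The closure properties of \<^const>\<open>schwartz\<close> below rest on this principle.\<close>

lemma schwartz_coinduct:
  assumes "f \<in> K"
    and diff: "\<And>g x. g \<in> K \<Longrightarrow> g differentiable (at x)"
    and part: "\<And>g e. g \<in> K \<Longrightarrow> e \<in> Basis \<Longrightarrow> partial e g \<in> K"
    and decay: "\<And>g k. g \<in> K \<Longrightarrow> \<exists>C. \<forall>x. (1 + norm x) ^ k * cmod (g x) \<le> C"
  shows "f \<in> schwartz"
proof -
  have K: "foldr partial es f \<in> K" if "es \<in> lists Basis" for es
    using that by (induction es) (auto simp: \<open>f \<in> K\<close> part)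
  have "bounded (range (\<lambda>x. (1 + norm x) ^ k *\<^sub>R foldr partial es f x))"
    if es: "es \<in> lists Basis" for es k
  proof -
    obtain C where "\<And>x. (1 + norm x) ^ k * cmod (foldr partial es f x) \<le> C"
      using decay[OF K[OF es]] by blast
    then show ?thesis
      by (auto simp: bounded_iff abs_mult intro!: exI[of _ C])
  qed
  then show ?thesis
    using K diff by (auto simp: schwartz_def)
qed

lemma schwartz_differentiable: "f \<in> schwartz \<Longrightarrow> f differentiable (at x)"
  by (auto simp: schwartz_def dest: bspec[where x="[]"])

lemma schwartz_has_derivative:
  "f \<in> schwartz \<Longrightarrow> (f has_derivative frechet_derivative f (at x)) (at x)"
  using schwartz_differentiable frechet_derivative_works by blast

lemma schwartz_partial:
  fixes f :: "'a::euclidean_space \<Rightarrow> complex"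
  shows "f \<in> schwartz \<Longrightarrow> e \<in> Basis \<Longrightarrow> partial e f \<in> schwartz"
  by (unfold schwartz_def, safe) (drule_tac x="es @ [e]" in bspec; auto)+

lemma schwartz_decay:
  assumes "f \<in> schwartz"
  obtains C where "C > 0" "\<And>x. (1 + norm x) ^ k * cmod (f x) \<le> C"
proof -
  have "bounded (range (\<lambda>x. (1 + norm x) ^ k *\<^sub>R f x))"
    using assms by (auto simp: schwartz_def dest: bspec[where x="[]"])
  then obtain C where "C > 0" "\<And>x. norm ((1 + norm x) ^ k *\<^sub>R f x) \<le> C"
    unfolding bounded_pos by auto
  then show thesis by (intro that[of C]) (auto simp: abs_mult)
qed

lemma schwartz_continuous: "f \<in> schwartz \<Longrightarrow> continuous_on A f"
  by (meson continuous_at_imp_continuous_on differentiable_imp_continuous_within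
      schwartz_differentiable)

lemma schwartz_measurable: "f \<in> schwartz \<Longrightarrow> f \<in> borel_measurable borel"
  by (rule borel_measurable_continuous_onI[OF schwartz_continuous])

lemma partial_eq: "(f has_derivative D) (at x) \<Longrightarrow> partial e f x = D e"
  unfolding partial_def by (metis frechet_derivative_at)

lemma schwartz_lincomb:
  fixes f g :: "'a::euclidean_space \<Rightarrow> complex"
  assumes "f \<in> schwartz" "g \<in> schwartz"
  shows "(\<lambda>x. f x + c * g x) \<in> schwartz"
proof (rule schwartz_coinduct)
  let ?K = "{\<lambda>x. f x + c * g x |f g. f \<in> schwartz \<and> g \<in> (schwartz :: ('a \<Rightarrow> complex) set)}"
  show "(\<lambda>x. f x + c * g x) \<in> ?K" using assms by auto
  fix h assume "h \<in> ?K"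
  then obtain f g where h: "h = (\<lambda>x. f x + c * g x)" and fg: "f \<in> schwartz" "g \<in> schwartz"
    by auto
  note D = schwartz_has_derivative[OF fg(1)] schwartz_has_derivative[OF fg(2)]
  have *: "(h has_derivative (\<lambda>v. frechet_derivative f (at x) v + c * frechet_derivative g (at x) v)) (at x)"
    for x unfolding h by (intro derivative_intros D)
  show "h differentiable (at x)" for x using * by (auto simp: differentiable_def)
  show "partial e h \<in> ?K" if "e \<in> Basis" for e
  proof -
    have "partial e h = (\<lambda>x. partial e f x + c * partial e g x)"
      by (rule ext, subst partial_eq[OF *]) (simp add: partial_def)
    then show ?thesis using fg that schwartz_partial by blast
  qed
  fix k
  obtain A B where A: "\<And>x. (1 + norm x) ^ k * cmod (f x) \<le> A"
    and B: "\<And>x. (1 + norm x) ^ k * cmod (g x) \<le> B"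
    using schwartz_decay[OF fg(1)] schwartz_decay[OF fg(2)] by metis
  have "(1 + norm x) ^ k * cmod (h x) \<le> A + cmod c * B" for x
  proof -
    have "(1 + norm x) ^ k * cmod (h x) \<le> (1 + norm x) ^ k * (cmod (f x) + cmod c * cmod (g x))"
      unfolding h
      by (intro mult_left_mono order_trans[OF norm_triangle_ineq]) (auto simp: norm_mult)
    also have "\<dots> = (1 + norm x) ^ k * cmod (f x) + cmod c * ((1 + norm x) ^ k * cmod (g x))"
      by (simp add: algebra_simps)
    also have "\<dots> \<le> A + cmod c * B"
      by (intro add_mono mult_left_mono A B) auto
    finally show ?thesis .
  qed
  then show "\<exists>C. \<forall>x. (1 + norm x) ^ k * cmod (h x) \<le> C" by blast
qed

lemma schwartz_zero: "(\<lambda>x. 0) \<in> schwartz"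
proof (rule schwartz_coinduct)
  have *: "partial e (\<lambda>x. 0) = (\<lambda>x::'a. 0)" for e
    by (rule ext, subst partial_eq[OF has_derivative_const]) simp
  then show "partial e g \<in> {\<lambda>x::'a. 0}" if "g \<in> {\<lambda>x::'a. 0}" for g e using that by auto
qed auto

lemma schwartz_cmult: "f \<in> schwartz \<Longrightarrow> (\<lambda>x. c * f x) \<in> schwartz"
  using schwartz_lincomb[OF schwartz_zero, of f c] by simp

lemma schwartz_sum:
  assumes "finite I" "\<And>i. i \<in> I \<Longrightarrow> f i \<in> schwartz"
  shows "(\<lambda>x. \<Sum>i\<in>I. f i x) \<in> schwartz"
  using assms
proof (induction I)
  case (insert i I)
  then show ?case using schwartz_lincomb[of "f i" "\<lambda>x. \<Sum>i\<in>I. f i x" 1] by simp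
qed (simp add: schwartz_zero)

text \<open>The product rule produces a term without the factor \<open>x \<bullet> a\<close>. The class used for the coinduction
  therefore consists of the sums \<open>(x \<bullet> a) f + g\<close>.\<close>

lemma schwartz_coord_mult:
  fixes f :: "'a::euclidean_space \<Rightarrow> complex"
  assumes "f \<in> schwartz"
  shows "(\<lambda>x. of_real (x \<bullet> a) * f x) \<in> schwartz"
proof (rule schwartz_coinduct)
  let ?K = "{\<lambda>x. of_real (x \<bullet> a) * f x + g x |f g. f \<in> schwartz \<and> g \<in> (schwartz :: ('a \<Rightarrow> complex) set)}"
  show "(\<lambda>x. of_real (x \<bullet> a) * f x) \<in> ?K"
    using assms schwartz_zero by (intro CollectI exI[of _ f] exI[of _ "\<lambda>x. 0"]) simp
  fix h assume "h \<in> ?K"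
  then obtain f g where h: "h = (\<lambda>x. of_real (x \<bullet> a) * f x + g x)"
    and fg: "f \<in> schwartz" "g \<in> schwartz"
    by auto
  note D = schwartz_has_derivative[OF fg(1)] schwartz_has_derivative[OF fg(2)]
  have *: "(h has_derivative (\<lambda>v. of_real (x \<bullet> a) * frechet_derivative f (at x) v
      + of_real (v \<bullet> a) * f x + frechet_derivative g (at x) v)) (at x)"
    for x unfolding h by (rule derivative_eq_intros D refl | simp)+
  show "h differentiable (at x)" for x using * by (auto simp: differentiable_def)
  show "partial e h \<in> ?K" if "e \<in> Basis" for e
  proof -
    have "partial e h = (\<lambda>x. of_real (x \<bullet> a) * partial e f x + (partial e g x + of_real (e \<bullet> a) * f x))"
      by (rule ext, subst partial_eq[OF *]) (simp add: partial_def)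
    moreover have "(\<lambda>x. partial e g x + of_real (e \<bullet> a) * f x) \<in> schwartz"
      using fg that by (intro schwartz_lincomb schwartz_partial)
    ultimately show ?thesis
      using schwartz_partial[OF fg(1) that]
      by (intro CollectI exI[of _ "partial e f"] exI[of _ "\<lambda>x. partial e g x + of_real (e \<bullet> a) * f x"]) auto
  qed
  fix k
  obtain A where A: "\<And>x. (1 + norm x) ^ Suc k * cmod (f x) \<le> A"
    using schwartz_decay[OF fg(1)] by blast
  obtain B where B: "\<And>x. (1 + norm x) ^ k * cmod (g x) \<le> B"
    using schwartz_decay[OF fg(2)] by blast
  have "(1 + norm x) ^ k * cmod (h x) \<le> norm a * A + B" for x
  proof -
    have "cmod (h x) \<le> norm a * ((1 + norm x) * cmod (f x)) + cmod (g x)"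
    proof -
      have "\<bar>x \<bullet> a\<bar> \<le> norm a * (1 + norm x)"
        using Cauchy_Schwarz_ineq2[of x a] norm_ge_zero[of a] unfolding mult.commute[of "norm x"] distrib_left
        by linarith
      then have "\<bar>x \<bullet> a\<bar> * cmod (f x) \<le> norm a * ((1 + norm x) * cmod (f x))"
        by (metis mult.assoc mult_right_mono norm_ge_zero)
      then show ?thesis
        using norm_triangle_ineq[of "of_real (x \<bullet> a) * f x" "g x"]
        unfolding h by (simp add: norm_mult)
    qed
    then have "(1 + norm x) ^ k * cmod (h x)
        \<le> (1 + norm x) ^ k * (norm a * ((1 + norm x) * cmod (f x)) + cmod (g x))"
      by (intro mult_left_mono) auto
    also have "\<dots> = norm a * ((1 + norm x) ^ Suc k * cmod (f x)) + ((1 + norm x) ^ k * cmod (g x))"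
      by (simp add: algebra_simps)
    also have "\<dots> \<le> norm a * A + B"
      by (intro add_mono mult_left_mono A B) auto
    finally show ?thesis .
  qed
  then show "\<exists>C. \<forall>x. (1 + norm x) ^ k * cmod (h x) \<le> C" by blast
qed

lemma schwartz_reflect:
  fixes f :: "'a::euclidean_space \<Rightarrow> complex"
  assumes "f \<in> schwartz"
  shows "(\<lambda>x. f (- x)) \<in> schwartz"
proof (rule schwartz_coinduct)
  let ?K = "{\<lambda>x. f (- x) |f. f \<in> (schwartz :: ('a \<Rightarrow> complex) set)}"
  show "(\<lambda>x. f (- x)) \<in> ?K" using assms by auto
  fix h assume "h \<in> ?K"
  then obtain f where h: "h = (\<lambda>x. f (- x))" and f: "f \<in> schwartz" by auto
  have *: "(h has_derivative (\<lambda>v. frechet_derivative f (at (- x)) (- v))) (at x)" for x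
    unfolding h
    using diff_chain_at[of uminus uminus x f "frechet_derivative f (at (- x))"]
      schwartz_has_derivative[OF f, of "- x"]
    by (auto simp: o_def intro: derivative_intros)
  show "h differentiable (at x)" for x using * by (auto simp: differentiable_def)
  show "partial e h \<in> ?K" if "e \<in> Basis" for e
  proof -
    have "partial e h = (\<lambda>x. (\<lambda>y. -1 * partial e f y) (- x))"
      by (rule ext, subst partial_eq[OF *])
        (simp add: partial_def linear_neg[OF has_derivative_linear[OF schwartz_has_derivative[OF f]]])
    moreover have "(\<lambda>y. -1 * partial e f y) \<in> schwartz"
      by (intro schwartz_cmult schwartz_partial f that)
    ultimately show ?thesis by (intro CollectI exI[of _ "\<lambda>y. -1 * partial e f y"]) simp
  qed
  fix k
  obtain A where A: "\<And>x. (1 + norm x) ^ k * cmod (f x) \<le> A"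
    using schwartz_decay[OF f] by metis
  have "(1 + norm x) ^ k * cmod (h x) \<le> A" for x
    using A[of "- x"] unfolding h by simp
  then show "\<exists>C. \<forall>x. (1 + norm x) ^ k * cmod (h x) \<le> C" by blast
qed

section \<open>Integrability of rapidly decreasing functions\<close>

lemma integrable_inverse_square: "integrable lborel (\<lambda>x::real. 1 / (1 + \<bar>x\<bar>)\<^sup>2)"
proof -
  have pos: "set_integrable lborel {0..} (\<lambda>x::real. 1 / (1 + x)\<^sup>2)"
  proof -
    have "(\<integral>\<^sup>+x. ennreal (1 / (1 + x)\<^sup>2) * indicator {0..} x \<partial>lborel) = ennreal (0 - (- 1 / (1 + 0)))"
    proof (rule nn_integral_FTC_atLeast)
      show "DERIV (\<lambda>x. - 1 / (1 + x)) x :> 1 / (1 + x)\<^sup>2" if "0 \<le> x" for x :: real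
        using that by (auto intro!: derivative_eq_intros simp: power2_eq_square)
      show "((\<lambda>x::real. - 1 / (1 + x)) \<longlongrightarrow> 0) at_top"
        by real_asymp
    qed auto
    also have "(\<integral>\<^sup>+x. ennreal (1 / (1 + x)\<^sup>2) * indicator {0..} x \<partial>lborel)
        = (\<integral>\<^sup>+x. ennreal (indicator {0..} x *\<^sub>R (1 / (1 + x)\<^sup>2)) \<partial>lborel)"
      by (intro nn_integral_cong) (auto simp: indicator_def)
    finally show ?thesis
      unfolding set_integrable_def by (intro integrableI_nonneg) auto
  qed
  have neg: "integrable lborel (\<lambda>x::real. indicator {0..} (- x) *\<^sub>R (1 / (1 + - x)\<^sup>2))"
    using lborel_integrable_real_affine[OF pos[unfolded set_integrable_def], of "-1" 0] by simp
  have sum: "integrable lborel (\<lambda>x::real. indicator {0..} x *\<^sub>R (1 / (1 + x)\<^sup>2)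
      + indicator {0..} (- x) *\<^sub>R (1 / (1 + - x)\<^sup>2))"
    by (rule Bochner_Integration.integrable_add[OF pos[unfolded set_integrable_def] neg])
  show ?thesis
    by (rule Bochner_Integration.integrable_bound[OF sum]) (auto simp: indicator_def)
qed

lemma integrable_lborel_prod:
  fixes f :: "'a::euclidean_space \<Rightarrow> real \<Rightarrow> complex"
  assumes "\<And>b. b \<in> Basis \<Longrightarrow> integrable lborel (f b)"
  shows "integrable lborel (\<lambda>x::'a. \<Prod>b\<in>Basis. f b (x \<bullet> b))"
    and "(LINT x|lborel. (\<Prod>b\<in>Basis. f b ((x::'a) \<bullet> b))) = (\<Prod>b\<in>Basis. LINT x|lborel. f b x)"
proof -
  interpret product_sigma_finite "\<lambda>b::'a. lborel :: real measure" ..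
  have fm [measurable]: "f b \<in> borel_measurable borel" if "b \<in> Basis" for b
    using assms[OF that] by (metis borel_measurable_integrable measurable_lborel2)
  have eq: "(\<Prod>b\<in>Basis. f b ((\<Sum>b\<in>Basis. x b *\<^sub>R b) \<bullet> b)) = (\<Prod>b\<in>Basis. f b (x b))" for x
    by (intro prod.cong refl) simp
  have [measurable]: "(\<lambda>x::'a. \<Prod>b\<in>Basis. f b (x \<bullet> b)) \<in> borel_measurable borel"
    by (intro borel_measurable_prod measurable_compose[OF _ fm]) simp_all
  show "integrable lborel (\<lambda>x::'a. \<Prod>b\<in>Basis. f b (x \<bullet> b))"
    unfolding lborel_eq[where 'a='a]
    by (subst integrable_distr_eq) (auto simp: eq intro!: product_integrable_prod assms)
  show "(LINT x|lborel. (\<Prod>b\<in>Basis. f b ((x::'a) \<bullet> b))) = (\<Prod>b\<in>Basis. LINT x|lborel. f b x)"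
    unfolding lborel_eq[where 'a='a]
    by (subst integral_distr) (auto simp: eq intro!: product_integral_prod assms)
qed

text \<open>The comparison function is a product of one-dimensional weights \<open>1 / (1 + \<bar>x \<bullet> b\<bar>)\<^sup>2\<close>; this is where the
  exponent \<open>2 * DIM('a)\<close> comes from.\<close>

lemma integrable_norm_weight:
  "integrable lborel (\<lambda>x::'a::euclidean_space. 1 / (1 + norm x) ^ (2 * DIM('a)))"
proof -
  have "integrable lborel (\<lambda>x::'a. \<Prod>b\<in>Basis. complex_of_real (1 / (1 + \<bar>x \<bullet> b\<bar>)\<^sup>2))"
    by (rule integrable_lborel_prod(1)) (simp only: integrable_inverse_square integrable_of_real)
  then show ?thesis
  proof (rule Bochner_Integration.integrable_bound)
    have "1 / (1 + norm x) ^ (2 * DIM('a)) \<le> (\<Prod>b\<in>Basis. (1 / (1 + \<bar>x \<bullet> b\<bar>)\<^sup>2))" for x :: 'a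
    proof -
      have "(\<Prod>b\<in>(Basis::'a set). 1 / (1 + norm x)\<^sup>2) \<le> (\<Prod>b\<in>Basis. (1 / (1 + \<bar>x \<bullet> b\<bar>)\<^sup>2))"
        by (intro prod_mono conjI divide_left_mono power_mono)
          (auto simp: Basis_le_norm intro!: mult_pos_pos zero_less_power add_pos_nonneg)
      then show ?thesis by (simp add: power_mult power_divide)
    qed
    moreover have "norm (\<Prod>b\<in>Basis. complex_of_real (1 / (1 + \<bar>x \<bullet> b\<bar>)\<^sup>2))
        = (\<Prod>b\<in>Basis. (1 / (1 + \<bar>x \<bullet> b\<bar>)\<^sup>2))" for x :: 'a
      by (subst prod_norm[symmetric], rule prod.cong[OF refl], subst norm_of_real) simp
    moreover have "norm (1 / (1 + norm x) ^ (2 * DIM('a))) = 1 / (1 + norm x) ^ (2 * DIM('a))" for x :: 'a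
      by simp
    ultimately show "AE x in (lborel :: 'a measure). norm (1 / (1 + norm x) ^ (2 * DIM('a)))
        \<le> norm (\<Prod>b\<in>Basis. complex_of_real (1 / (1 + \<bar>x \<bullet> b\<bar>)\<^sup>2))"
      by (intro AE_I2) (simp only:)
  qed simp
qed

lemma integrable_decay:
  fixes f :: "'a::euclidean_space \<Rightarrow> 'b::{banach, second_countable_topology}"
  assumes "f \<in> borel_measurable borel"
    and "\<And>x. (1 + norm x) ^ (2 * DIM('a)) * norm (f x) \<le> C"
  shows "integrable lborel f"
proof (rule Bochner_Integration.integrable_bound)
  show "integrable lborel (\<lambda>x::'a. C * (1 / (1 + norm x) ^ (2 * DIM('a))))"
    by (intro integrable_mult_right integrable_norm_weight)
  have "norm (f x) \<le> C * (1 / (1 + norm x) ^ (2 * DIM('a)))" for x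
    using assms(2)[of x] by (simp add: pos_le_divide_eq add_pos_nonneg mult.commute)
  then show "AE x in lborel. norm (f x) \<le> norm (C * (1 / (1 + norm x) ^ (2 * DIM('a))))"
    by (intro AE_I2 order_trans[OF _ abs_ge_self, of "norm _", folded real_norm_def]) simp
qed (use assms in auto)

lemma schwartz_integrable: 
  fixes f :: "'a::euclidean_space \<Rightarrow> complex"
  assumes "f \<in> schwartz" shows "integrable lborel f"
proof -
  obtain C where "\<And>x. (1 + norm x) ^ (2 * DIM('a)) * cmod (f x) \<le> C"
    using schwartz_decay[OF assms] by blast
  then show ?thesis
    by (rule integrable_decay[OF schwartz_measurable[OF assms]])
qed

lemma schwartz_weight_integrable:
  fixes f :: "'a::euclidean_space \<Rightarrow> complex"
  assumes "f \<in> schwartz" shows "integrable lborel (\<lambda>x. norm x ^ k * cmod (f x))"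
proof -
  obtain C where C: "\<And>x. (1 + norm x) ^ (2 * DIM('a) + k) * cmod (f x) \<le> C"
    using schwartz_decay[OF assms] by metis
  note [measurable] = schwartz_measurable[OF assms]
  have "(1 + norm x) ^ (2 * DIM('a)) * norm (norm x ^ k * cmod (f x)) \<le> C" for x
  proof -
    have "(1 + norm x) ^ (2 * DIM('a)) * (norm x ^ k * cmod (f x))
      \<le> (1 + norm x) ^ (2 * DIM('a)) * ((1 + norm x) ^ k * cmod (f x))"
      by (intro mult_left_mono mult_right_mono power_mono) auto
    also have "\<dots> \<le> C" using C[of x] by (simp add: power_add mult.assoc)
    finally show ?thesis by simp
  qed
  then show ?thesis by (intro integrable_decay[where C=C]) measurable
qed

lemma schwartz_L2: "f \<in> schwartz \<Longrightarrow> f \<in> L2_fun"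
proof -
  fix f :: "'a \<Rightarrow> complex" assume f: "f \<in> schwartz"
  note [measurable] = schwartz_measurable[OF f]
  obtain C where C: "\<And>x. (1 + norm x) ^ (2 * DIM('a)) * cmod (f x) \<le> C"
    using schwartz_decay[OF f] by metis
  obtain B where B: "\<And>x. (1 + norm x) ^ 0 * cmod (f x) \<le> B"
    using schwartz_decay[OF f] by metis
  have B0: "0 \<le> B" using B[of 0] norm_ge_zero[of "f 0"] by (metis mult_1 order_trans power_0)
  have "(1 + norm x) ^ (2 * DIM('a)) * norm ((cmod (f x))\<^sup>2) \<le> C * B" for x
  proof -
    have "((1 + norm x) ^ (2 * DIM('a)) * cmod (f x)) * cmod (f x) \<le> C * B"
      using B[of x] C[of x] by (intro mult_mono) (auto intro: order_trans[OF _ C[of x]])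
    then show ?thesis by (simp add: power2_eq_square mult.assoc)
  qed
  then have "integrable lborel (\<lambda>x. (cmod (f x))\<^sup>2)"
    by (intro integrable_decay[where C="C * B"]) measurable
  then show "f \<in> L2_fun" by (simp add: L2_fun_def)
qed

section \<open>The Fourier transform of Schwartz functions\<close>

lemma measurable_cis [measurable (raw)]:
  "f \<in> borel_measurable M \<Longrightarrow> (\<lambda>x. cis (f x)) \<in> borel_measurable M"
  by (rule measurable_compose[of f M borel cis]) (auto intro!: borel_measurable_continuous_onI continuous_intros)

lemma integrable_cis_mult:
  fixes f :: "'a \<Rightarrow> complex"
  assumes "integrable M f" "g \<in> borel_measurable M"
  shows "integrable M (\<lambda>x. cis (g x) * f x)"
  using assms by (intro Bochner_Integration.integrable_bound[OF assms(1)]) (auto simp: norm_mult)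

lemma cis_taylor: "cmod (cis s - 1 - \<i> * s) \<le> s\<^sup>2"
proof -
  have "cmod (cis s - 1 - \<i> * s) \<le> \<bar>s\<bar>\<^sup>2 / 2"
    using iexp_approx1[of s 1] by (simp add: cis_conv_exp algebra_simps numeral_2_eq_2)
  also have "\<dots> \<le> s\<^sup>2" by simp
  finally show ?thesis .
qed

text \<open>Used for plane waves and for Fourier integrals, where Taylor's formula bounds the remainder
  explicitly and no limit has to be interchanged with an integral.\<close>

lemma has_derivative_quadratic_remainder:
  fixes F :: "'a::real_normed_vector \<Rightarrow> 'b::real_normed_vector"
  assumes "bounded_linear D" and le: "\<And>v. norm (F (x + v) - F x - D v) \<le> K * (norm v)\<^sup>2"
  shows "(F has_derivative D) (at x)"
  unfolding has_derivative_at
proof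
  show "(\<lambda>v. norm (F (x + v) - F x - D v) / norm v) \<midarrow>0\<rightarrow> 0"
  proof (rule tendsto_sandwich[of "\<lambda>_. 0"])
    have "norm (F (x + v) - F x - D v) / norm v \<le> K * norm v" for v
      using le[of v] by (cases "v = 0") (auto simp: divide_le_eq power2_eq_square mult.assoc)
    then show "\<forall>\<^sub>F v in at 0. norm (F (x + v) - F x - D v) / norm v \<le> K * norm v"
      by (intro always_eventually) blast
    show "((\<lambda>v::'a. K * norm v) \<longlongrightarrow> 0) (at 0)"
      by (auto intro!: tendsto_eq_intros)
  qed auto
qed fact

abbreviation (input) fourier_const :: "'a::euclidean_space itself \<Rightarrow> complex" where
  "fourier_const _ \<equiv> of_real ((2 * pi) powr (- real DIM('a) / 2))"

lemma fourier_lincomb: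
  assumes "integrable lborel f" "integrable lborel g"
  shows "fourier (\<lambda>x. f x + c * g x) \<xi> = fourier f \<xi> + c * fourier g \<xi>"
proof -
  have "(LINT x|lborel. cis (- (x \<bullet> \<xi>)) * (f x + c * g x))
      = (LINT x|lborel. cis (- (x \<bullet> \<xi>)) * f x + c * (cis (- (x \<bullet> \<xi>)) * g x))"
    by (simp add: algebra_simps)
  also have "\<dots> = (LINT x|lborel. cis (- (x \<bullet> \<xi>)) * f x) + c * (LINT x|lborel. cis (- (x \<bullet> \<xi>)) * g x)"
    using assms by (subst Bochner_Integration.integral_add) (auto intro!: integrable_cis_mult)
  finally show ?thesis by (simp add: fourier_def algebra_simps)
qed

lemma fourier_zero [simp]: "fourier (\<lambda>x. 0) = (\<lambda>\<xi>. 0)"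
  by (rule ext) (simp add: fourier_def)

lemma fourier_cmult: "fourier (\<lambda>x. c * f x) \<xi> = c * fourier f \<xi>"
proof -
  have "(LINT x|lborel. cis (- (x \<bullet> \<xi>)) * (c * f x)) = (LINT x|lborel. c * (cis (- (x \<bullet> \<xi>)) * f x))"
    by (simp add: algebra_simps)
  then show ?thesis by (simp add: fourier_def)
qed

lemma fourier_sum:
  assumes "finite I" "\<And>i. i \<in> I \<Longrightarrow> integrable lborel (f i)"
  shows "fourier (\<lambda>x. \<Sum>i\<in>I. f i x) \<xi> = (\<Sum>i\<in>I. fourier (f i) \<xi>)"
  using assms
proof (induction I)
  case (insert i I)
  then show ?case using fourier_lincomb[of "f i" "\<lambda>x. \<Sum>i\<in>I. f i x" 1 \<xi>] by simp
qed simp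

lemma norm_fourier_le: "cmod (fourier f \<xi>) \<le> cmod (fourier_const TYPE('a)) * (LINT x|lborel. cmod (f x))"
  for f :: "'a::euclidean_space \<Rightarrow> complex"
proof -
  have "cmod (LINT x|lborel. cis (- (x \<bullet> \<xi>)) * f x) \<le> (LINT x|lborel. cmod (cis (- (x \<bullet> \<xi>)) * f x))"
    by (rule integral_norm_bound)
  then show ?thesis unfolding fourier_def norm_mult
    by (intro mult_left_mono) (auto simp: norm_mult)
qed

text \<open>The first order Taylor remainder \<open>R\<close> of the plane wave is at most \<open>\<bar>v\<bar>\<^sup>2 \<bar>x\<bar>\<^sup>2\<close>, and \<open>\<bar>x\<bar>\<^sup>2 f\<close> is integrable.\<close>

lemma fourier_has_derivative:
  fixes f :: "'a::euclidean_space \<Rightarrow> complex"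
  assumes f: "f \<in> schwartz"
  shows "(fourier f has_derivative (\<lambda>v. fourier (\<lambda>x. - \<i> * (of_real (x \<bullet> v) * f x)) \<xi>)) (at \<xi>)"
proof (rule has_derivative_quadratic_remainder)
  let ?D = "\<lambda>v. fourier (\<lambda>x. - \<i> * (of_real (x \<bullet> v) * f x)) \<xi>"
  note [measurable] = schwartz_measurable[OF f]
  have int: "integrable lborel (\<lambda>x. of_real (x \<bullet> v) * f x)" for v
    by (intro schwartz_integrable schwartz_coord_mult f)
  have "linear ?D"
  proof
    fix v w :: 'a and r :: real
    have "(\<lambda>x. - \<i> * (of_real (x \<bullet> (v + w)) * f x))
        = (\<lambda>x. - \<i> * (of_real (x \<bullet> v) * f x) + - \<i> * (of_real (x \<bullet> w) * f x))"
      by (simp add: fun_eq_iff inner_add_right algebra_simps)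
    then show "?D (v + w) = ?D v + ?D w"
      by (simp only: fourier_lincomb[OF integrable_mult_right[OF int] int] fourier_cmult)
    have "(\<lambda>x. - \<i> * (of_real (x \<bullet> (r *\<^sub>R v)) * f x))
        = (\<lambda>x. of_real r * (- \<i> * (of_real (x \<bullet> v) * f x)))"
      by (simp add: fun_eq_iff algebra_simps)
    then show "?D (r *\<^sub>R v) = r *\<^sub>R ?D v"
      by (simp only: fourier_cmult scaleR_conv_of_real)
  qed
  then show "bounded_linear ?D" by (simp add: linear_conv_bounded_linear)
  fix v :: 'a
  define R :: "'a \<Rightarrow> complex" where "R x = cis (- (x \<bullet> v)) - 1 - \<i> * of_real (- (x \<bullet> v))" for x
  have [measurable]: "R \<in> borel_measurable borel" unfolding R_def by measurable
  have Rle: "cmod (R x) \<le> (norm v)\<^sup>2 * (norm x)\<^sup>2" for x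
  proof -
    have "cmod (R x) \<le> (x \<bullet> v)\<^sup>2" using cis_taylor[of "- (x \<bullet> v)"] by (simp add: R_def)
    also have "\<dots> = \<bar>x \<bullet> v\<bar>\<^sup>2" by simp
    also have "\<dots> \<le> (norm x * norm v)\<^sup>2" by (intro power_mono Cauchy_Schwarz_ineq2) auto
    finally show ?thesis by (simp add: power_mult_distrib mult.commute)
  qed
  have iw: "integrable lborel (\<lambda>x. (norm v)\<^sup>2 * ((norm x)\<^sup>2 * cmod (f x)))"
    by (intro integrable_mult_right schwartz_weight_integrable f)
  have Rf: "integrable lborel (\<lambda>x. R x * f x)"
  proof (rule Bochner_Integration.integrable_bound[OF iw])
    show "AE x in lborel. cmod (R x * f x) \<le> norm ((norm v)\<^sup>2 * ((norm x)\<^sup>2 * cmod (f x)))"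
      using mult_right_mono[OF Rle norm_ge_zero[of "f _"]] by (intro AE_I2) (simp add: norm_mult mult.assoc)
  qed measurable
  have eq: "cis (- (x \<bullet> (\<xi> + v))) * f x
      = cis (- (x \<bullet> \<xi>)) * (R x * f x + (f x + - \<i> * (of_real (x \<bullet> v) * f x)))" for x
  proof -
    have "cis (- (x \<bullet> (\<xi> + v))) = cis (- (x \<bullet> \<xi>)) * cis (- (x \<bullet> v))"
      by (simp add: cis_mult inner_add_right)
    then show ?thesis by (simp add: R_def algebra_simps)
  qed
  have "fourier f (\<xi> + v) = fourier (\<lambda>x. R x * f x + (f x + - \<i> * (of_real (x \<bullet> v) * f x))) \<xi>"
    unfolding fourier_def eq ..
  also have "\<dots> = fourier (\<lambda>x. R x * f x) \<xi> + (fourier f \<xi> + ?D v)"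
    using fourier_lincomb[OF schwartz_integrable[OF f] int[of v], of "- \<i>" \<xi>]
      fourier_lincomb[OF Rf, of "\<lambda>x. f x + - \<i> * (of_real (x \<bullet> v) * f x)" 1 \<xi>]
      schwartz_integrable[OF f] int[of v]
    by (simp add: fourier_cmult[of "- \<i>", simplified])
  finally have "cmod (fourier f (\<xi> + v) - fourier f \<xi> - ?D v) = cmod (fourier (\<lambda>x. R x * f x) \<xi>)"
    by simp
  also have "\<dots> \<le> cmod (fourier_const TYPE('a)) * (LINT x|lborel. cmod (R x * f x))"
    by (rule norm_fourier_le)
  also have "\<dots> \<le> cmod (fourier_const TYPE('a)) * (LINT x|lborel. (norm v)\<^sup>2 * ((norm x)\<^sup>2 * cmod (f x)))"
    using mult_right_mono[OF Rle norm_ge_zero[of "f _"]]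
    by (intro mult_left_mono integral_mono iw integrable_norm[OF Rf]) (auto simp: norm_mult mult.assoc)
  finally show "cmod (fourier f (\<xi> + v) - fourier f \<xi> - ?D v)
      \<le> cmod (fourier_const TYPE('a)) * (LINT x|lborel. (norm x)\<^sup>2 * cmod (f x)) * (norm v)\<^sup>2"
    by (subst (asm) integral_mult_right_zero) (simp only: mult_ac)
qed

lemma partial_fourier:
  "f \<in> schwartz \<Longrightarrow> partial e (fourier f) = fourier (\<lambda>x. - \<i> * (of_real (x \<bullet> e) * f x))"
  by (rule ext) (simp only: partial_eq[OF fourier_has_derivative])

lemma lborel_integral_shift:
  fixes f :: "'a::euclidean_space \<Rightarrow> 'b::{banach, second_countable_topology}"
  assumes [measurable]: "f \<in> borel_measurable borel"
  shows "(LINT x|lborel. f (c + x)) = (LINT x|lborel. f x)"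
proof -
  have "(LINT x|lborel. f x) = (LINT x|distr lborel borel ((+) c). f x)"
    by (simp add: lborel_distr_plus)
  then show ?thesis by (simp add: integral_distr)
qed

lemma has_vector_derivative_quotient:
  assumes "(g has_vector_derivative D) (at x)"
  shows "((\<lambda>t. (g (x + t) - g x) /\<^sub>R t) \<longlongrightarrow> D) (at 0)"
proof -
  have "((\<lambda>t. norm (g (x + t) - g x - t *\<^sub>R D) / norm t) \<longlongrightarrow> 0) (at 0)"
    using assms unfolding has_vector_derivative_def has_derivative_at by blast
  moreover have "norm (g (x + t) - g x - t *\<^sub>R D) / norm t = norm ((g (x + t) - g x) /\<^sub>R t - D)"
    if "t \<noteq> 0" for t
  proof -
    have "(g (x + t) - g x) /\<^sub>R t - D = (g (x + t) - g x - t *\<^sub>R D) /\<^sub>R t"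
      using that by (simp add: scaleR_diff_right)
    then show ?thesis by (simp add: divide_inverse mult.commute)
  qed
  ultimately have "((\<lambda>t. norm ((g (x + t) - g x) /\<^sub>R t - D)) \<longlongrightarrow> 0) (at 0)"
    by (elim Lim_transform_eventually) (auto simp: eventually_at_filter)
  then show ?thesis
    by (simp add: tendsto_norm_zero_iff LIM_zero_iff)
qed

text \<open>By translation invariance the difference quotients of \<open>G\<close> in the direction \<open>e\<close> have integral zero. The
  mean value inequality provides a majorant for them, so dominated convergence applies.\<close>

lemma integral_directional_derivative_zero:
  fixes G :: "'a::euclidean_space \<Rightarrow> complex"
  assumes der: "\<And>x. (G has_derivative D x) (at x)" and e: "e \<in> Basis"
    and [measurable]: "(\<lambda>x. D x e) \<in> borel_measurable borel"
    and G: "integrable lborel G"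
    and DC: "\<And>x. (1 + norm x) ^ (2 * DIM('a)) * cmod (D x e) \<le> C"
  shows "(LINT x|lborel. D x e) = 0"
proof -
  let ?N = "2 * DIM('a)"
  let ?h = "\<lambda>n. 1 / real (Suc n)"
  define d where "d n x = (G (?h n *\<^sub>R e + x) - G x) /\<^sub>R ?h n" for n x
  have [measurable]: "G \<in> borel_measurable borel"
    using G by simp
  have "(\<lambda>n. LINT x|lborel. d n x) \<longlonglongrightarrow> (LINT x|lborel. D x e)"
  proof (rule integral_dominated_convergence)
    show "integrable lborel (\<lambda>x::'a. C * 2 ^ ?N * (1 / (1 + norm x) ^ ?N))"
      by (intro integrable_mult_right integrable_norm_weight)
    show "AE x in lborel. (\<lambda>n. d n x) \<longlonglongrightarrow> D x e"
    proof (intro AE_I2)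
      fix x
      have "((\<lambda>t. x + t *\<^sub>R e) has_vector_derivative e) (at 0)"
        by (auto intro!: derivative_eq_intros simp: has_vector_derivative_def)
      moreover have "(G has_derivative D x) (at ((\<lambda>t. x + t *\<^sub>R e) 0))" using der by simp
      ultimately have "(G \<circ> (\<lambda>t. x + t *\<^sub>R e) has_vector_derivative D x e) (at 0)"
        using vector_derivative_diff_chain_within[of "\<lambda>t. x + t *\<^sub>R e" e 0 UNIV G "D x"]
        by (auto intro: has_derivative_at_withinI)
      then have "((\<lambda>t. (G (x + t *\<^sub>R e) - G x) /\<^sub>R t) \<longlongrightarrow> D x e) (at 0)"
        by (auto dest!: has_vector_derivative_quotient)
      moreover have "filterlim ?h (at 0) sequentially"
        by (real_asymp)
      ultimately have "((\<lambda>n. (G (x + ?h n *\<^sub>R e) - G x) /\<^sub>R ?h n) \<longlonglongrightarrow> D x e)"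
        by (rule filterlim_compose)
      then show "(\<lambda>n. d n x) \<longlonglongrightarrow> D x e" by (simp add: d_def add.commute)
    qed
    show "AE x in lborel. cmod (d n x) \<le> C * 2 ^ ?N * (1 / (1 + norm x) ^ ?N)" for n
    proof (intro AE_I2)
      fix x
      define h where "h = ?h n"
      have h: "0 < h" "h \<le> 1" by (auto simp: h_def divide_simps)
      let ?g = "\<lambda>t. G (x + t *\<^sub>R e)"
      have "\<exists>s\<in>{0<..<h}. cmod (?g (h) - ?g 0) \<le> cmod ((h - 0) *\<^sub>R D (x + s *\<^sub>R e) e)"
      proof (rule mvt_general[OF h(1)])
        have *: "(?g has_derivative (\<lambda>t. t *\<^sub>R D (x + s *\<^sub>R e) e)) (at s)" for s
        proof -
          have "((\<lambda>t. x + t *\<^sub>R e) has_derivative (\<lambda>t. t *\<^sub>R e)) (at s)"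
            by (auto intro!: derivative_eq_intros)
          from diff_chain_at[OF this der] show ?thesis
            by (simp add: o_def linear_scale[OF has_derivative_linear[OF der]])
        qed
        then show "(?g has_derivative (\<lambda>t. t *\<^sub>R D (x + s *\<^sub>R e) e)) (at s)" for s .
        show "continuous_on {0..h} ?g"
          using * by (meson continuous_at_imp_continuous_on has_derivative_continuous)
      qed
      then obtain s where s: "0 < s" "s < h"
        and le: "cmod (?g (h) - ?g 0) \<le> h * cmod (D (x + s *\<^sub>R e) e)"
        by auto
      have "cmod (d n x) = cmod (?g (h) - ?g 0) / h"
        using h(1) unfolding d_def h_def[symmetric] norm_scaleR by (simp add: add.commute divide_inverse mult.commute)
      also have "\<dots> \<le> cmod (D (x + s *\<^sub>R e) e)"
        using le h by (simp add: pos_divide_le_eq mult.commute)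
      finally have 1: "cmod (d n x) \<le> cmod (D (x + s *\<^sub>R e) e)" .
      \<comment> \<open>A shift by at most one changes the weight by a factor of at most two.\<close>
      have "norm x \<le> norm (x + s *\<^sub>R e) + norm (s *\<^sub>R e)"
        by (metis add_diff_cancel_right' norm_triangle_ineq4)
      moreover have "norm (s *\<^sub>R e) = s" using s e by simp
      ultimately have "1 + norm x \<le> 2 * (1 + norm (x + s *\<^sub>R e))"
        using s h norm_ge_zero[of "x + s *\<^sub>R e"] unfolding distrib_left by linarith
      then have "(1 + norm x) ^ ?N \<le> (2 * (1 + norm (x + s *\<^sub>R e))) ^ ?N"
        by (intro power_mono) auto
      then have "(1 + norm x) ^ ?N * cmod (d n x)
          \<le> (2 * (1 + norm (x + s *\<^sub>R e))) ^ ?N * cmod (D (x + s *\<^sub>R e) e)"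
        using 1 by (intro mult_mono) auto
      also have "\<dots> = 2 ^ ?N * ((1 + norm (x + s *\<^sub>R e)) ^ ?N * cmod (D (x + s *\<^sub>R e) e))"
        by (simp only: power_mult_distrib mult.assoc)
      also have "\<dots> \<le> 2 ^ ?N * C"
        by (intro mult_left_mono DC) auto
      finally show "cmod (d n x) \<le> C * 2 ^ ?N * (1 / (1 + norm x) ^ ?N)"
        by (simp add: pos_le_divide_eq add_pos_nonneg mult_ac)
    qed
  qed (auto simp: d_def)
  moreover have "(LINT x|lborel. d n x) = 0" for n
  proof -
    have "integrable lborel (\<lambda>x. G (?h n *\<^sub>R e + x))"
    proof -
      have "integrable (distr lborel borel ((+) (?h n *\<^sub>R e))) G" using G by (simp add: lborel_distr_plus)
      then show ?thesis by (subst (asm) integrable_distr_eq) auto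
    qed
    then have "(LINT x|lborel. d n x) = ((LINT x|lborel. G (?h n *\<^sub>R e + x)) - (LINT x|lborel. G x)) /\<^sub>R ?h n"
      unfolding d_def using G by simp
    then show ?thesis by (simp add: lborel_integral_shift)
  qed
  ultimately show ?thesis by (simp add: LIMSEQ_const_iff)
qed

lemma has_derivative_cis_inner:
  fixes x :: "'a::euclidean_space"
  shows "((\<lambda>x. cis (- (x \<bullet> \<xi>))) has_derivative (\<lambda>v. - \<i> * of_real (v \<bullet> \<xi>) * cis (- (x \<bullet> \<xi>)))) (at x)"
  (is "(_ has_derivative ?D) _")
proof (rule has_derivative_quadratic_remainder)
  show "bounded_linear ?D"
    unfolding linear_conv_bounded_linear[symmetric]
    by (rule linearI) (simp_all add: inner_add_left algebra_simps scaleR_conv_of_real)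
  fix v
  have "cis (- ((x + v) \<bullet> \<xi>)) - cis (- (x \<bullet> \<xi>)) - ?D v
      = cis (- (x \<bullet> \<xi>)) * (cis (- (v \<bullet> \<xi>)) - 1 - \<i> * of_real (- (v \<bullet> \<xi>)))"
  proof -
    have "cis (- ((x + v) \<bullet> \<xi>)) = cis (- (x \<bullet> \<xi>)) * cis (- (v \<bullet> \<xi>))"
      by (simp add: cis_mult inner_add_left)
    then show ?thesis by (simp add: algebra_simps)
  qed
  then have "cmod (cis (- ((x + v) \<bullet> \<xi>)) - cis (- (x \<bullet> \<xi>)) - ?D v) \<le> (v \<bullet> \<xi>)\<^sup>2"
    using cis_taylor[of "- (v \<bullet> \<xi>)"] by (simp add: norm_mult)
  also have "\<dots> \<le> (norm v * norm \<xi>)\<^sup>2"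
    using power_mono[OF Cauchy_Schwarz_ineq2[of v \<xi>] abs_ge_zero, of 2] by simp
  finally show "cmod (cis (- ((x + v) \<bullet> \<xi>)) - cis (- (x \<bullet> \<xi>)) - ?D v) \<le> (norm \<xi>)\<^sup>2 * (norm v)\<^sup>2"
    by (simp add: power_mult_distrib mult.commute)
qed

text \<open>Integration by parts, that is, the preceding lemma for the plane wave times \<open>f\<close>.\<close>

lemma fourier_partial:
  fixes f :: "'a::euclidean_space \<Rightarrow> complex"
  assumes f: "f \<in> schwartz" and e: "e \<in> Basis"
  shows "fourier (partial e f) \<xi> = \<i> * of_real (\<xi> \<bullet> e) * fourier f \<xi>"
proof -
  let ?N = "2 * DIM('a)"
  let ?D = "\<lambda>x v. cis (- (x \<bullet> \<xi>)) * frechet_derivative f (at x) v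
      + (- \<i> * of_real (v \<bullet> \<xi>) * cis (- (x \<bullet> \<xi>))) * f x"
  note pf = schwartz_partial[OF f e]
  note [measurable] = schwartz_measurable[OF f] schwartz_measurable[OF pf]
  have De: "?D x e = cis (- (x \<bullet> \<xi>)) * partial e f x
      + (- \<i> * of_real (e \<bullet> \<xi>)) * (cis (- (x \<bullet> \<xi>)) * f x)" for x
    by (simp add: partial_def)
  obtain A where A: "\<And>x. (1 + norm x) ^ ?N * cmod (partial e f x) \<le> A"
    using schwartz_decay[OF pf] by blast
  obtain B where B: "\<And>x. (1 + norm x) ^ ?N * cmod (f x) \<le> B"
    using schwartz_decay[OF f] by blast
  have "(LINT x|lborel. ?D x e) = 0"
  proof (rule integral_directional_derivative_zero[OF _ e])
    show "((\<lambda>x. cis (- (x \<bullet> \<xi>)) * f x) has_derivative ?D x) (at x)" for x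
      by (rule has_derivative_mult[OF has_derivative_cis_inner schwartz_has_derivative[OF f]])
    show "(\<lambda>x. ?D x e) \<in> borel_measurable borel" unfolding De by measurable
    show "integrable lborel (\<lambda>x. cis (- (x \<bullet> \<xi>)) * f x)"
      by (intro integrable_cis_mult schwartz_integrable f) measurable
    show "(1 + norm x) ^ ?N * cmod (?D x e) \<le> A + \<bar>e \<bullet> \<xi>\<bar> * B" for x
    proof -
      have "cmod (?D x e) \<le> cmod (partial e f x) + \<bar>e \<bullet> \<xi>\<bar> * cmod (f x)"
        unfolding De by (rule order_trans[OF norm_triangle_ineq]) (simp add: norm_mult)
      then have "(1 + norm x) ^ ?N * cmod (?D x e)
          \<le> (1 + norm x) ^ ?N * (cmod (partial e f x) + \<bar>e \<bullet> \<xi>\<bar> * cmod (f x))"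
        by (intro mult_left_mono) auto
      also have "\<dots> = (1 + norm x) ^ ?N * cmod (partial e f x) + \<bar>e \<bullet> \<xi>\<bar> * ((1 + norm x) ^ ?N * cmod (f x))"
        by (simp add: algebra_simps)
      also have "\<dots> \<le> A + \<bar>e \<bullet> \<xi>\<bar> * B" by (intro add_mono mult_left_mono A B) auto
      finally show ?thesis .
    qed
  qed
  moreover have "(LINT x|lborel. ?D x e) = (LINT x|lborel. cis (- (x \<bullet> \<xi>)) * partial e f x)
      + (- \<i> * of_real (e \<bullet> \<xi>)) * (LINT x|lborel. cis (- (x \<bullet> \<xi>)) * f x)"
    unfolding De
    by (subst Bochner_Integration.integral_add)
      (auto intro!: integrable_cis_mult integrable_mult_right schwartz_integrable[OF f] schwartz_integrable[OF pf])
  ultimately show ?thesis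
    by (simp add: fourier_def inner_commute)
qed

text \<open>A factor \<open>1 + \<bar>\<xi>\<bar>\<close> is paid for with a derivative, since \<open>\<bar>\<xi>\<bar> \<le> \<Sum>\<bar>\<xi> \<bullet> e\<bar>\<close> and \<open>\<xi> \<bullet> e\<close> acts as a partial derivative on \<open>f\<close>.\<close>

lemma fourier_decay:
  fixes f :: "'a::euclidean_space \<Rightarrow> complex"
  assumes "f \<in> schwartz"
  shows "\<exists>C. \<forall>\<xi>. (1 + norm \<xi>) ^ k * cmod (fourier f \<xi>) \<le> C"
  using assms
proof (induction k arbitrary: f)
  case 0
  then show ?case using norm_fourier_le[of f] by auto
next
  case (Suc k)
  obtain A where A: "\<And>\<xi>. (1 + norm \<xi>) ^ k * cmod (fourier f \<xi>) \<le> A"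
    using Suc by blast
  have "\<exists>B. \<forall>\<xi>. (1 + norm \<xi>) ^ k * cmod (fourier (partial e f) \<xi>) \<le> B" if "e \<in> Basis" for e
    using Suc schwartz_partial that by blast
  then obtain B where B: "\<And>e \<xi>. e \<in> Basis \<Longrightarrow> (1 + norm \<xi>) ^ k * cmod (fourier (partial e f) \<xi>) \<le> B e"
    by metis
  have "(1 + norm \<xi>) ^ Suc k * cmod (fourier f \<xi>) \<le> A + (\<Sum>e\<in>Basis. B e)" for \<xi>
  proof -
    have "(1 + norm \<xi>) ^ Suc k * cmod (fourier f \<xi>)
        = (1 + norm \<xi>) * ((1 + norm \<xi>) ^ k * cmod (fourier f \<xi>))" by simp
    also have "\<dots> \<le> (1 + (\<Sum>e\<in>Basis. \<bar>\<xi> \<bullet> e\<bar>)) * ((1 + norm \<xi>) ^ k * cmod (fourier f \<xi>))"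
      using norm_le_l1[of \<xi>] by (intro mult_right_mono) auto
    also have "\<dots> = (1 + norm \<xi>) ^ k * cmod (fourier f \<xi>)
        + (\<Sum>e\<in>Basis. (1 + norm \<xi>) ^ k * cmod (fourier (partial e f) \<xi>))"
      by (simp add: fourier_partial[OF Suc.prems] norm_mult sum_distrib_right sum_distrib_left
          algebra_simps)
    also have "\<dots> \<le> A + (\<Sum>e\<in>Basis. B e)"
      by (intro add_mono sum_mono A B)
    finally show ?thesis .
  qed
  then show ?case by blast
qed

lemma fourier_schwartz:
  fixes f :: "'a::euclidean_space \<Rightarrow> complex"
  assumes "f \<in> schwartz"
  shows "fourier f \<in> schwartz"
proof (rule schwartz_coinduct)
  let ?K = "fourier ` (schwartz :: ('a \<Rightarrow> complex) set)"
  show "fourier f \<in> ?K" using assms by blast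
  fix g assume "g \<in> ?K"
  then obtain h where h: "h \<in> schwartz" "g = fourier h" by auto
  show "g differentiable (at x)" for x
    using fourier_has_derivative[OF h(1)] h(2) by (auto simp: differentiable_def)
  show "partial e g \<in> ?K" if "e \<in> Basis" for e
    unfolding h(2) partial_fourier[OF h(1)] by (intro imageI schwartz_cmult schwartz_coord_mult h)
  show "\<exists>C. \<forall>x. (1 + norm x) ^ k * cmod (g x) \<le> C" for k
    unfolding h(2) by (rule fourier_decay[OF h(1)])
qed

lemma inverse_fourier_eq: "inverse_fourier f x = fourier f (- x)"
  by (simp add: inverse_fourier_def fourier_def inner_commute)

lemma inverse_fourier_schwartz:
  "f \<in> schwartz \<Longrightarrow> inverse_fourier f \<in> schwartz"
  using schwartz_reflect[OF fourier_schwartz] by (simp add: inverse_fourier_eq[abs_def])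

lemma lborel_integral_reflect:
  fixes f :: "'a::euclidean_space \<Rightarrow> 'b::{banach, second_countable_topology}"
  assumes [measurable]: "f \<in> borel_measurable borel"
  shows "(LINT x|lborel. f (- x)) = (LINT x|lborel. f x)"
    and "integrable lborel (\<lambda>x. f (- x)) \<longleftrightarrow> integrable lborel f"
proof -
  have u: "lborel = distr lborel borel (uminus :: 'a \<Rightarrow> 'a)"
    by (subst lborel_affine[of "-1" 0]) (auto simp: density_1)
  show "(LINT x|lborel. f (- x)) = (LINT x|lborel. f x)"
    by (subst (2) u) (simp add: integral_distr)
  show "integrable lborel (\<lambda>x. f (- x)) \<longleftrightarrow> integrable lborel f"
    by (subst (2) u) (simp add: integrable_distr_eq)
qed

lemma fourier_reflect:
  assumes [measurable]: "f \<in> borel_measurable borel"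
  shows "fourier (\<lambda>x. f (- x)) \<xi> = fourier f (- \<xi>)"
proof -
  have "(LINT x|lborel. cis (- (x \<bullet> \<xi>)) * f (- x))
     = (LINT x|lborel. cis (- (x \<bullet> - \<xi>)) * f x)"
    using lborel_integral_reflect[of "\<lambda>x. cis (- (x \<bullet> - \<xi>)) * f x"] by simp
  then show ?thesis by (simp add: fourier_def)
qed

lemma laplacian_fourier:
  fixes f :: "'a::euclidean_space \<Rightarrow> complex"
  assumes f: "f \<in> schwartz"
  shows "laplacian (fourier f) = fourier (\<lambda>x. - of_real ((norm x)\<^sup>2) * f x)"
    and "(\<lambda>x. - of_real ((norm x)\<^sup>2) * f x) \<in> schwartz"
proof -
  let ?g = "\<lambda>e x. - \<i> * (of_real (x \<bullet> e) * (- \<i> * (of_real (x \<bullet> e) * f x)))"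
  have g: "?g e \<in> schwartz" for e
    by (intro schwartz_cmult schwartz_coord_mult f)
  have pp: "partial e (partial e (fourier f)) = fourier (?g e)" for e
    unfolding partial_fourier[OF f] partial_fourier[OF schwartz_cmult[OF schwartz_coord_mult[OF f]]] ..
  have eq: "(\<lambda>x. - of_real ((norm x)\<^sup>2) * f x) = (\<lambda>x. \<Sum>e\<in>Basis. ?g e x)"
  proof
    fix x :: 'a
    have "(norm x)\<^sup>2 = (\<Sum>e\<in>Basis. (x \<bullet> e) * (x \<bullet> e))"
      by (simp add: power2_norm_eq_inner euclidean_inner[of x x])
    moreover have "?g e x = - of_real ((x \<bullet> e) * (x \<bullet> e)) * f x" for e
    proof -
      have "?g e x = (\<i> * \<i>) * (of_real (x \<bullet> e) * of_real (x \<bullet> e)) * f x"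
        by (simp only: mult_minus_left mult_minus_right minus_minus mult_ac)
      then show ?thesis by simp
    qed
    ultimately show "- of_real ((norm x)\<^sup>2) * f x = (\<Sum>e\<in>Basis. ?g e x)"
      by (simp add: sum_distrib_right sum_negf del: mult_minus_left mult_minus_right)
  qed
  show "laplacian (fourier f) = fourier (\<lambda>x. - of_real ((norm x)\<^sup>2) * f x)"
    unfolding eq laplacian_def pp
    by (rule ext, rule fourier_sum[symmetric]) (rule finite_Basis schwartz_integrable[OF g])+
  show "(\<lambda>x. - of_real ((norm x)\<^sup>2) * f x) \<in> schwartz"
    unfolding eq by (intro schwartz_sum g) auto
qed

section \<open>Gaussian regularisation and Fourier inversion\<close>

definition gauss :: "real \<Rightarrow> 'a::euclidean_space \<Rightarrow> real" where
  "gauss \<epsilon> \<xi> = exp (- (\<epsilon> * norm \<xi>)\<^sup>2 / 2)"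

text \<open>The centred normal density with standard deviation \<open>\<epsilon>\<close> in each coordinate, to which the Gaussian
  frequency weight \<^term>\<open>gauss \<epsilon>\<close> corresponds.\<close>

definition heat :: "real \<Rightarrow> 'a::euclidean_space \<Rightarrow> real" where
  "heat \<epsilon> x = gauss (1 / \<epsilon>) x / (sqrt (2 * pi) * \<epsilon>) ^ DIM('a)"

lemma gauss_measurable [measurable]: "gauss \<epsilon> \<in> borel_measurable borel"
  unfolding gauss_def[abs_def] by measurable

lemma heat_measurable [measurable]: "heat \<epsilon> \<in> borel_measurable borel"
  unfolding heat_def[abs_def] by measurable

lemma gauss_pos: "0 < gauss \<epsilon> \<xi>" and gauss_le_1: "gauss \<epsilon> \<xi> \<le> 1"
  by (auto simp: gauss_def)

lemma heat_pos: "0 < \<epsilon> \<Longrightarrow> 0 < heat \<epsilon> x"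
  by (simp add: heat_def gauss_pos)

text \<open>The characteristic function of the standard normal distribution, rescaled by \<open>\<epsilon>\<close>.\<close>

lemma gauss_1d:
  assumes \<epsilon>: "\<epsilon> > 0"
  shows "integrable lborel (\<lambda>x::real. cis (z * x) * of_real (exp (- (\<epsilon> * x)\<^sup>2 / 2)))" (is ?I)
    and "(LINT x|lborel. cis (z * x) * of_real (exp (- (\<epsilon> * x)\<^sup>2 / 2)))
      = of_real (sqrt (2 * pi) / \<epsilon> * exp (- (z / \<epsilon>)\<^sup>2 / 2))" (is ?E)
proof -
  have sn: "std_normal_density x = exp (- x\<^sup>2 / 2) / sqrt (2 * pi)" for x
    by (simp add: std_normal_density_def)
  have i1: "integrable lborel (\<lambda>x::real. cis (w * x) * of_real (std_normal_density x))" for w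
    by (intro integrable_cis_mult) (auto intro!: integrable_of_real integrable_normal_density)
  have "char std_normal_distribution w
      = (LINT x|lborel. std_normal_density x *\<^sub>R cis (w * x))" for w
    unfolding char_def
    by (subst integral_density) (auto simp: cis_conv_exp)
  then have e1: "(LINT x|lborel. cis (w * x) * of_real (std_normal_density x)) = of_real (exp (- w\<^sup>2 / 2))" for w
    by (simp add: char_std_normal_distribution scaleR_conv_of_real mult.commute)
  have eq: "cis (z * x) * of_real (exp (- (\<epsilon> * x)\<^sup>2 / 2))
     = of_real (sqrt (2 * pi)) * (cis (z / \<epsilon> * (0 + \<epsilon> * x)) * of_real (std_normal_density (0 + \<epsilon> * x)))" for x
    using \<epsilon> by (simp add: sn)
  show ?I unfolding eq
    by (rule integrable_mult_right, rule lborel_integrable_real_affine[OF i1]) (use \<epsilon> in simp)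
  have "of_real (exp (- (z / \<epsilon>)\<^sup>2 / 2)) = \<bar>\<epsilon>\<bar> *\<^sub>R
     (LINT x|lborel. cis (z / \<epsilon> * (0 + \<epsilon> * x)) * of_real (std_normal_density (0 + \<epsilon> * x)))"
    unfolding e1[symmetric] by (rule lborel_integral_real_affine) (use \<epsilon> in simp)
  then show ?E unfolding eq integral_mult_right_zero using \<epsilon>
    by (simp add: scaleR_conv_of_real nonzero_eq_divide_eq mult_ac)
qed

lemma gauss_fourier:
  fixes z :: "'a::euclidean_space"
  assumes \<epsilon>: "\<epsilon> > 0"
  shows "integrable lborel (\<lambda>\<xi>. cis (z \<bullet> \<xi>) * of_real (gauss \<epsilon> \<xi>))" (is ?I)
    and "(LINT \<xi>|lborel. cis (z \<bullet> \<xi>) * of_real (gauss \<epsilon> \<xi>))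
      = of_real ((sqrt (2 * pi) / \<epsilon>) ^ DIM('a) * gauss (1 / \<epsilon>) z)" (is ?E)
proof -
  have cis_sum: "cis (\<Sum>b\<in>B. g b) = (\<Prod>b\<in>B. cis (g b))" if "finite B" for B and g :: "'a \<Rightarrow> real"
    using that by induction (auto simp: cis_mult[symmetric])
  have g: "of_real (gauss c x) = (\<Prod>b\<in>Basis. of_real (exp (- (c * (x \<bullet> b))\<^sup>2 / 2)) :: complex)"
    for x :: 'a and c
  proof -
    have "(norm x)\<^sup>2 = (\<Sum>b\<in>Basis. (x \<bullet> b)\<^sup>2)"
      unfolding power2_norm_eq_inner by (subst euclidean_inner) (simp only: power2_eq_square)
    then have "- (c * norm x)\<^sup>2 / 2 = (\<Sum>b\<in>Basis. - (c * (x \<bullet> b))\<^sup>2 / 2)"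
      by (simp add: power_mult_distrib sum_divide_distrib sum_negf sum_distrib_left)
    then show ?thesis
      unfolding gauss_def by (simp only: exp_sum[OF finite_Basis] of_real_prod)
  qed
  have eq: "cis (z \<bullet> \<xi>) * of_real (gauss \<epsilon> \<xi>)
      = (\<Prod>b\<in>Basis. cis ((z \<bullet> b) * (\<xi> \<bullet> b)) * of_real (exp (- (\<epsilon> * (\<xi> \<bullet> b))\<^sup>2 / 2)))" for \<xi>
    unfolding g by (subst euclidean_inner, subst cis_sum) (simp_all add: prod.distrib)
  show ?I unfolding eq
    by (rule integrable_lborel_prod(1)[where f="\<lambda>b x. cis ((z \<bullet> b) * x) * of_real (exp (- (\<epsilon> * x)\<^sup>2 / 2))"])
      (rule gauss_1d[OF \<epsilon>])
  have "(LINT \<xi>|lborel. cis (z \<bullet> \<xi>) * of_real (gauss \<epsilon> \<xi>))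
     = (\<Prod>b\<in>Basis. of_real (sqrt (2 * pi) / \<epsilon> * exp (- ((z \<bullet> b) / \<epsilon>)\<^sup>2 / 2)))"
    unfolding eq
    by (subst integrable_lborel_prod(2)[where f="\<lambda>b x. cis ((z \<bullet> b) * x) * of_real (exp (- (\<epsilon> * x)\<^sup>2 / 2))"])
      (simp_all only: gauss_1d[OF \<epsilon>])
  also have "\<dots> = of_real ((sqrt (2 * pi) / \<epsilon>) ^ DIM('a)) * of_real (gauss (1 / \<epsilon>) z)"
    unfolding g by (simp only: of_real_mult prod.distrib prod_constant of_real_power) simp
  finally show ?E by (simp only: of_real_mult)
qed

lemma integrable_gauss:
  assumes "\<epsilon> > 0" shows "integrable lborel (gauss \<epsilon> :: 'a::euclidean_space \<Rightarrow> real)"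
  using integrable_Re[OF gauss_fourier(1)[OF assms, of "0::'a"]] by simp

lemma heat_integral:
  assumes "\<epsilon> > 0"
  shows "integrable lborel (heat \<epsilon> :: 'a::euclidean_space \<Rightarrow> real)"
    and "(LINT x|lborel. heat \<epsilon> (x :: 'a)) = 1"
proof -
  show "integrable lborel (heat \<epsilon> :: 'a \<Rightarrow> real)"
    unfolding heat_def[abs_def] using integrable_gauss[of "1 / \<epsilon>", where 'a='a] assms by simp
  have "complex_of_real (LINT x|lborel. gauss (1 / \<epsilon>) (x :: 'a)) = of_real ((sqrt (2 * pi) * \<epsilon>) ^ DIM('a))"
    using gauss_fourier(2)[of "1 / \<epsilon>" "0::'a"] assms by (simp add: gauss_def)
  then have "(LINT x|lborel. gauss (1 / \<epsilon>) (x :: 'a)) = (sqrt (2 * pi) * \<epsilon>) ^ DIM('a)"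
    by (simp only: of_real_eq_iff)
  then show "(LINT x|lborel. heat \<epsilon> (x :: 'a)) = 1"
    unfolding heat_def[abs_def] using assms by simp
qed

lemma fourier_measurable [measurable]:
  fixes f :: "'a::euclidean_space \<Rightarrow> complex"
  assumes [measurable]: "f \<in> borel_measurable borel"
  shows "fourier f \<in> borel_measurable borel"
  unfolding fourier_def[abs_def] by measurable

lemma integrable_product_kernel:
  fixes f g :: "'a::euclidean_space \<Rightarrow> complex"
  assumes f: "integrable lborel f" and g: "integrable lborel g"
    and [measurable]: "k \<in> borel_measurable (borel \<Otimes>\<^sub>M borel)" and k: "\<And>x y. cmod (k (x, y)) \<le> 1"
  shows "integrable (lborel \<Otimes>\<^sub>M lborel) (\<lambda>(x, y). k (x, y) * (f x * g y))"
proof -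
  have [measurable]: "f \<in> borel_measurable borel" "g \<in> borel_measurable borel"
    using f g by auto
  have "integrable (lborel \<Otimes>\<^sub>M lborel) (\<lambda>(x, y). f x * g y)"
    by (rule lborel_pair.Fubini_integrable) (use f g in \<open>auto simp: norm_mult\<close>)
  then show ?thesis
  proof (rule Bochner_Integration.integrable_bound)
    show "AE z in lborel \<Otimes>\<^sub>M lborel. cmod (case z of (x, y) \<Rightarrow> k (x, y) * (f x * g y))
        \<le> cmod (case z of (x, y) \<Rightarrow> f x * g y)"
      using k by (intro AE_I2) (auto simp: norm_mult intro!: mult_left_le_one_le)
  qed measurable
qed

text \<open>Fubini's theorem: both sides are the double integral of \<open>f(x) g(y)\<close> against \<open>cis (- (x \<bullet> y))\<close>.\<close>

lemma fourier_multiplication_formula: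
  fixes f g :: "'a::euclidean_space \<Rightarrow> complex"
  assumes f: "integrable lborel f" and g: "integrable lborel g"
  shows "(LINT x|lborel. fourier f x * g x) = (LINT x|lborel. f x * fourier g x)"
proof -
  let ?c = "fourier_const TYPE('a)"
  have "integrable (lborel \<Otimes>\<^sub>M lborel) (\<lambda>(x, y). cis (- (fst (x, y) \<bullet> snd (x, y))) * (f x * g y))"
    by (rule integrable_product_kernel[OF f g, where k="\<lambda>z. cis (- (fst z \<bullet> snd z))"]) auto
  then have F: "(LINT y|lborel. LINT x|lborel. cis (- (x \<bullet> y)) * (f x * g y))
     = (LINT x|lborel. LINT y|lborel. cis (- (x \<bullet> y)) * (f x * g y))"
    by (intro lborel_pair.Fubini_integral) simp
  have "(LINT y|lborel. fourier f y * g y) = (LINT y|lborel. ?c * (LINT x|lborel. cis (- (x \<bullet> y)) * (f x * g y)))"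
    unfolding fourier_def by (simp only: mult.assoc integral_mult_left_zero[symmetric])
  also have "\<dots> = (LINT x|lborel. ?c * (LINT y|lborel. cis (- (x \<bullet> y)) * (f x * g y)))"
    by (simp only: integral_mult_right_zero F)
  also have "\<dots> = (LINT x|lborel. f x * fourier g x)"
  proof -
    have "?c * (LINT y|lborel. cis (- (x \<bullet> y)) * (f x * g y)) = f x * fourier g x" for x
    proof -
      have "(LINT y|lborel. cis (- (x \<bullet> y)) * (f x * g y)) = (LINT y|lborel. f x * (cis (- (y \<bullet> x)) * g y))"
        by (simp add: inner_commute mult_ac)
      then show ?thesis by (simp add: fourier_def mult_ac)
    qed
    then show ?thesis by simp
  qed
  finally show ?thesis .
qed

lemma fourier_const_powr: 
  "(2 * pi) powr (- real n / 2) = 1 / sqrt (2 * pi) ^ n"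
proof -
  have "sqrt (2 * pi) ^ n = sqrt (2 * pi) powr real n" by (rule powr_realpow[symmetric]) simp
  also have "\<dots> = ((2 * pi) powr (1 / 2)) powr real n"
    by (subst powr_half_sqrt) (auto intro: less_imp_le)
  also have "\<dots> = (2 * pi) powr (real n / 2)" unfolding powr_powr by (rule arg_cong) simp
  finally have *: "sqrt (2 * pi) ^ n = (2 * pi) powr (real n / 2)" .
  have "(2 * pi) powr (- real n / 2) = inverse ((2 * pi) powr (real n / 2))"
    unfolding powr_minus[symmetric] by (rule arg_cong) simp
  then show ?thesis unfolding * inverse_eq_divide .
qed

text \<open>The multiplication formula with a plane wave damped by a Gaussian. Its Fourier transform is a
  multiple of the heat kernel centred at \<open>x\<close>.\<close>

lemma regularised_inversion:
  fixes h :: "'a::euclidean_space \<Rightarrow> complex"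
  assumes h: "integrable lborel h" and \<epsilon>: "\<epsilon> > 0"
  shows "inverse_fourier (\<lambda>\<xi>. of_real (gauss \<epsilon> \<xi>) * fourier h \<xi>) x
     = (LINT y|lborel. h y * of_real (heat \<epsilon> (x - y)))"
proof -
  let ?c = "fourier_const TYPE('a)"
  let ?g = "\<lambda>\<xi>. cis (x \<bullet> \<xi>) * of_real (gauss \<epsilon> \<xi>)"
  have g: "integrable lborel ?g" by (rule gauss_fourier[OF \<epsilon>])
  have Fg: "?c * fourier ?g y = of_real (heat \<epsilon> (x - y))" for y
  proof -
    have "cis (- (\<xi> \<bullet> y)) * ?g \<xi> = cis ((x - y) \<bullet> \<xi>) * of_real (gauss \<epsilon> \<xi>)" for \<xi>
      by (simp add: cis_mult mult.assoc[symmetric] inner_diff_left inner_commute[of \<xi>])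
    then have "(LINT \<xi>|lborel. cis (- (\<xi> \<bullet> y)) * ?g \<xi>) = of_real ((sqrt (2 * pi) / \<epsilon>) ^ DIM('a) * gauss (1 / \<epsilon>) (x - y))"
      by (simp only: gauss_fourier(2)[OF \<epsilon>])
    then have "fourier ?g y = ?c * of_real ((sqrt (2 * pi) / \<epsilon>) ^ DIM('a) * gauss (1 / \<epsilon>) (x - y))"
      unfolding fourier_def by (simp only:)
    then have "?c * fourier ?g y
       = of_real ((1 / sqrt (2 * pi) ^ DIM('a)) * ((1 / sqrt (2 * pi) ^ DIM('a)) * ((sqrt (2 * pi) / \<epsilon>) ^ DIM('a) * gauss (1 / \<epsilon>) (x - y))))"
      unfolding fourier_const_powr by (simp only: of_real_mult)
    also have "(1 / sqrt (2 * pi) ^ DIM('a)) * ((1 / sqrt (2 * pi) ^ DIM('a)) * ((sqrt (2 * pi) / \<epsilon>) ^ DIM('a) * gauss (1 / \<epsilon>) (x - y))) = heat \<epsilon> (x - y)"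
      using \<epsilon> by (simp add: heat_def power_divide power_mult_distrib)
    finally show ?thesis .
  qed
  have "inverse_fourier (\<lambda>\<xi>. of_real (gauss \<epsilon> \<xi>) * fourier h \<xi>) x
      = ?c * (LINT \<xi>|lborel. fourier h \<xi> * ?g \<xi>)"
    by (simp add: inverse_fourier_def mult_ac)
  also have "\<dots> = (LINT y|lborel. h y * (?c * fourier ?g y))"
    unfolding fourier_multiplication_formula[OF h g]
    by (simp only: integral_mult_right_zero[symmetric] mult.left_commute)
  finally show ?thesis unfolding Fg .
qed

lemma heat_rescale:
  fixes h :: "'a::euclidean_space \<Rightarrow> complex"
  assumes [measurable]: "h \<in> borel_measurable borel" and \<epsilon>: "\<epsilon> > 0"
  shows "(LINT y|lborel. h y * of_real (heat \<epsilon> (x - y)))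
    = (LINT z|lborel. h (x + \<epsilon> *\<^sub>R z) * of_real (heat 1 z))"
proof -
  have "(LINT y|lborel. h y * of_real (heat \<epsilon> (x - y)))
     = (LINT y|density (distr lborel borel (\<lambda>z. x + \<epsilon> *\<^sub>R z)) (\<lambda>_. \<bar>\<epsilon>\<bar> ^ DIM('a)). h y * of_real (heat \<epsilon> (x - y)))"
    by (subst lborel_affine[of \<epsilon> x]) (use \<epsilon> in auto)
  also have "\<dots> = (LINT z|lborel. \<bar>\<epsilon>\<bar> ^ DIM('a) *\<^sub>R (h (x + \<epsilon> *\<^sub>R z) * of_real (heat \<epsilon> (- (\<epsilon> *\<^sub>R z)))))"
    using \<epsilon> by (subst integral_density) (auto simp: integral_distr)
  also have "\<dots> = (LINT z|lborel. h (x + \<epsilon> *\<^sub>R z) * of_real (heat 1 z))"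
    using \<epsilon> by (intro Bochner_Integration.integral_cong refl)
      (simp add: heat_def gauss_def scaleR_conv_of_real power_mult_distrib)
  finally show ?thesis .
qed

text \<open>After rescaling, the kernel is fixed and the width \<open>\<epsilon>\<close> occurs only in the argument of \<open>h\<close>, so that
  dominated convergence applies.\<close>

lemma heat_approximate_identity:
  fixes h :: "'a::euclidean_space \<Rightarrow> complex"
  assumes cont: "continuous_on UNIV h" and bd: "\<And>x. cmod (h x) \<le> B"
  shows "(\<lambda>n. LINT y|lborel. h y * of_real (heat (1 / real (Suc n)) (x - y))) \<longlonglongrightarrow> h x"
proof -
  have [measurable]: "h \<in> borel_measurable borel"
    by (rule borel_measurable_continuous_onI[OF cont])
  have "(\<lambda>n. LINT z|lborel. h (x + (1 / real (Suc n)) *\<^sub>R z) * of_real (heat 1 z))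
      \<longlonglongrightarrow> (LINT z|lborel. h x * of_real (heat 1 (z::'a)))"
  proof (rule integral_dominated_convergence)
    show "integrable lborel (\<lambda>z::'a. B * heat 1 z)"
      by (intro integrable_mult_right heat_integral) simp
    show "AE z in lborel. (\<lambda>n. h (x + (1 / real (Suc n)) *\<^sub>R z) * of_real (heat 1 z)) \<longlonglongrightarrow> h x * of_real (heat 1 z)"
    proof (intro AE_I2 tendsto_mult tendsto_const)
      fix z :: 'a
      have "(\<lambda>n. 1 / real (Suc n)) \<longlonglongrightarrow> 0" by real_asymp
      then have "(\<lambda>n. x + (1 / real (Suc n)) *\<^sub>R z) \<longlonglongrightarrow> x"
        using tendsto_add[OF tendsto_const[of x] tendsto_scaleR[OF _ tendsto_const[of z]]] by fastforce
      moreover have "isCont h x" using cont by (simp add: continuous_on_eq_continuous_at)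
      ultimately show "(\<lambda>n. h (x + (1 / real (Suc n)) *\<^sub>R z)) \<longlonglongrightarrow> h x"
        by (rule isCont_tendsto_compose[rotated])
    qed
    show "AE z in lborel. cmod (h (x + (1 / real (Suc n)) *\<^sub>R z) * of_real (heat 1 z)) \<le> B * heat 1 z" for n
      using mult_right_mono[OF bd less_imp_le[OF heat_pos[of 1]]]
      by (intro AE_I2) (simp add: norm_mult abs_of_pos[OF heat_pos])
  qed auto
  also have "(LINT z|lborel. h x * of_real (heat 1 (z::'a))) = h x"
    using heat_integral(2)[of 1, where 'a='a] by simp
  finally show ?thesis by (simp add: heat_rescale)
qed

lemma gauss_tendsto_1: "(\<lambda>n. gauss (1 / real (Suc n)) \<xi>) \<longlonglongrightarrow> 1"
proof -
  have "(\<lambda>n. 1 / real (Suc n)) \<longlonglongrightarrow> 0" by real_asymp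
  then have "(\<lambda>n. exp (- (1 / real (Suc n) * norm \<xi>)\<^sup>2 / 2)) \<longlonglongrightarrow> exp (- (0 * norm \<xi>)\<^sup>2 / 2)"
    by (intro tendsto_intros) auto
  then show ?thesis unfolding gauss_def by simp
qed

text \<open>The regularised inversion formula in the limit \<open>\<epsilon> \<rightarrow> 0\<close>: on one side the kernel concentrates at \<open>x\<close>, on the
  other the Gaussian weight tends to one. Conjugation with the reflection \<open>x \<mapsto> -x\<close> exchanges the two identities.\<close>

theorem fourier_inversion:
  fixes f :: "'a::euclidean_space \<Rightarrow> complex"
  assumes f: "f \<in> schwartz"
  shows "inverse_fourier (fourier f) = f" and "fourier (inverse_fourier f) = f"
proof -
  have *: "inverse_fourier (fourier f) x = f x" for x
  proof (rule LIMSEQ_unique)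
    obtain B where B: "\<And>x. (1 + norm x) ^ 0 * cmod (f x) \<le> B"
      using schwartz_decay[OF f] by blast
    note [measurable] = schwartz_measurable[OF fourier_schwartz[OF f]]
    show "(\<lambda>n. inverse_fourier (\<lambda>\<xi>. of_real (gauss (1 / real (Suc n)) \<xi>) * fourier f \<xi>) x) \<longlonglongrightarrow> f x"
      using heat_approximate_identity[OF schwartz_continuous[OF f], of B x] B
      by (simp add: regularised_inversion[OF schwartz_integrable[OF f]])
    have "(\<lambda>n. LINT \<xi>|lborel. cis (x \<bullet> \<xi>) * (of_real (gauss (1 / real (Suc n)) \<xi>) * fourier f \<xi>))
        \<longlonglongrightarrow> (LINT \<xi>|lborel. cis (x \<bullet> \<xi>) * (of_real 1 * fourier f \<xi>))"
    proof (rule integral_dominated_convergence)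
      show "integrable lborel (\<lambda>\<xi>. cmod (fourier f \<xi>))"
        using schwartz_integrable[OF fourier_schwartz[OF f]] by simp
      show "AE \<xi> in lborel. (\<lambda>n. cis (x \<bullet> \<xi>) * (of_real (gauss (1 / real (Suc n)) \<xi>) * fourier f \<xi>))
          \<longlonglongrightarrow> cis (x \<bullet> \<xi>) * (of_real 1 * fourier f \<xi>)"
        by (intro AE_I2 tendsto_mult tendsto_const tendsto_of_real gauss_tendsto_1)
      show "AE \<xi> in lborel. cmod (cis (x \<bullet> \<xi>) * (of_real (gauss (1 / real (Suc n)) \<xi>) * fourier f \<xi>))
          \<le> cmod (fourier f \<xi>)" for n
        by (intro AE_I2) (simp add: norm_mult abs_of_pos gauss_pos gauss_le_1 mult_left_le_one_le less_imp_le)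
    qed measurable
    then show "(\<lambda>n. inverse_fourier (\<lambda>\<xi>. of_real (gauss (1 / real (Suc n)) \<xi>) * fourier f \<xi>) x)
        \<longlonglongrightarrow> inverse_fourier (fourier f) x"
      unfolding inverse_fourier_def by (intro tendsto_mult tendsto_const) simp
  qed
  then show "inverse_fourier (fourier f) = f" by blast
  have "fourier (inverse_fourier f) x = fourier (\<lambda>\<xi>. fourier f (- \<xi>)) x" for x
    by (simp add: inverse_fourier_eq[abs_def])
  also have "\<dots> x = f x" for x
    using *[of x] schwartz_measurable[OF fourier_schwartz[OF f]]
    by (simp add: fourier_reflect inverse_fourier_eq)
  finally show "fourier (inverse_fourier f) = f" by blast
qed

section \<open>The Fourier transform of square integrable functions\<close>

text \<open>The squared \<open>L\<^sup>2\<close> norm in \<^typ>\<open>ennreal\<close>, where Fatou's lemma and monotone limits need no integrability.\<close>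

abbreviation nn2 :: "('a::euclidean_space \<Rightarrow> complex) \<Rightarrow> ennreal" where
  "nn2 f \<equiv> \<integral>\<^sup>+x. ennreal ((cmod (f x))\<^sup>2) \<partial>lborel"

lemma L2_fun_iff: "f \<in> L2_fun \<longleftrightarrow> f \<in> borel_measurable borel \<and> nn2 f < \<infinity>"
  by (auto simp: L2_fun_def integrable_iff_bounded)

lemma L2_fun_measurable [measurable_dest]: "f \<in> L2_fun \<Longrightarrow> f \<in> borel_measurable borel"
  by (simp add: L2_fun_def)

lemma L2_fun_integrable: "f \<in> L2_fun \<Longrightarrow> integrable lborel (\<lambda>x. (cmod (f x))\<^sup>2)"
  by (simp add: L2_fun_def)

lemma L2_fun_norm_nonneg [simp]: "0 \<le> L2_fun_norm f"
  by (simp add: L2_fun_norm_def)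

lemma L2_fun_norm_power2: "(L2_fun_norm f)\<^sup>2 = (LINT x|lborel. (cmod (f x))\<^sup>2)"
  by (simp add: L2_fun_norm_def)

lemma nn2_eq: "f \<in> L2_fun \<Longrightarrow> nn2 f = ennreal ((L2_fun_norm f)\<^sup>2)"
  by (simp add: L2_fun_norm_power2 nn_integral_eq_integral L2_fun_integrable)

lemma L2_fun_norm_le:
  assumes "f \<in> borel_measurable borel" "nn2 f \<le> nn2 g" "g \<in> L2_fun"
  shows "f \<in> L2_fun" "L2_fun_norm f \<le> L2_fun_norm g"
proof -
  show f: "f \<in> L2_fun"
    using assms by (auto simp: L2_fun_iff dest: le_less_trans)
  show "L2_fun_norm f \<le> L2_fun_norm g"
    using assms(2) unfolding nn2_eq[OF f] nn2_eq[OF assms(3)]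
    by (simp add: power2_le_iff_abs_le)
qed

lemma L2_fun_mult_integrable:
  assumes f: "f \<in> L2_fun" and g: "g \<in> L2_fun"
  shows "integrable lborel (\<lambda>x. f x * g x)"
proof (rule Bochner_Integration.integrable_bound)
  show "integrable lborel (\<lambda>x. (cmod (f x))\<^sup>2 + (cmod (g x))\<^sup>2)"
    using f g by (intro Bochner_Integration.integrable_add L2_fun_integrable)
  show "(\<lambda>x. f x * g x) \<in> borel_measurable lborel"
    using f g by (intro borel_measurable_times) (auto simp: L2_fun_def)
  have "cmod (f x) * cmod (g x) \<le> (cmod (f x))\<^sup>2 + (cmod (g x))\<^sup>2" for x
    using sum_squares_bound[of "cmod (f x)" "cmod (g x)"] mult_nonneg_nonneg[of "cmod (f x)" "cmod (g x)"]
    unfolding mult.assoc by (smt (verit) norm_ge_zero)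
  then show "AE x in lborel. cmod (f x * g x) \<le> norm ((cmod (f x))\<^sup>2 + (cmod (g x))\<^sup>2)"
    by (intro AE_I2) (simp add: norm_mult)
qed

lemma nn_integral_shift:
  fixes f :: "'a::euclidean_space \<Rightarrow> ennreal"
  assumes [measurable]: "f \<in> borel_measurable borel"
  shows "(\<integral>\<^sup>+x. f (c + x) \<partial>lborel) = (\<integral>\<^sup>+x. f x \<partial>lborel)"
proof -
  have "(\<integral>\<^sup>+x. f x \<partial>lborel) = (\<integral>\<^sup>+x. f x \<partial>distr lborel borel ((+) c))"
    by (simp add: lborel_distr_plus)
  then show ?thesis by (simp add: nn_integral_distr)
qed

lemma measurable_cnj [measurable (raw)]:
  "f \<in> borel_measurable M \<Longrightarrow> (\<lambda>x. cnj (f x)) \<in> borel_measurable M"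
  by (rule measurable_compose[of f M borel cnj]) (auto intro!: borel_measurable_continuous_onI continuous_intros)

lemma heat_minus: "heat \<epsilon> (x - y) = heat \<epsilon> (y - x)"
  by (simp add: heat_def gauss_def norm_minus_commute)

lemma heat_nn_integral:
  assumes \<epsilon>: "\<epsilon> > 0"
  shows "(\<integral>\<^sup>+y. ennreal (heat \<epsilon> (x - y)) \<partial>lborel) = 1"
proof -
  have "(\<integral>\<^sup>+y. ennreal (heat \<epsilon> (x - y)) \<partial>lborel) = (\<integral>\<^sup>+y. ennreal (heat \<epsilon> (- x + y)) \<partial>lborel)"
    by (subst heat_minus) simp
  also have "\<dots> = (\<integral>\<^sup>+y. ennreal (heat \<epsilon> (y :: 'a)) \<partial>lborel)"
    by (rule nn_integral_shift) measurable
  also have "\<dots> = ennreal (LINT y|lborel. heat \<epsilon> (y :: 'a))"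
    by (intro nn_integral_eq_integral heat_integral \<epsilon> AE_I2) (auto intro: less_imp_le heat_pos \<epsilon>)
  finally show ?thesis by (simp add: heat_integral(2)[OF \<epsilon>])
qed

text \<open>Schur's test: \<open>2 \<bar>g(x)\<bar> \<bar>g(y)\<bar> \<le> \<bar>g(x)\<bar>\<^sup>2 + \<bar>g(y)\<bar>\<^sup>2\<close>, and the kernel has total mass one in either variable.\<close>

lemma heat_schur:
  fixes g :: "'a::euclidean_space \<Rightarrow> complex"
  assumes [measurable]: "g \<in> borel_measurable borel" and \<epsilon>: "\<epsilon> > 0"
  shows "(\<integral>\<^sup>+x. \<integral>\<^sup>+y. ennreal (cmod (g x) * cmod (g y) * heat \<epsilon> (x - y)) \<partial>lborel \<partial>lborel) \<le> nn2 g"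
proof -
  let ?h = "\<lambda>x y. ennreal (heat \<epsilon> (x - y))"
  have h0: "0 \<le> heat \<epsilon> x" for x :: 'a by (rule less_imp_le[OF heat_pos[OF \<epsilon>]])
  have "cmod (g x) * cmod (g y) * heat \<epsilon> (x - y)
      \<le> (cmod (g x))\<^sup>2 / 2 * heat \<epsilon> (x - y) + (cmod (g y))\<^sup>2 / 2 * heat \<epsilon> (x - y)" for x y
    using mult_right_mono[OF sum_squares_bound[of "cmod (g x)" "cmod (g y)"] h0[of "x - y"]]
    by (simp add: algebra_simps)
  then have "ennreal (cmod (g x) * cmod (g y) * heat \<epsilon> (x - y))
      \<le> ennreal ((cmod (g x))\<^sup>2 / 2) * ?h x y + ennreal ((cmod (g y))\<^sup>2 / 2) * ?h x y" for x y
    by (simp add: ennreal_mult[symmetric] ennreal_plus[symmetric] h0 del: ennreal_plus)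
  then have "(\<integral>\<^sup>+x. \<integral>\<^sup>+y. ennreal (cmod (g x) * cmod (g y) * heat \<epsilon> (x - y)) \<partial>lborel \<partial>lborel)
    \<le> (\<integral>\<^sup>+x. \<integral>\<^sup>+y. ennreal ((cmod (g x))\<^sup>2 / 2) * ?h x y + ennreal ((cmod (g y))\<^sup>2 / 2) * ?h x y \<partial>lborel \<partial>lborel)"
    by (intro nn_integral_mono) auto
  also have "\<dots> = (\<integral>\<^sup>+x. \<integral>\<^sup>+y. ennreal ((cmod (g x))\<^sup>2 / 2) * ?h x y \<partial>lborel \<partial>lborel)
      + (\<integral>\<^sup>+x. \<integral>\<^sup>+y. ennreal ((cmod (g y))\<^sup>2 / 2) * ?h x y \<partial>lborel \<partial>lborel)"
    by (simp add: nn_integral_add)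
  also have "(\<integral>\<^sup>+x. \<integral>\<^sup>+y. ennreal ((cmod (g x))\<^sup>2 / 2) * ?h x y \<partial>lborel \<partial>lborel)
     = (\<integral>\<^sup>+x. ennreal ((cmod (g x))\<^sup>2 / 2) \<partial>lborel)"
    by (simp add: nn_integral_cmult heat_nn_integral[OF \<epsilon>])
  also have "(\<integral>\<^sup>+x. \<integral>\<^sup>+y. ennreal ((cmod (g y))\<^sup>2 / 2) * ?h x y \<partial>lborel \<partial>lborel)
     = (\<integral>\<^sup>+y. \<integral>\<^sup>+x. ennreal ((cmod (g y))\<^sup>2 / 2) * ?h x y \<partial>lborel \<partial>lborel)"
    by (rule lborel_pair.Fubini') measurable
  also have "\<dots> = (\<integral>\<^sup>+y. ennreal ((cmod (g y))\<^sup>2 / 2) \<partial>lborel)"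
    by (subst heat_minus) (simp add: nn_integral_cmult heat_nn_integral[OF \<epsilon>])
  also have "(\<integral>\<^sup>+x. ennreal ((cmod (g x))\<^sup>2 / 2) \<partial>lborel) + (\<integral>\<^sup>+y. ennreal ((cmod (g y))\<^sup>2 / 2) \<partial>lborel)
     = nn2 g"
    by (subst nn_integral_add[symmetric]) (auto simp: ennreal_plus[symmetric] simp del: ennreal_plus)
  finally show ?thesis .
qed

text \<open>With \<open>\<psi>\<close> the conjugate of the Fourier transform times the Gaussian weight, the multiplication formula
  turns the left hand side into the quadratic form of the heat kernel at \<open>g\<close>, to which Schur's test applies.\<close>

lemma fourier_gauss_weighted_bound:
  fixes g :: "'a::euclidean_space \<Rightarrow> complex"
  assumes g: "integrable lborel g" and \<epsilon>: "\<epsilon> > 0"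
  shows "(\<integral>\<^sup>+\<xi>. ennreal (gauss \<epsilon> \<xi> * (cmod (fourier g \<xi>))\<^sup>2) \<partial>lborel) \<le> nn2 g"
proof (cases "nn2 g < \<infinity>")
  case True
  have [measurable]: "g \<in> borel_measurable borel" using g by auto
  have h0: "0 \<le> heat \<epsilon> x" for x :: 'a by (rule less_imp_le[OF heat_pos[OF \<epsilon>]])
  define \<psi> where "\<psi> \<xi> = of_real (gauss \<epsilon> \<xi>) * cnj (fourier g \<xi>)" for \<xi>
  define B where "B = cmod (fourier_const TYPE('a)) * (LINT x|lborel. cmod (g x))"
  have B: "cmod (fourier g \<xi>) \<le> B" for \<xi> unfolding B_def by (rule norm_fourier_le)
  have igB: "integrable lborel (\<lambda>\<xi>::'a. c * gauss \<epsilon> \<xi>)" for c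
    by (intro integrable_mult_right integrable_gauss \<epsilon>)
  have \<psi>: "integrable lborel \<psi>"
  proof (rule Bochner_Integration.integrable_bound[OF igB[of B]])
    show "\<psi> \<in> borel_measurable lborel" unfolding \<psi>_def[abs_def] by measurable
    show "AE \<xi> in lborel. cmod (\<psi> \<xi>) \<le> norm (B * gauss \<epsilon> \<xi>)"
      using mult_right_mono[OF B less_imp_le[OF gauss_pos]] order_trans[OF norm_ge_zero B]
      by (intro AE_I2) (simp add: \<psi>_def norm_mult abs_of_pos[OF gauss_pos] abs_mult mult.commute)
  qed
  have F\<psi>: "fourier \<psi> x = cnj (LINT y|lborel. g y * of_real (heat \<epsilon> (x - y)))" for x
  proof -
    have "fourier \<psi> x = cnj (inverse_fourier (\<lambda>\<xi>. of_real (gauss \<epsilon> \<xi>) * fourier g \<xi>) x)"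
    proof -
      have "cnj (LINT \<xi>|lborel. cis (x \<bullet> \<xi>) * (of_real (gauss \<epsilon> \<xi>) * fourier g \<xi>))
          = (LINT \<xi>|lborel. cnj (cis (x \<bullet> \<xi>) * (of_real (gauss \<epsilon> \<xi>) * fourier g \<xi>)))"
        by (rule Bochner_Integration.integral_cnj[symmetric])
      then show ?thesis
        unfolding inverse_fourier_def fourier_def[of \<psi>] \<psi>_def by (simp add: cis_cnj inner_commute)
    qed
    then show ?thesis by (simp add: regularised_inversion[OF g \<epsilon>])
  qed
  have sq: "fourier g \<xi> * \<psi> \<xi> = of_real (gauss \<epsilon> \<xi> * (cmod (fourier g \<xi>))\<^sup>2)" for \<xi>
    by (simp only: \<psi>_def of_real_mult complex_norm_square mult_ac)
  have int: "integrable lborel (\<lambda>\<xi>. gauss \<epsilon> \<xi> * (cmod (fourier g \<xi>))\<^sup>2)"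
  proof (rule Bochner_Integration.integrable_bound[OF igB[of "B\<^sup>2"]])
    show "AE \<xi> in lborel. norm (gauss \<epsilon> \<xi> * (cmod (fourier g \<xi>))\<^sup>2) \<le> norm (B\<^sup>2 * gauss \<epsilon> \<xi>)"
      using B by (intro AE_I2)
       (simp add: abs_mult abs_of_pos[OF gauss_pos] mult.commute[of "B\<^sup>2"] gauss_pos power_mono)
  qed measurable
  have "complex_of_real (LINT \<xi>|lborel. gauss \<epsilon> \<xi> * (cmod (fourier g \<xi>))\<^sup>2)
      = (LINT \<xi>|lborel. fourier g \<xi> * \<psi> \<xi>)"
    unfolding sq by (rule integral_complex_of_real[symmetric])
  also have "\<dots> = (LINT x|lborel. g x * fourier \<psi> x)"
    by (rule fourier_multiplication_formula[OF g \<psi>])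
  finally have eq: "complex_of_real (LINT \<xi>|lborel. gauss \<epsilon> \<xi> * (cmod (fourier g \<xi>))\<^sup>2)
      = (LINT x|lborel. g x * fourier \<psi> x)" .
  have "(\<integral>\<^sup>+\<xi>. ennreal (gauss \<epsilon> \<xi> * (cmod (fourier g \<xi>))\<^sup>2) \<partial>lborel)
      = ennreal (LINT \<xi>|lborel. gauss \<epsilon> \<xi> * (cmod (fourier g \<xi>))\<^sup>2)"
    by (intro nn_integral_eq_integral int AE_I2) (simp add: gauss_pos less_imp_le)
  also have "(LINT \<xi>|lborel. gauss \<epsilon> \<xi> * (cmod (fourier g \<xi>))\<^sup>2) \<le> cmod (LINT x|lborel. g x * fourier \<psi> x)"
    unfolding eq[symmetric] by simp
  also have "ennreal (cmod (LINT x|lborel. g x * fourier \<psi> x)) \<le> (\<integral>\<^sup>+x. ennreal (cmod (g x * fourier \<psi> x)) \<partial>lborel)"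
    by (cases "integrable lborel (\<lambda>x. g x * fourier \<psi> x)")
      (auto simp: integral_norm_bound_ennreal not_integrable_integral_eq)
  also have "\<dots> \<le> (\<integral>\<^sup>+x. \<integral>\<^sup>+y. ennreal (cmod (g x) * cmod (g y) * heat \<epsilon> (x - y)) \<partial>lborel \<partial>lborel)"
  proof (rule nn_integral_mono)
    fix x
    have "ennreal (cmod (LINT y|lborel. g y * of_real (heat \<epsilon> (x - y))))
       \<le> (\<integral>\<^sup>+y. ennreal (cmod (g y * of_real (heat \<epsilon> (x - y)))) \<partial>lborel)"
      by (cases "integrable lborel (\<lambda>y. g y * complex_of_real (heat \<epsilon> (x - y)))")
        (auto simp: integral_norm_bound_ennreal not_integrable_integral_eq)
    then have "ennreal (cmod (g x)) * ennreal (cmod (fourier \<psi> x))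
      \<le> ennreal (cmod (g x)) * (\<integral>\<^sup>+y. ennreal (cmod (g y * of_real (heat \<epsilon> (x - y)))) \<partial>lborel)"
      unfolding F\<psi> by (intro mult_left_mono) auto
    also have "\<dots> = (\<integral>\<^sup>+y. ennreal (cmod (g x)) * ennreal (cmod (g y * of_real (heat \<epsilon> (x - y)))) \<partial>lborel)"
      by (rule nn_integral_cmult[symmetric]) measurable
    finally show "ennreal (cmod (g x * fourier \<psi> x))
      \<le> (\<integral>\<^sup>+y. ennreal (cmod (g x) * cmod (g y) * heat \<epsilon> (x - y)) \<partial>lborel)"
      by (simp add: norm_mult ennreal_mult mult.assoc h0)
  qed
  also have "\<dots> \<le> nn2 g" by (rule heat_schur[OF _ \<epsilon>]) measurable
  finally show ?thesis by (simp add: ennreal_leI)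
qed (simp add: not_less top_unique)

text \<open>Fatou's lemma for the Gaussian weights tending to one. Applied to the transform and to its inverse,
  this inequality compares the norms in both directions.\<close>

lemma fourier_L2_contraction:
  fixes g :: "'a::euclidean_space \<Rightarrow> complex"
  assumes g: "integrable lborel g"
  shows "nn2 (fourier g) \<le> nn2 g"
proof -
  have [measurable]: "g \<in> borel_measurable borel" using g by auto
  let ?w = "\<lambda>n \<xi>. ennreal (gauss (1 / real (Suc n)) \<xi> * (cmod (fourier g \<xi>))\<^sup>2)"
  have "(\<lambda>n. ?w n \<xi>) \<longlonglongrightarrow> ennreal (1 * (cmod (fourier g \<xi>))\<^sup>2)" for \<xi>
    by (intro tendsto_ennrealI tendsto_mult gauss_tendsto_1 tendsto_const)
  then have "ennreal ((cmod (fourier g \<xi>))\<^sup>2) = liminf (\<lambda>n. ?w n \<xi>)" for \<xi>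
    unfolding mult_1 by (rule lim_imp_Liminf[OF trivial_limit_sequentially, symmetric])
  then have "nn2 (fourier g) = (\<integral>\<^sup>+\<xi>. liminf (\<lambda>n. ?w n \<xi>) \<partial>lborel)" by simp
  also have "\<dots> \<le> liminf (\<lambda>n. \<integral>\<^sup>+\<xi>. ?w n \<xi> \<partial>lborel)"
    by (rule nn_integral_liminf) measurable
  also have "\<dots> \<le> nn2 g"
    by (rule Liminf_le) (auto intro!: always_eventually fourier_gauss_weighted_bound[OF g])
  finally show ?thesis .
qed

lemma nn2_add_le: "nn2 (\<lambda>x. f x + g x) \<le> 2 * nn2 f + 2 * nn2 g"
  if [measurable]: "f \<in> borel_measurable borel" "g \<in> borel_measurable borel"
proof -
  have "ennreal ((cmod (f x + g x))\<^sup>2) \<le> 2 * ennreal ((cmod (f x))\<^sup>2) + 2 * ennreal ((cmod (g x))\<^sup>2)" for x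
  proof -
    have "(cmod (f x + g x))\<^sup>2 \<le> (cmod (f x) + cmod (g x))\<^sup>2"
      by (intro power_mono norm_triangle_ineq) auto
    also have "\<dots> \<le> 2 * (cmod (f x))\<^sup>2 + 2 * (cmod (g x))\<^sup>2"
      using sum_squares_bound[of "cmod (f x)" "cmod (g x)"] by (simp add: power2_sum)
    finally have "ennreal ((cmod (f x + g x))\<^sup>2) \<le> ennreal (2 * (cmod (f x))\<^sup>2 + 2 * (cmod (g x))\<^sup>2)"
      by (rule ennreal_leI)
    then show ?thesis by (simp add: ennreal_mult)
  qed
  then have "nn2 (\<lambda>x. f x + g x) \<le> (\<integral>\<^sup>+x. 2 * ennreal ((cmod (f x))\<^sup>2) + 2 * ennreal ((cmod (g x))\<^sup>2) \<partial>lborel)"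
    by (intro nn_integral_mono)
  also have "\<dots> = 2 * nn2 f + 2 * nn2 g"
    by (simp add: nn_integral_add nn_integral_cmult)
  finally show ?thesis .
qed

lemma L2_fun_add: "f \<in> L2_fun \<Longrightarrow> g \<in> L2_fun \<Longrightarrow> (\<lambda>x. f x + g x) \<in> L2_fun"
  using nn2_add_le[of f g] by (auto simp: L2_fun_iff ennreal_mult_less_top intro: le_less_trans)

lemma L2_fun_cmult: "f \<in> L2_fun \<Longrightarrow> (\<lambda>x. c * f x) \<in> L2_fun"
  by (auto simp: L2_fun_def norm_mult power_mult_distrib)

lemma L2_fun_diff: "f \<in> L2_fun \<Longrightarrow> g \<in> L2_fun \<Longrightarrow> (\<lambda>x. f x - g x) \<in> L2_fun"
  using L2_fun_add[of f "\<lambda>x. -1 * g x"] L2_fun_cmult[of g "-1"] by simp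

lemma fourier_diff:
  "integrable lborel f \<Longrightarrow> integrable lborel g \<Longrightarrow> fourier (\<lambda>x. f x - g x) \<xi> = fourier f \<xi> - fourier g \<xi>"
  using fourier_lincomb[of f g "-1" \<xi>] by simp

text \<open>The increments are dominated by a geometric sequence with the ratio \<open>1 / sqrt 2\<close>.\<close>

lemma convergent_if_increments_decay:
  fixes a :: "nat \<Rightarrow> complex"
  assumes "\<And>j. 2 ^ j * (cmod (a (Suc j) - a j))\<^sup>2 \<le> H"
  shows "convergent a"
proof -
  define q where "q = 1 / sqrt 2"
  have q: "q\<^sup>2 = 1 / 2" "0 < q" "q < 1" by (auto simp: q_def power_divide)
  have H0: "0 \<le> H" by (rule order_trans[OF _ assms[of 0]]) simp
  have le: "cmod (a (Suc j) - a j) \<le> sqrt H * q ^ j" for j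
  proof (rule power2_le_imp_le)
    have "(q ^ j)\<^sup>2 = (q\<^sup>2) ^ j" unfolding power_mult[symmetric] by (simp only: mult.commute)
    then have "(sqrt H * q ^ j)\<^sup>2 = H * (1 / 2) ^ j"
      using H0 by (simp only: power_mult_distrib q(1) real_sqrt_pow2)
    moreover have "(cmod (a (Suc j) - a j))\<^sup>2 \<le> H * (1 / 2) ^ j"
      using assms[of j] by (simp add: power_one_over field_simps)
    ultimately show "(cmod (a (Suc j) - a j))\<^sup>2 \<le> (sqrt H * q ^ j)\<^sup>2" by (simp only:)
  qed (use H0 q in simp)
  have "summable (\<lambda>j. sqrt H * q ^ j)"
    using q by (intro summable_mult summable_geometric) simp
  then have "summable (\<lambda>j. a (Suc j) - a j)"
    by (rule summable_comparison_test'[where N=0]) (rule le)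
  then have "(\<lambda>n. \<Sum>j<n. a (Suc j) - a j) \<longlonglongrightarrow> (\<Sum>j. a (Suc j) - a j)"
    by (rule summable_LIMSEQ)
  then have "(\<lambda>n. (a n - a 0) + a 0) \<longlonglongrightarrow> (\<Sum>j. a (Suc j) - a j) + a 0"
    unfolding sum_lessThan_telescope by (rule tendsto_add[OF _ tendsto_const])
  then show ?thesis by (auto simp: convergent_def)
qed

lemma L2_truncation_tendsto:
  fixes g :: "'a::euclidean_space \<Rightarrow> complex"
  assumes g: "g \<in> L2_fun"
  shows "(\<lambda>k::nat. nn2 (\<lambda>x. g x - indicator (cball 0 (real k)) x * g x)) \<longlonglongrightarrow> 0"
proof -
  note [measurable] = L2_fun_measurable[OF g]
  have "(\<lambda>k::nat. nn2 (\<lambda>x. g x - indicator (cball 0 (real k)) x * g x)) \<longlonglongrightarrow> nn2 (\<lambda>x::'a. 0)"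
  proof (rule nn_integral_dominated_convergence)
    show "nn2 g < \<infinity>" using g by (simp add: L2_fun_iff)
    show "AE x in lborel. (\<lambda>k. ennreal ((cmod (g x - indicator (cball 0 (real k)) x * g x))\<^sup>2)) \<longlonglongrightarrow> ennreal ((cmod 0)\<^sup>2)"
    proof (intro AE_I2 tendsto_eventually)
      fix x :: 'a
      have "\<forall>\<^sub>F k in sequentially. norm x \<le> real k"
        using filterlim_real_sequentially by (auto simp: filterlim_at_top)
      then show "\<forall>\<^sub>F k in sequentially. ennreal ((cmod (g x - indicator (cball 0 (real k)) x * g x))\<^sup>2) = ennreal ((cmod 0)\<^sup>2)"
        by eventually_elim simp
    qed
  qed (auto simp: indicator_def)
  then show ?thesis by simp
qed

lemma young_weighted:
  fixes a b c :: real
  assumes "c > 0"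
  shows "a * b \<le> c / 2 * a\<^sup>2 + (1 / c) / 2 * b\<^sup>2"
proof -
  have "0 \<le> (c * a - b)\<^sup>2 / (2 * c)" using assms by simp
  also have "\<dots> = c / 2 * a\<^sup>2 + (1 / c) / 2 * b\<^sup>2 - a * b"
    using assms by (simp add: field_simps power2_eq_square)
  finally show ?thesis by simp
qed

text \<open>The truncations of \<open>g\<close> to balls are integrable, so their Fourier transforms \<open>F j\<close> are integrals. Along a
  subsequence with rapidly decreasing errors these converge almost everywhere, as in the Riesz-Fischer
  theorem, and Fatou's lemma carries the bounds of the contraction property over to the limit \<open>f\<close>.\<close>

theorem fourier_L2_extension:
  fixes g :: "'a::euclidean_space \<Rightarrow> complex"
  assumes g: "g \<in> L2_fun"
  obtains f where "f \<in> L2_fun" "L2_fun_norm f \<le> L2_fun_norm g"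
    "\<And>\<phi>. \<phi> \<in> schwartz \<Longrightarrow> (LINT x|lborel. g x * fourier \<phi> x) = (LINT x|lborel. f x * \<phi> x)"
proof -
  note gm[measurable] = L2_fun_measurable[OF g]
  have [measurable]: "cball (0::'a) r \<in> sets borel" for r by simp
  \<comment> \<open>The condition \<open>j \<le> k\<close> makes the balls exhaust the space.\<close>
  have "\<exists>k::nat. nn2 (\<lambda>x. g x - indicator (cball 0 (real k)) x * g x) < ennreal (1 / 4 ^ j) \<and> j \<le> k" for j
  proof -
    have "\<forall>\<^sub>F k::nat in sequentially. nn2 (\<lambda>x. g x - indicator (cball 0 (real k)) x * g x) < ennreal (1 / 4 ^ j)"
      by (intro order_tendstoD(2)[OF L2_truncation_tendsto[OF g]]) simp
    moreover have "\<forall>\<^sub>F k in sequentially. j \<le> k" by (rule eventually_ge_at_top)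
    ultimately have "\<forall>\<^sub>F k::nat in sequentially. nn2 (\<lambda>x. g x - indicator (cball 0 (real k)) x * g x) < ennreal (1 / 4 ^ j) \<and> j \<le> k"
      by eventually_elim simp
    then show ?thesis by (rule eventually_happens'[OF trivial_limit_sequentially])
  qed
  then obtain K :: "nat \<Rightarrow> nat" where K: "\<And>j. nn2 (\<lambda>x. g x - indicator (cball 0 (real (K j))) x * g x) < ennreal (1 / 4 ^ j)"
    and Kj: "\<And>j. j \<le> K j" using choice[of "\<lambda>j k. nn2 (\<lambda>x. g x - indicator (cball 0 (real k)) x * g x) < ennreal (1 / 4 ^ j) \<and> j \<le> k"] by blast
  define G where "G j x = indicator (cball 0 (real (K j))) x * g x" for j x
  have [measurable]: "G j \<in> borel_measurable borel" for j unfolding G_def[abs_def] by measurable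
  have Gle: "cmod (G j x) \<le> cmod (g x)" for j x by (simp add: G_def indicator_def)
  have Gint: "integrable lborel (G j)" for j
  proof (rule Bochner_Integration.integrable_bound)
    show "integrable lborel (\<lambda>x. indicator (cball 0 (real (K j))) x + (cmod (g x))\<^sup>2)"
      by (intro Bochner_Integration.integrable_add L2_fun_integrable[OF g] integrable_real_indicator)
        (auto simp: emeasure_lborel_cball_finite[unfolded infinity_ennreal_def])
    have "a \<le> 1 + a\<^sup>2" for a :: real using zero_le_power2[of "a - 1 / 2"] by (simp add: power2_diff power_divide)
    then show "AE x in lborel. cmod (G j x) \<le> norm (indicator (cball 0 (real (K j))) x + (cmod (g x))\<^sup>2)"
      by (intro AE_I2) (auto simp: G_def indicator_def)
  qed measurable
  have Gdiff: "nn2 (\<lambda>x. G i x - G j x) \<le> ennreal (4 / 4 ^ j)" if "j \<le> i" for i j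
  proof -
    have "nn2 (\<lambda>x. G i x - G j x) = nn2 (\<lambda>x. (G i x - g x) + (g x - G j x))" by simp
    also have "\<dots> \<le> 2 * nn2 (\<lambda>x. G i x - g x) + 2 * nn2 (\<lambda>x. g x - G j x)"
      by (rule nn2_add_le) measurable
    also have "nn2 (\<lambda>x. G i x - g x) = nn2 (\<lambda>x. g x - G i x)" by (simp add: norm_minus_commute)
    also have "2 * nn2 (\<lambda>x. g x - G i x) + 2 * nn2 (\<lambda>x. g x - G j x) \<le> 2 * ennreal (1 / 4 ^ i) + 2 * ennreal (1 / 4 ^ j)"
      unfolding G_def by (intro add_mono mult_left_mono less_imp_le[OF K]) auto
    also have "\<dots> \<le> 2 * ennreal (1 / 4 ^ j) + 2 * ennreal (1 / 4 ^ j)"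
      using that by (intro add_mono mult_left_mono ennreal_leI) (auto simp: field_simps power_increasing)
    also have "\<dots> = ennreal 2 * ennreal (1 / 4 ^ j) + ennreal 2 * ennreal (1 / 4 ^ j)" by simp
    also have "\<dots> = ennreal (4 / 4 ^ j)"
      by (subst (1 2) ennreal_mult[symmetric]) (auto simp: ennreal_plus[symmetric] simp del: ennreal_plus)
    finally show ?thesis .
  qed
  define F where "F j = fourier (G j)" for j
  have [measurable]: "F j \<in> borel_measurable borel" for j unfolding F_def by measurable
  have Fdiff: "nn2 (\<lambda>x. F i x - F j x) \<le> ennreal (4 / 4 ^ j)" if "j \<le> i" for i j
  proof -
    have "nn2 (\<lambda>x. F i x - F j x) = nn2 (fourier (\<lambda>x. G i x - G j x))"
      by (simp add: F_def fourier_diff Gint)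
    also have "\<dots> \<le> nn2 (\<lambda>x. G i x - G j x)"
      by (intro fourier_L2_contraction Bochner_Integration.integrable_diff Gint)
    also have "\<dots> \<le> ennreal (4 / 4 ^ j)" by (rule Gdiff[OF that])
    finally show ?thesis .
  qed
  define f where "f x = lim (\<lambda>j. F j x)" for x
  have [measurable]: "f \<in> borel_measurable borel"
    unfolding f_def[abs_def] by measurable
  have conv: "AE x in lborel. (\<lambda>j. F j x) \<longlonglongrightarrow> f x"
  proof -
    \<comment> \<open>The squared increments are of the order \<open>4\<^sup>-\<^sup>j\<close>; the factor \<open>2\<^sup>j\<close> leaves their sum
        finite and yields a geometric bound for the increments themselves at almost every point.\<close>
    have "(\<integral>\<^sup>+x. (\<Sum>j. ennreal (2 ^ j) * ennreal ((cmod (F (Suc j) x - F j x))\<^sup>2)) \<partial>lborel)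
       = (\<Sum>j. ennreal (2 ^ j) * nn2 (\<lambda>x. F (Suc j) x - F j x))"
      by (subst nn_integral_suminf) (simp_all add: nn_integral_cmult)
    also have "\<dots> \<le> (\<Sum>j. ennreal (2 ^ j) * ennreal (4 / 4 ^ j))"
      by (intro suminf_le mult_left_mono Fdiff) auto
    also have "\<dots> = (\<Sum>j. ennreal (4 * (1 / 2) ^ j))"
    proof -
      have "2 ^ j * (4 / 4 ^ j) = (4 * (1 / 2) ^ j :: real)" for j
        using power_mult_distrib[of "2::real" 2 j] by (simp add: power_divide field_simps)
      then show ?thesis by (simp add: ennreal_mult[symmetric])
    qed
    also have "\<dots> < \<infinity>"
      by (subst suminf_ennreal2) (auto intro!: summable_mult summable_geometric)
    finally have "AE x in lborel. (\<Sum>j. ennreal (2 ^ j) * ennreal ((cmod (F (Suc j) x - F j x))\<^sup>2)) \<noteq> \<infinity>"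
      by (intro nn_integral_PInf_AE) auto
    then show ?thesis
    proof eventually_elim
      case (elim x)
      then obtain H where H: "0 \<le> H" "(\<Sum>j. ennreal (2 ^ j) * ennreal ((cmod (F (Suc j) x - F j x))\<^sup>2)) = ennreal H"
        by (cases "(\<Sum>j. ennreal (2 ^ j) * ennreal ((cmod (F (Suc j) x - F j x))\<^sup>2))") auto
      have "2 ^ j * (cmod (F (Suc j) x - F j x))\<^sup>2 \<le> H" for j
      proof -
        have "(\<Sum>j\<in>{j}. ennreal (2 ^ j) * ennreal ((cmod (F (Suc j) x - F j x))\<^sup>2)) \<le> ennreal H"
          unfolding H(2)[symmetric] by (rule sum_le_suminf) auto
        then show ?thesis using H(1) by (simp add: ennreal_mult[symmetric])
      qed
      then have "convergent (\<lambda>j. F j x)" by (rule convergent_if_increments_decay)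
      then show ?case by (simp add: f_def convergent_LIMSEQ_iff)
    qed
  qed
  have nnf: "nn2 (\<lambda>x. f x - h x) \<le> C" if [measurable]: "h \<in> borel_measurable borel"
    and C: "\<forall>\<^sub>F i in sequentially. nn2 (\<lambda>x. F i x - h x) \<le> C" for h C
  proof -
    have "nn2 (\<lambda>x. f x - h x) = (\<integral>\<^sup>+x. liminf (\<lambda>i. ennreal ((cmod (F i x - h x))\<^sup>2)) \<partial>lborel)"
    proof (rule nn_integral_cong_AE)
      show "AE x in lborel. ennreal ((cmod (f x - h x))\<^sup>2) = liminf (\<lambda>i. ennreal ((cmod (F i x - h x))\<^sup>2))"
        using conv
      proof eventually_elim
        case (elim x)
        then have "(\<lambda>i. ennreal ((cmod (F i x - h x))\<^sup>2)) \<longlonglongrightarrow> ennreal ((cmod (f x - h x))\<^sup>2)"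
          by (intro tendsto_intros)
        then show ?case by (rule lim_imp_Liminf[OF trivial_limit_sequentially, symmetric])
      qed
    qed
    also have "\<dots> \<le> liminf (\<lambda>i. nn2 (\<lambda>x. F i x - h x))"
      by (rule nn_integral_liminf) measurable
    also have "\<dots> \<le> C" using C by (intro Liminf_le) auto
    finally show ?thesis .
  qed
  have Fle: "nn2 (F i) \<le> nn2 g" for i
  proof -
    have "nn2 (F i) \<le> nn2 (G i)" unfolding F_def by (rule fourier_L2_contraction[OF Gint])
    also have "\<dots> \<le> nn2 g" by (intro nn_integral_mono ennreal_leI power_mono Gle) auto
    finally show ?thesis .
  qed
  have "nn2 f \<le> nn2 g" using nnf[of "\<lambda>x. 0" "nn2 g"] Fle by simp
  note f = L2_fun_norm_le[OF _ this g, simplified]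
  have FL: "F i \<in> L2_fun" for i
    by (rule L2_fun_norm_le(1)[OF _ Fle g]) measurable
  show thesis
  proof (rule that[OF f])
    fix \<phi> :: "'a \<Rightarrow> complex" assume \<phi>: "\<phi> \<in> schwartz"
    note \<phi>L = schwartz_L2[OF \<phi>] and F\<phi>L = schwartz_L2[OF fourier_schwartz[OF \<phi>]]
    note [measurable] = schwartz_measurable[OF \<phi>] schwartz_measurable[OF fourier_schwartz[OF \<phi>]]
    have "(\<lambda>j. LINT x|lborel. G j x * fourier \<phi> x) \<longlonglongrightarrow> (LINT x|lborel. g x * fourier \<phi> x)"
    proof (rule integral_dominated_convergence)
      show "integrable lborel (\<lambda>x. cmod (g x * fourier \<phi> x))"
        by (intro integrable_norm L2_fun_mult_integrable g F\<phi>L)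
      show "AE x in lborel. (\<lambda>j. G j x * fourier \<phi> x) \<longlonglongrightarrow> g x * fourier \<phi> x"
      proof (intro AE_I2 tendsto_mult tendsto_const tendsto_eventually)
        fix x :: 'a
        have "\<forall>\<^sub>F k in sequentially. norm x \<le> real k"
          using filterlim_real_sequentially by (auto simp: filterlim_at_top)
        then show "\<forall>\<^sub>F j in sequentially. G j x = g x"
        proof eventually_elim
          case (elim j)
          then have "norm x \<le> real (K j)" using Kj[of j] by linarith
          then show ?case by (simp add: G_def)
        qed
      qed
      show "AE x in lborel. cmod (G j x * fourier \<phi> x) \<le> cmod (g x * fourier \<phi> x)" for j
        using Gle by (intro AE_I2) (simp add: norm_mult mult_right_mono)
    qed measurable
    moreover have "(LINT x|lborel. G j x * fourier \<phi> x) = (LINT x|lborel. F j x * \<phi> x)" for j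
      unfolding F_def
      by (rule fourier_multiplication_formula[OF Gint schwartz_integrable[OF \<phi>], symmetric])
    ultimately have 1: "(\<lambda>j. LINT x|lborel. F j x * \<phi> x) \<longlonglongrightarrow> (LINT x|lborel. g x * fourier \<phi> x)"
      by simp
    have "(\<lambda>j. (LINT x|lborel. F j x * \<phi> x) - (LINT x|lborel. f x * \<phi> x)) \<longlonglongrightarrow> 0"
    proof (rule Lim_null_comparison)
      show "(\<lambda>j::nat. 2 * (1 / 2) ^ j + (1 / 2) ^ j * (L2_fun_norm \<phi>)\<^sup>2 / 2) \<longlonglongrightarrow> 0"
        by (rule tendsto_eq_intros LIMSEQ_power_zero refl | simp)+
      have "cmod ((LINT x|lborel. F j x * \<phi> x) - (LINT x|lborel. f x * \<phi> x))
          \<le> 2 * (1 / 2) ^ j + (1 / 2) ^ j * (L2_fun_norm \<phi>)\<^sup>2 / 2" for j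
      proof -
        have d: "(\<lambda>x. f x - F j x) \<in> L2_fun" by (intro L2_fun_diff f FL)
        have "nn2 (\<lambda>x. f x - F j x) \<le> ennreal (4 / 4 ^ j)"
          by (rule nnf) (auto intro!: eventually_sequentiallyI[of j] Fdiff)
        then have d2: "(LINT x|lborel. (cmod (f x - F j x))\<^sup>2) \<le> 4 / 4 ^ j"
          unfolding nn2_eq[OF d] L2_fun_norm_power2 by (subst (asm) ennreal_le_iff) auto
        have "(LINT x|lborel. F j x * \<phi> x) - (LINT x|lborel. f x * \<phi> x)
            = - (LINT x|lborel. (f x - F j x) * \<phi> x)"
          by (simp add: left_diff_distrib L2_fun_mult_integrable[OF FL \<phi>L] L2_fun_mult_integrable[OF f(1) \<phi>L])
        then have "cmod ((LINT x|lborel. F j x * \<phi> x) - (LINT x|lborel. f x * \<phi> x))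
            \<le> (LINT x|lborel. cmod ((f x - F j x) * \<phi> x))"
          by (simp add: integral_norm_bound)
        \<comment> \<open>Young's inequality with the weight \<open>2\<^sup>j\<close>, which the error \<open>4 / 4\<^sup>j\<close> outweighs.\<close>
        also have "\<dots> \<le> (LINT x|lborel. 2 ^ j / 2 * (cmod (f x - F j x))\<^sup>2 + (1 / 2) ^ j / 2 * (cmod (\<phi> x))\<^sup>2)"
        proof (rule Bochner_Integration.integral_mono)
          show "integrable lborel (\<lambda>x. 2 ^ j / 2 * (cmod (f x - F j x))\<^sup>2 + (1 / 2) ^ j / 2 * (cmod (\<phi> x))\<^sup>2)"
            by (intro Bochner_Integration.integrable_add integrable_mult_right L2_fun_integrable d \<phi>L)
          show "integrable lborel (\<lambda>x. cmod ((f x - F j x) * \<phi> x))"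
            by (intro integrable_norm L2_fun_mult_integrable d \<phi>L)
          fix x
          show "cmod ((f x - F j x) * \<phi> x) \<le> 2 ^ j / 2 * (cmod (f x - F j x))\<^sup>2 + (1 / 2) ^ j / 2 * (cmod (\<phi> x))\<^sup>2"
            using young_weighted[of "2 ^ j" "cmod (f x - F j x)" "cmod (\<phi> x)"] by (simp add: norm_mult power_divide)
        qed
        also have "\<dots> = 2 ^ j / 2 * (LINT x|lborel. (cmod (f x - F j x))\<^sup>2) + (1 / 2) ^ j / 2 * (L2_fun_norm \<phi>)\<^sup>2"
          unfolding L2_fun_norm_power2
          by (subst Bochner_Integration.integral_add) (auto intro!: integrable_mult_right L2_fun_integrable d \<phi>L)
        also have "\<dots> \<le> 2 ^ j / 2 * (4 / 4 ^ j) + (1 / 2) ^ j / 2 * (L2_fun_norm \<phi>)\<^sup>2"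
          by (intro add_right_mono mult_left_mono d2) auto
        also have "2 ^ j / 2 * (4 / 4 ^ j) = 2 * (1 / 2 :: real) ^ j"
          using power_mult_distrib[of "2::real" 2 j] by (simp add: power_divide field_simps)
        finally show ?thesis by simp
      qed
      then show "\<forall>\<^sub>F j in sequentially. cmod ((LINT x|lborel. F j x * \<phi> x) - (LINT x|lborel. f x * \<phi> x))
          \<le> 2 * (1 / 2) ^ j + (1 / 2) ^ j * (L2_fun_norm \<phi>)\<^sup>2 / 2"
        by (intro always_eventually allI)
    qed
    then have "(\<lambda>j. LINT x|lborel. F j x * \<phi> x) \<longlonglongrightarrow> (LINT x|lborel. f x * \<phi> x)"
      by (simp add: LIM_zero_iff)
    with 1 show "(LINT x|lborel. g x * fourier \<phi> x) = (LINT x|lborel. f x * \<phi> x)"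
      by (rule LIMSEQ_unique)
  qed
qed

section \<open>Schwartz functions determine a density\<close>

definition sigm :: "real \<Rightarrow> real" where
  "sigm x = 1 / (1 + exp (- x))"

lemma sigm_pos: "0 < sigm x" and sigm_le_1: "sigm x \<le> 1" and sigm_le_exp: "sigm x \<le> exp x"
proof -
  have p: "0 < 1 + exp (- x)" by (simp add: add_pos_pos)
  show "0 < sigm x" "sigm x \<le> 1" using p by (auto simp: sigm_def)
  have "exp x * exp (- x) = 1" by (simp add: exp_minus)
  then show "sigm x \<le> exp x" using p by (simp add: sigm_def divide_le_eq distrib_left)
qed

lemma sigm_derivative: "(sigm has_real_derivative sigm x * (1 - sigm x)) (at x)"
proof -
  have p: "1 + exp (- x) \<noteq> 0" using add_pos_pos[OF zero_less_one exp_gt_zero, of "- x"] by linarith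
  show ?thesis
    unfolding sigm_def[abs_def] using p
    by (auto intro!: derivative_eq_intros simp: field_simps power2_eq_square)
qed

text \<open>Sigmoids approximate step functions, and since the derivative of \<^const>\<open>sigm\<close> is \<open>sigm (1 - sigm)\<close>, the
  polynomials in sigmoids are closed under differentiation. They replace bump functions.\<close>

inductive sigm_poly :: "(real \<Rightarrow> real) \<Rightarrow> bool" where
  const: "sigm_poly (\<lambda>x. c)"
| sigm: "sigm_poly (\<lambda>x. sigm (k * x + c))"
| add: "sigm_poly p \<Longrightarrow> sigm_poly q \<Longrightarrow> sigm_poly (\<lambda>x. p x + q x)"
| mult: "sigm_poly p \<Longrightarrow> sigm_poly q \<Longrightarrow> sigm_poly (\<lambda>x. p x * q x)"

lemma sigm_poly_bounded: "sigm_poly p \<Longrightarrow> \<exists>B\<ge>0. \<forall>x. \<bar>p x\<bar> \<le> B"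
proof (induction rule: sigm_poly.induct)
  case (const c)
  then show ?case by (intro exI[of _ "\<bar>c\<bar>"]) auto
next
  case (sigm k c)
  then show ?case
    by (intro exI[of _ 1]) (auto simp: abs_of_pos[OF sigm_pos] sigm_le_1)
next
  case (add p q)
  then obtain A B where "\<forall>x. \<bar>p x\<bar> \<le> A" "\<forall>x. \<bar>q x\<bar> \<le> B" "0 \<le> A" "0 \<le> B" by blast
  then show ?case
    by (intro exI[of _ "A + B"]) (auto intro!: order_trans[OF abs_triangle_ineq] add_mono)
next
  case (mult p q)
  then obtain A B where "\<forall>x. \<bar>p x\<bar> \<le> A" "\<forall>x. \<bar>q x\<bar> \<le> B" "0 \<le> A" "0 \<le> B" by blast
  then show ?case
    by (intro exI[of _ "A * B"]) (auto simp: abs_mult intro!: mult_mono)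
qed

lemma sigm_poly_derivative:
  "sigm_poly p \<Longrightarrow> \<exists>p'. sigm_poly p' \<and> (\<forall>x. (p has_real_derivative p' x) (at x))"
proof (induction rule: sigm_poly.induct)
  case (const c)
  show ?case by (rule exI[of _ "\<lambda>x. 0"]) (auto intro: sigm_poly.intros)
next
  case (sigm k c)
  let ?s = "\<lambda>x. sigm (k * x + c)"
  have "sigm_poly (\<lambda>x. k * (?s x * (1 + - 1 * ?s x)))"
    by (intro sigm_poly.intros)
  moreover have "(?s has_real_derivative k * (?s x * (1 + - 1 * ?s x))) (at x)" for x
  proof -
    have "((\<lambda>x. k * x + c) has_real_derivative k) (at x)"
      by (auto intro!: derivative_eq_intros)
    from DERIV_chain[OF sigm_derivative this] show ?thesis
      by (simp add: o_def mult_ac)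
  qed
  ultimately show ?case by blast
next
  case (add p q)
  then obtain p' q' where "sigm_poly p'" "\<forall>x. (p has_real_derivative p' x) (at x)"
    "sigm_poly q'" "\<forall>x. (q has_real_derivative q' x) (at x)" by blast
  then show ?case
    by (intro exI[of _ "\<lambda>x. p' x + q' x"]) (auto intro!: sigm_poly.intros derivative_intros)
next
  case (mult p q)
  then obtain p' q' where d: "sigm_poly p'" "\<forall>x. (p has_real_derivative p' x) (at x)"
    "sigm_poly q'" "\<forall>x. (q has_real_derivative q' x) (at x)" by blast
  have "sigm_poly (\<lambda>x. p' x * q x + q' x * p x)"
    using d mult.hyps by (intro sigm_poly.intros)
  moreover have "((\<lambda>x. p x * q x) has_real_derivative p' x * q x + q' x * p x) (at x)" for x
    by (rule DERIV_mult) (use d in blast)+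
  ultimately show ?case by blast
qed

text \<open>The derivative of the sigmoid. It decays exponentially and makes every polynomial in sigmoids rapidly
  decreasing.\<close>

definition decay_weight :: "real \<Rightarrow> real" where
  "decay_weight x = sigm x * sigm (- x)"

lemma decay_weight_pos: "0 < decay_weight x"
  by (simp add: decay_weight_def sigm_pos)

lemma decay_weight_le: "decay_weight x \<le> exp (- \<bar>x\<bar>)"
proof -
  have "sigm x * sigm (- x) \<le> sigm x" "sigm x * sigm (- x) \<le> sigm (- x)"
    by (simp_all add: mult_left_le mult_left_le_one_le sigm_le_1 less_imp_le[OF sigm_pos])
  then show ?thesis
    using sigm_le_exp[of x] sigm_le_exp[of "- x"] unfolding decay_weight_def
    by (cases "0 \<le> x") auto
qed

lemma power_le_exp: "0 \<le> x \<Longrightarrow> (1 + x) ^ N \<le> real N ^ N * exp x"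
proof (cases N)
  case (Suc n)
  assume x: "0 \<le> x"
  have "1 + x \<le> real N * (1 + x / real N)" using x Suc by (simp add: distrib_left)
  also have "\<dots> \<le> real N * exp (x / real N)" by (intro mult_left_mono exp_ge_add_one_self) auto
  finally have "(1 + x) ^ N \<le> (real N * exp (x / real N)) ^ N" using x by (intro power_mono) auto
  also have "\<dots> = real N ^ N * exp (real N * (x / real N))"
    by (simp only: power_mult_distrib exp_of_nat_mult)
  also have "real N * (x / real N) = x" using Suc by simp
  finally show ?thesis .
qed auto

lemma decay_weight_decay: "(1 + \<bar>x\<bar>) ^ N * decay_weight x \<le> real N ^ N"
proof -
  have "(1 + \<bar>x\<bar>) ^ N * decay_weight x \<le> (real N ^ N * exp \<bar>x\<bar>) * exp (- \<bar>x\<bar>)"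
    by (intro mult_mono power_le_exp decay_weight_le) (auto simp: less_imp_le[OF decay_weight_pos])
  then show ?thesis by (simp add: mult.assoc exp_minus)
qed

definition test_1d :: "(real \<Rightarrow> real) \<Rightarrow> bool" where
  "test_1d p \<longleftrightarrow> (\<exists>q. sigm_poly q \<and> p = (\<lambda>x. decay_weight x * q x))"

lemma test_1d_derivative:
  assumes "test_1d p"
  obtains p' where "test_1d p'" "\<And>x. (p has_real_derivative p' x) (at x)"
proof -
  obtain q where q: "sigm_poly q" "p = (\<lambda>x. decay_weight x * q x)"
    using assms by (auto simp: test_1d_def)
  obtain q' where q': "sigm_poly q'" "\<And>x. (q has_real_derivative q' x) (at x)"
    using sigm_poly_derivative[OF q(1)] by blast
  let ?d = "\<lambda>x. sigm ((- 1) * x + 0) + - 1 * sigm (1 * x + 0)"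
  have d: "(decay_weight has_real_derivative decay_weight x * ?d x) (at x)" for x
  proof -
    have "((\<lambda>x. sigm (- x)) has_real_derivative - (sigm (- x) * (1 - sigm (- x)))) (at x)"
    proof -
      have "((\<lambda>x::real. - x) has_real_derivative - 1) (at x)"
        by (auto intro!: derivative_eq_intros)
      from DERIV_chain2[OF sigm_derivative this] show ?thesis by simp
    qed
    from DERIV_mult[OF sigm_derivative this] show ?thesis
      by (simp add: decay_weight_def[abs_def] algebra_simps)
  qed
  show thesis
  proof (rule that)
    show "test_1d (\<lambda>x. decay_weight x * (?d x * q x + q' x))"
      unfolding test_1d_def
      by (intro exI[of _ "\<lambda>x. ?d x * q x + q' x"] conjI sigm_poly.intros q q' refl)
    show "(p has_real_derivative decay_weight x * (?d x * q x + q' x)) (at x)" for x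
      using DERIV_mult[OF d q'(2), of x] unfolding q(2) by (simp add: algebra_simps)
  qed
qed

lemma test_1d_decay:
  assumes "test_1d p"
  obtains C where "0 \<le> C" "\<And>x. (1 + \<bar>x\<bar>) ^ N * \<bar>p x\<bar> \<le> C"
proof -
  obtain q where q: "sigm_poly q" "p = (\<lambda>x. decay_weight x * q x)"
    using assms by (auto simp: test_1d_def)
  obtain B where B: "0 \<le> B" "\<And>x. \<bar>q x\<bar> \<le> B"
    using sigm_poly_bounded[OF q(1)] by blast
  have "(1 + \<bar>x\<bar>) ^ N * \<bar>p x\<bar> \<le> real N ^ N * B" for x
    using mult_mono[OF decay_weight_decay[of x N] B(2)[of x]] decay_weight_pos[of x]
    by (simp add: q(2) abs_mult mult.assoc)
  then show thesis using that[of "real N ^ N * B"] B(1) by simp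
qed

definition tensor :: "('a::euclidean_space \<Rightarrow> real \<Rightarrow> real) \<Rightarrow> 'a \<Rightarrow> complex" where
  "tensor p x = of_real (\<Prod>e\<in>Basis. p e (x \<bullet> e))"

text \<open>Splits a power of \<open>1 + norm x\<close> into one factor for each coordinate.\<close>

lemma one_plus_sum_le_prod:
  fixes a :: "'i \<Rightarrow> real"
  assumes "finite A" "\<And>i. i \<in> A \<Longrightarrow> 0 \<le> a i"
  shows "1 + sum a A \<le> (\<Prod>i\<in>A. 1 + a i)"
  using assms
proof (induction A)
  case (insert i A)
  have "1 + sum a (insert i A) \<le> (1 + a i) * (1 + sum a A)"
    using insert by (simp add: algebra_simps sum_nonneg)
  also have "\<dots> \<le> (1 + a i) * (\<Prod>i\<in>A. 1 + a i)"
    using insert by (intro mult_left_mono) auto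
  finally show ?case using insert by simp
qed simp

text \<open>A partial derivative of a tensor product differentiates a single factor, so tensor products of a class
  that is closed under differentiation are again closed under partial derivatives.\<close>

lemma tensor_schwartz:
  fixes p :: "'a::euclidean_space \<Rightarrow> real \<Rightarrow> real"
  assumes "\<And>e. e \<in> Basis \<Longrightarrow> test_1d (p e)"
  shows "tensor p \<in> schwartz"
proof (rule schwartz_coinduct)
  let ?K = "{tensor p | p :: 'a \<Rightarrow> real \<Rightarrow> real. \<forall>e\<in>Basis. test_1d (p e)}"
  show "tensor p \<in> ?K" using assms by blast
  fix g assume "g \<in> ?K"
  then obtain p :: "'a \<Rightarrow> real \<Rightarrow> real" where g: "g = tensor p" and p: "\<And>e. e \<in> Basis \<Longrightarrow> test_1d (p e)"
    by blast
  have "\<exists>q. test_1d q \<and> (\<forall>x. (p e has_real_derivative q x) (at x))" if "e \<in> Basis" for e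
    using test_1d_derivative[OF p[OF that]] by blast
  then obtain p' where p': "\<And>e. e \<in> Basis \<Longrightarrow> test_1d (p' e)"
    "\<And>e x. e \<in> Basis \<Longrightarrow> (p e has_real_derivative p' e x) (at x)" by metis
  have D: "(g has_derivative (\<lambda>y. of_real (\<Sum>e\<in>Basis. p' e (x \<bullet> e) * (y \<bullet> e) * (\<Prod>j\<in>Basis - {e}. p j (x \<bullet> j))))) (at x)" for x
    unfolding g tensor_def[abs_def]
  proof (intro has_derivative_of_real has_derivative_prod)
    fix e :: 'a assume e: "e \<in> Basis"
    have "((\<lambda>x. x \<bullet> e) has_derivative (\<lambda>y. y \<bullet> e)) (at x)"
      by (auto intro!: derivative_eq_intros)
    from has_derivative_compose[OF this p'(2)[OF e, of "x \<bullet> e", unfolded has_field_derivative_def]]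
    show "((\<lambda>x. p e (x \<bullet> e)) has_derivative (\<lambda>y. p' e (x \<bullet> e) * (y \<bullet> e))) (at x)" .
  qed
  show "g differentiable (at x)" for x using D by (auto simp: differentiable_def)
  show "partial e g \<in> ?K" if e: "e \<in> Basis" for e
  proof -
    have "partial e g x = tensor (p(e := p' e)) x" for x
    proof -
      have "partial e g x = of_real (\<Sum>i\<in>Basis. p' i (x \<bullet> i) * (e \<bullet> i) * (\<Prod>j\<in>Basis - {i}. p j (x \<bullet> j)))"
        by (rule partial_eq[OF D])
      also have "(\<Sum>i\<in>Basis. p' i (x \<bullet> i) * (e \<bullet> i) * (\<Prod>j\<in>Basis - {i}. p j (x \<bullet> j)))
          = (\<Sum>i\<in>Basis. if i = e then p' i (x \<bullet> i) * (\<Prod>j\<in>Basis - {i}. p j (x \<bullet> j)) else 0)"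
        using e by (intro sum.cong refl) (auto simp: inner_Basis)
      also have "\<dots> = p' e (x \<bullet> e) * (\<Prod>j\<in>Basis - {e}. p j (x \<bullet> j))"
        using e by simp
      also have "\<dots> = (\<Prod>j\<in>Basis. (p(e := p' e)) j (x \<bullet> j))"
        using prod.remove[OF finite_Basis e, of "\<lambda>j. (p(e := p' e)) j (x \<bullet> j)"]
        by (simp cong: prod.cong_simp)
      finally show ?thesis by (simp add: tensor_def)
    qed
    then have "partial e g = tensor (p(e := p' e))" by blast
    moreover have "\<forall>i\<in>Basis. test_1d ((p(e := p' e)) i)" using p p' e by auto
    ultimately show ?thesis by blast
  qed
  fix k
  have "\<exists>C. 0 \<le> C \<and> (\<forall>x. (1 + \<bar>x\<bar>) ^ k * \<bar>p e x\<bar> \<le> C)" if "e \<in> Basis" for e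
    using test_1d_decay[OF p[OF that]] by metis
  then obtain C where C: "\<And>e x. e \<in> Basis \<Longrightarrow> (1 + \<bar>x\<bar>) ^ k * \<bar>p e x\<bar> \<le> C e" by metis
  have "(1 + norm x) ^ k * cmod (g x) \<le> (\<Prod>e\<in>Basis. C e)" for x
  proof -
    have "1 + norm x \<le> (\<Prod>e\<in>Basis. 1 + \<bar>x \<bullet> e\<bar>)"
      using norm_le_l1[of x] one_plus_sum_le_prod[of Basis "\<lambda>e. \<bar>x \<bullet> e\<bar>"] by simp
    then have "(1 + norm x) ^ k * cmod (g x) \<le> (\<Prod>e\<in>Basis. 1 + \<bar>x \<bullet> e\<bar>) ^ k * cmod (g x)"
      by (intro mult_right_mono power_mono) auto
    also have "\<dots> = (\<Prod>e\<in>Basis. (1 + \<bar>x \<bullet> e\<bar>) ^ k * \<bar>p e (x \<bullet> e)\<bar>)"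
      unfolding g tensor_def norm_of_real by (simp add: abs_prod prod.distrib prod_power_distrib)
    also have "\<dots> \<le> (\<Prod>e\<in>Basis. C e)"
      by (intro prod_mono conjI C) auto
    finally show ?thesis .
  qed
  then show "\<exists>C. \<forall>x. (1 + norm x) ^ k * cmod (g x) \<le> C" by blast
qed

text \<open>The shift by \<open>n\<close> gives the limit zero also at \<open>y = 0\<close>. In this way the indicator of an open box is an
  everywhere limit of tensor products of sigmoids.\<close>

lemma sigm_step_tendsto:
  "(\<lambda>n. sigm ((real n)\<^sup>2 * y - real n)) \<longlonglongrightarrow> (if 0 < y then 1 else 0)"
proof -
  have top: "(sigm \<longlongrightarrow> 1) at_top" unfolding sigm_def[abs_def] by real_asymp
  have bot: "(sigm \<longlongrightarrow> 0) at_bot" unfolding sigm_def[abs_def] by real_asymp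
  consider "0 < y" | "y = 0" | "y < 0" by linarith
  then show ?thesis
  proof cases
    case 1
    then have "filterlim (\<lambda>n. (real n)\<^sup>2 * y - real n) at_top sequentially" by real_asymp
    from filterlim_compose[OF top this] show ?thesis using 1 by simp
  next
    case 2
    have "filterlim (\<lambda>n. - real n) at_bot sequentially" by real_asymp
    from filterlim_compose[OF bot this] show ?thesis using 2 by simp
  next
    case 3
    then have "filterlim (\<lambda>n. (real n)\<^sup>2 * y - real n) at_bot sequentially" by real_asymp
    from filterlim_compose[OF bot this] show ?thesis using 3 by simp
  qed
qed

text \<open>The positive and the negative part of \<open>h\<close> are densities of finite measures that agree on boxes, a
  generator of the Borel sets that is stable under intersections.\<close>

lemma zero_if_box_integrals_zero:
  fixes h :: "'a::euclidean_space \<Rightarrow> real"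
  assumes h: "integrable lborel h" and zero: "\<And>a b. (LINT x|lborel. h x * indicator (box a b) x) = 0"
  shows "AE x in lborel. h x = 0"
proof -
  have [measurable]: "h \<in> borel_measurable borel" using h by auto
  let ?p = "\<lambda>x. ennreal (h x)" and ?m = "\<lambda>x. ennreal (- h x)"
  have fin: "(\<integral>\<^sup>+x. ?p x \<partial>lborel) \<noteq> \<infinity>" "(\<integral>\<^sup>+x. ?m x \<partial>lborel) \<noteq> \<infinity>"
    using h by (auto simp: real_integrable_def)
  have eq: "emeasure (density lborel ?p) (box a b) = emeasure (density lborel ?m) (box a b)" for a b
  proof -
    let ?g = "\<lambda>x. h x * indicator (box a b) x"
    have g: "integrable lborel ?g"
      using integrable_mult_indicator[OF _ h, of "box a b"] by (simp add: mult.commute)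
    have e1: "ennreal (?g x) = ?p x * indicator (box a b) x" "ennreal (- ?g x) = ?m x * indicator (box a b) x" for x
      by (auto simp: indicator_def)
    have "enn2real (\<integral>\<^sup>+x. ennreal (?g x) \<partial>lborel) - enn2real (\<integral>\<^sup>+x. ennreal (- ?g x) \<partial>lborel) = 0"
      using real_lebesgue_integral_def[OF g] zero by simp
    moreover have "(\<integral>\<^sup>+x. ennreal (?g x) \<partial>lborel) < \<top>" "(\<integral>\<^sup>+x. ennreal (- ?g x) \<partial>lborel) < \<top>"
      using g by (auto simp: real_integrable_def less_top[symmetric])
    ultimately have "(\<integral>\<^sup>+x. ennreal (?g x) \<partial>lborel) = (\<integral>\<^sup>+x. ennreal (- ?g x) \<partial>lborel)"
      by (metis eq_iff_diff_eq_0 ennreal_enn2real)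
    then show ?thesis unfolding e1 by (simp add: emeasure_density)
  qed
  have "density lborel ?p = density lborel ?m"
  proof (rule measure_eqI_generator_eq)
    let ?E = "range (\<lambda>(a, b). box a b::'a set)"
    show "Int_stable ?E"
      by (auto simp: Int_stable_def box_Int_box)
    show "?E \<subseteq> Pow UNIV" "sets (density lborel ?p) = sigma_sets UNIV ?E"
      "sets (density lborel ?m) = sigma_sets UNIV ?E"
      by (simp_all add: borel_eq_box)
    let ?A = "\<lambda>n::nat. box (- (real n *\<^sub>R One)) (real n *\<^sub>R One) :: 'a set"
    show "range ?A \<subseteq> ?E" "(\<Union>i. ?A i) = UNIV"
      unfolding UN_box_eq_UNIV by auto
    show "emeasure (density lborel ?p) (?A i) \<noteq> \<infinity>" for i
    proof -
      have "emeasure (density lborel ?p) (?A i) \<le> emeasure (density lborel ?p) (space (density lborel ?p))"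
        by (rule emeasure_space)
      also have "\<dots> = (\<integral>\<^sup>+x. ?p x \<partial>lborel)" by (simp add: emeasure_density)
      finally show ?thesis using fin(1) by (auto simp: top_unique)
    qed
    show "emeasure (density lborel ?p) X = emeasure (density lborel ?m) X" if "X \<in> ?E" for X
      using that eq by auto
  qed
  then have "AE x in lborel. ?p x = ?m x"
    by (intro sigma_finite_measure.density_unique[OF sigma_finite_lborel]) auto
  then show ?thesis
  proof eventually_elim
    case (elim x)
    then show ?case by (cases "0 \<le> h x") (auto simp: ennreal_neg ennreal_eq_0_iff)
  qed
qed

text \<open>The test functions are the fixed positive weight \<open>W\<close>, a tensor product of \<^const>\<open>decay_weight\<close>, times
  sigmoid approximations of the indicator of a box. In the limit the integral of \<open>g W\<close> over every box
  vanishes.\<close>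

theorem density_zero_unique:
  fixes g :: "'a::euclidean_space \<Rightarrow> complex"
  assumes [measurable]: "g \<in> borel_measurable borel"
    and int: "\<And>\<phi>. \<phi> \<in> schwartz \<Longrightarrow> integrable lborel (\<lambda>x. g x * \<phi> x)"
    and zero: "\<And>\<phi>. \<phi> \<in> schwartz \<Longrightarrow> (LINT x|lborel. g x * \<phi> x) = 0"
  shows "AE x in lborel. g x = 0"
proof -
  let ?W = "tensor (\<lambda>e. decay_weight) :: 'a \<Rightarrow> complex"
  have w1: "test_1d decay_weight"
    unfolding test_1d_def by (rule exI[of _ "\<lambda>x. 1"]) (auto intro: sigm_poly.intros)
  have W: "?W \<in> schwartz" by (rule tensor_schwartz) (rule w1)
  note [measurable] = schwartz_measurable[OF W]
  have h: "integrable lborel (\<lambda>x. g x * ?W x)" by (rule int[OF W])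
  have box0: "(LINT x|lborel. g x * ?W x * indicator (box a b) x) = 0" for a b
  proof (rule LIMSEQ_unique)
    let ?p = "\<lambda>n e x. decay_weight x * (sigm ((real n)\<^sup>2 * x + (- (real n)\<^sup>2 * (a \<bullet> e) - real n))
        * sigm (- (real n)\<^sup>2 * x + ((real n)\<^sup>2 * (b \<bullet> e) - real n)))"
    have p: "tensor (?p n) \<in> schwartz" for n
    proof (rule tensor_schwartz)
      fix e :: 'a
      show "test_1d (?p n e)"
        unfolding test_1d_def
        by (intro exI[of _ "\<lambda>x. sigm ((real n)\<^sup>2 * x + (- (real n)\<^sup>2 * (a \<bullet> e) - real n))
          * sigm (- (real n)\<^sup>2 * x + ((real n)\<^sup>2 * (b \<bullet> e) - real n))"] conjI sigm_poly.intros refl)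
    qed
    note [measurable] = schwartz_measurable[OF p]
    show "(\<lambda>n. LINT x|lborel. g x * tensor (?p n) x) \<longlonglongrightarrow> 0"
      unfolding zero[OF p] by simp
    show "(\<lambda>n. LINT x|lborel. g x * tensor (?p n) x) \<longlonglongrightarrow> (LINT x|lborel. g x * ?W x * indicator (box a b) x)"
    proof (rule integral_dominated_convergence)
      show "integrable lborel (\<lambda>x. cmod (g x * ?W x))" using h by (rule integrable_norm)
      show "AE x in lborel. cmod (g x * tensor (?p n) x) \<le> cmod (g x * ?W x)" for n
      proof (intro AE_I2)
        fix x
        have "(\<Prod>e\<in>Basis. \<bar>?p n e (x \<bullet> e)\<bar>) \<le> (\<Prod>e\<in>Basis. \<bar>decay_weight (x \<bullet> e)\<bar>)"
        proof (intro prod_mono conjI)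
          fix e :: 'a
          have "sigm r * sigm s \<le> 1" for r s
            using mult_mono[OF sigm_le_1[of r] sigm_le_1[of s]] by (simp add: less_imp_le[OF sigm_pos])
          then show "\<bar>?p n e (x \<bullet> e)\<bar> \<le> \<bar>decay_weight (x \<bullet> e)\<bar>"
            unfolding abs_mult abs_of_pos[OF sigm_pos] abs_of_pos[OF decay_weight_pos]
            by (intro mult_left_le) (auto simp: less_imp_le[OF decay_weight_pos])
        qed auto
        then show "cmod (g x * tensor (?p n) x) \<le> cmod (g x * ?W x)"
          unfolding norm_mult tensor_def norm_of_real abs_prod by (intro mult_left_mono) auto
      qed
      show "AE x in lborel. (\<lambda>n. g x * tensor (?p n) x) \<longlonglongrightarrow> g x * ?W x * indicator (box a b) x"
      proof (intro AE_I2)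
        fix x
        let ?l = "\<lambda>e. decay_weight (x \<bullet> e) * ((if 0 < x \<bullet> e - a \<bullet> e then 1 else 0) * (if 0 < b \<bullet> e - x \<bullet> e then 1 else 0))"
        have "(\<lambda>n. ?p n e (x \<bullet> e)) \<longlonglongrightarrow> ?l e" for e
        proof (intro tendsto_mult tendsto_const)
          show "(\<lambda>n. sigm ((real n)\<^sup>2 * (x \<bullet> e) + (- (real n)\<^sup>2 * (a \<bullet> e) - real n))) \<longlonglongrightarrow> (if 0 < x \<bullet> e - a \<bullet> e then 1 else 0)"
            using sigm_step_tendsto[of "x \<bullet> e - a \<bullet> e"] by (simp add: algebra_simps)
          show "(\<lambda>n. sigm (- (real n)\<^sup>2 * (x \<bullet> e) + ((real n)\<^sup>2 * (b \<bullet> e) - real n))) \<longlonglongrightarrow> (if 0 < b \<bullet> e - x \<bullet> e then 1 else 0)"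
            using sigm_step_tendsto[of "b \<bullet> e - x \<bullet> e"] by (simp add: algebra_simps)
        qed
        then have "(\<lambda>n. g x * tensor (?p n) x) \<longlonglongrightarrow> g x * of_real (\<Prod>e\<in>Basis. ?l e)"
          unfolding tensor_def by (rule tendsto_mult[OF tendsto_const tendsto_of_real[OF tendsto_prod]])
        moreover have "(\<Prod>e\<in>Basis. ?l e) = (\<Prod>e\<in>Basis. decay_weight (x \<bullet> e)) * indicator (box a b) x"
        proof (cases "x \<in> box a b")
          case True
          then show ?thesis by (auto simp: mem_box intro!: prod.cong)
        next
          case False
          then obtain e where e: "e \<in> Basis" "?l e = 0" by (auto simp: mem_box not_less)
          have "(\<Prod>e\<in>Basis. ?l e) = 0" by (rule prod_zero[OF finite_Basis], rule bexI[of _ e]) (rule e)+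
          then show ?thesis using False by simp
        qed
        moreover have "g x * of_real ((\<Prod>e\<in>Basis. decay_weight (x \<bullet> e)) * indicator (box a b) x)
            = g x * ?W x * indicator (box a b) x"
          unfolding tensor_def by (simp add: mult.assoc of_real_indicator del: of_real_prod)
        ultimately show "(\<lambda>n. g x * tensor (?p n) x) \<longlonglongrightarrow> g x * ?W x * indicator (box a b) x"
          by (simp only:)
      qed
    qed measurable
  qed
  have hb: "integrable lborel (\<lambda>x. g x * ?W x * indicator (box a b) x)" for a b
    using integrable_mult_indicator[OF _ h, of "box a b"] by (simp add: scaleR_conv_of_real mult.commute of_real_indicator)
  have "AE x in lborel. Re (g x * ?W x) = 0"
  proof (rule zero_if_box_integrals_zero)
    show "(LINT x|lborel. Re (g x * ?W x) * indicator (box a b) x) = 0" for a b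
    proof -
      have "(LINT x|lborel. Re (g x * ?W x) * indicator (box a b) x) = (LINT x|lborel. Re (g x * ?W x * indicator (box a b) x))"
        by (intro Bochner_Integration.integral_cong refl) (simp add: indicator_def)
      then show ?thesis using integral_Re[OF hb[of a b]] box0[of a b] by simp
    qed
  qed (use h in \<open>rule integrable_Re\<close>)
  moreover have "AE x in lborel. Im (g x * ?W x) = 0"
  proof (rule zero_if_box_integrals_zero)
    show "(LINT x|lborel. Im (g x * ?W x) * indicator (box a b) x) = 0" for a b
    proof -
      have "(LINT x|lborel. Im (g x * ?W x) * indicator (box a b) x) = (LINT x|lborel. Im (g x * ?W x * indicator (box a b) x))"
        by (intro Bochner_Integration.integral_cong refl) (simp add: indicator_def)
      then show ?thesis using integral_Im[OF hb[of a b]] box0[of a b] by simp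
    qed
  qed (use h in \<open>rule integrable_Im\<close>)
  ultimately show ?thesis
  proof eventually_elim
    case (elim x)
    then have "g x * ?W x = 0" by (simp add: complex_eq_iff)
    moreover have "?W x \<noteq> 0"
      by (simp add: tensor_def prod_zero_iff decay_weight_pos[THEN less_imp_neq, symmetric] del: of_real_prod)
    ultimately show ?case by simp
  qed
qed

section \<open>Periodic coefficients of the Lyapunov functional\<close>

lemma continuous_antiderivative:
  fixes f :: "real \<Rightarrow> real"
  assumes "continuous_on UNIV f"
  obtains F where "\<And>x. (F has_real_derivative f x) (at x)" "F 0 = 0"
proof -
  have "\<exists>F. \<forall>x. - \<infinity> < ereal x \<longrightarrow> ereal x < \<infinity> \<longrightarrow> (F has_vector_derivative f x) (at x)"
    by (rule einterval_antiderivative) (use assms in \<open>auto simp: continuous_on_eq_continuous_at\<close>)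
  then obtain F where F: "\<And>x. (F has_real_derivative f x) (at x)"
    by (auto simp: has_real_derivative_iff_has_vector_derivative)
  show thesis
  proof (rule that)
    show "((\<lambda>x. F x - F 0) has_real_derivative f x) (at x)" for x
      using DERIV_diff[OF F[of x] DERIV_const[of "F 0"]] by simp
  qed simp
qed

lemma periodic_int:
  fixes f :: "real \<Rightarrow> 'b"
  assumes "\<And>t. f (t + T) = f t"
  shows "f (t + of_int n * T) = f t"
proof (induction n rule: int_induct[where k=0])
  case (step1 i)
  then show ?case using assms[of "t + of_int i * T"] by (simp add: algebra_simps)
next
  case (step2 i)
  then show ?case using assms[of "t + of_int (i - 1) * T"] by (simp add: algebra_simps)
qed simp

lemma periodic_reduce:
  fixes f :: "real \<Rightarrow> 'b"
  assumes T: "T > 0" and per: "\<And>t. f (t + T) = f t"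
  obtains s where "s \<in> {0..T}" "f t = f s"
proof
  let ?n = "\<lfloor>t / T\<rfloor>"
  have "of_int ?n \<le> t / T" "t / T \<le> of_int ?n + 1" by linarith+
  then have "of_int ?n * T \<le> t" "t \<le> (of_int ?n + 1) * T"
    using T by (simp_all only: pos_le_divide_eq pos_divide_le_eq)
  then show "t + of_int (- ?n) * T \<in> {0..T}" by (simp add: algebra_simps)
  show "f t = f (t + of_int (- ?n) * T)" using periodic_int[of f T t "- ?n", OF per] by simp
qed

lemma periodic_bounds:
  fixes f :: "real \<Rightarrow> real"
  assumes T: "T > 0" and per: "\<And>t. f (t + T) = f t" and cont: "continuous_on UNIV f"
  obtains a b where "a \<in> {0..T}" "b \<in> {0..T}" "\<And>t. f a \<le> f t" "\<And>t. f t \<le> f b"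
proof -
  have c: "continuous_on {0..T} f" using cont continuous_on_subset by blast
  obtain a where a: "a \<in> {0..T}" "\<And>t. t \<in> {0..T} \<Longrightarrow> f a \<le> f t"
    using continuous_attains_inf[OF compact_Icc _ c] T by auto
  obtain b where b: "b \<in> {0..T}" "\<And>t. t \<in> {0..T} \<Longrightarrow> f t \<le> f b"
    using continuous_attains_sup[OF compact_Icc _ c] T by auto
  show thesis
  proof (rule that[OF a(1) b(1)])
    fix t
    obtain s where "s \<in> {0..T}" "f t = f s" by (rule periodic_reduce[where f=f, OF T per])
    then show "f a \<le> f t" "f t \<le> f b" using a b by auto
  qed
qed

text \<open>Both sides have the same derivative in \<open>t\<close> and agree at \<open>t = 0\<close>. The factor \<open>c\<close> is needed for
  \<open>exp (- B)\<close>, where \<open>B\<close> grows by a constant in each period.\<close>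

lemma antiderivative_shift:
  fixes F f :: "real \<Rightarrow> real"
  assumes F: "\<And>x. (F has_real_derivative f x) (at x)" and per: "\<And>t. f (t + T) = c * f t"
    and F0: "F 0 = 0"
  shows "F (t + T) = c * F t + F T"
proof -
  have "((\<lambda>t. F (t + T) - c * F t) has_real_derivative 0) (at t)" for t
  proof -
    have "((\<lambda>t. F (t + T)) has_real_derivative f (t + T)) (at t)"
      by (subst DERIV_shift[symmetric]) (rule F)
    from DERIV_diff[OF this DERIV_cmult[OF F[of t], of c]] show ?thesis by (simp add: per)
  qed
  then have "F (t + T) - c * F t = F (0 + T) - c * F 0"
    using DERIV_isconst_all[of "\<lambda>t. F (t + T) - c * F t"] by blast
  then show ?thesis by (simp add: F0)
qed

lemma nonneg_if_AE_pos:
  fixes c :: "real \<Rightarrow> real"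
  assumes cont: "continuous_on UNIV c" and pos: "AE t in lborel. c t > 0"
  shows "0 \<le> c t"
proof (rule ccontr)
  assume "\<not> 0 \<le> c t"
  then have t: "t \<in> c -` {..<0}" by simp
  have op: "open (c -` {..<0})" by (rule open_vimage[OF open_lessThan cont])
  have "AE t in lborel. t \<notin> c -` {..<0}" using pos by eventually_elim auto
  then have "c -` {..<0} \<in> null_sets lborel"
    using op by (subst (asm) AE_iff_null_sets[symmetric]) auto
  then show False
    using open_not_negligible[OF op] t null_sets_completionI[of _ lborel]
    unfolding negligible_iff_null_sets by blast
qed

text \<open>Variation of constants: with antiderivatives \<open>B\<close> of \<open>c\<close> and \<open>E\<close> of \<open>exp (- B)\<close> the solutions are
  \<open>exp B * (k - E)\<close>. Periodicity determines \<open>k\<close>. Since \<open>B\<close> increases over a period, \<open>k > E T\<close>, and the solution is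
  positive. It is unstable forward in time and bounded only because of this choice.\<close>

lemma periodic_backward_solution:
  fixes c :: "real \<Rightarrow> real"
  assumes T: "T > 0" and per: "\<And>t. c (t + T) = c t" and cont: "continuous_on UNIV c"
    and pos: "AE t in lborel. c t > 0"
  obtains g m M where "\<And>t. (g has_real_derivative c t * g t - 1) (at t)" "\<And>t. g (t + T) = g t"
    "0 < m" "\<And>t. m \<le> g t" "\<And>t. g t \<le> M"
proof -
  have c0: "0 \<le> c t" for t by (rule nonneg_if_AE_pos[OF cont pos])
  obtain B where B: "\<And>x. (B has_real_derivative c x) (at x)" "B 0 = 0"
    using continuous_antiderivative[OF cont] by blast
  have Bshift: "B (t + T) = B t + B T" for t
    using antiderivative_shift[OF B(1), of T 1 t] B(2) per by simp
  have Bmono: "B s \<le> B t" if "s \<le> t" for s t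
    by (rule DERIV_nonneg_imp_nondecreasing[OF that]) (use B(1) c0 in blast)
  have BT: "0 < B T"
  proof (rule ccontr)
    assume "\<not> 0 < B T"
    then have "B T \<le> 0" by simp
    have B0: "B t = 0" if "t \<in> {0..T}" for t
      using Bmono[of 0 t] Bmono[of t T] that \<open>B T \<le> 0\<close> B(2) by auto
    have c00: "c t = 0" if t: "t \<in> {0<..<T}" for t
    proof -
      have "\<forall>\<^sub>F x in nhds t. x \<in> {0<..<T}" using t by (intro eventually_nhds_in_open) auto
      then have "\<forall>\<^sub>F x in nhds t. B x = 0" by eventually_elim (auto intro: B0)
      then have "(B has_real_derivative 0) (at t)"
        by (subst DERIV_cong_ev[OF refl _ refl, where g="\<lambda>x. 0"]) auto
      then show ?thesis using B(1)[of t] DERIV_unique by blast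
    qed
    have "AE t in lborel. t \<notin> {0<..<T}" using pos
    proof eventually_elim
      case (elim t)
      then show ?case using c00[of t] by auto
    qed
    then have "{0<..<T} \<in> null_sets lborel" by (subst (asm) AE_iff_null_sets[symmetric]) auto
    then show False using T by (auto simp: null_sets_def)
  qed
  have contB: "continuous_on UNIV B"
    by (intro continuous_at_imp_continuous_on ballI DERIV_isCont[OF B(1)])
  obtain E where E: "\<And>x. (E has_real_derivative exp (- B x)) (at x)" "E 0 = 0"
  proof -
    have "continuous_on UNIV (\<lambda>x. exp (- B x))" by (intro continuous_intros contB)
    from continuous_antiderivative[OF this] that show thesis by blast
  qed
  have Eshift: "E (t + T) = exp (- B T) * E t + E T" for t
    by (rule antiderivative_shift[OF E(1) _ E(2)]) (simp add: Bshift exp_add[symmetric])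
  have Emono: "E s < E t" if "s < t" for s t
    by (rule DERIV_pos_imp_increasing[OF that]) (rule exI, rule conjI, rule E(1), simp)
  define k where "k = exp (B T) * E T / (exp (B T) - 1)"
  have eB: "1 < exp (B T)" using BT by simp
  have ET: "0 < E T" using Emono[of 0 T] T E(2) by simp
  have kE: "E T < k" unfolding k_def using eB ET by (subst pos_less_divide_eq) (auto simp: right_diff_distrib mult.commute)
  have "e * (e * x / (e - 1) - x) = e * x / (e - 1)" if "1 < e" for e x :: real
    using that by (simp add: field_simps)
  from this[OF eB] have k: "exp (B T) * (k - E T) = k" unfolding k_def .
  define g where "g t = exp (B t) * (k - E t)" for t
  have dg: "(g has_real_derivative c t * g t - 1) (at t)" for t
  proof -
    have "(g has_real_derivative exp (B t) * c t * (k - E t) + exp (B t) * (- exp (- B t))) (at t)"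
      using DERIV_mult[OF DERIV_fun_exp[OF B(1)[of t]] DERIV_diff[OF DERIV_const[of k] E(1)[of t]]]
      by (simp add: g_def[abs_def] mult.commute)
    then show ?thesis by (simp add: g_def exp_minus mult_ac)
  qed
  have gper: "g (t + T) = g t" for t
  proof -
    have "g (t + T) = exp (B t) * (exp (B T) * (k - E T) - exp (B T) * exp (- B T) * E t)"
      unfolding g_def Bshift Eshift exp_add by (simp add: algebra_simps)
    also have "\<dots> = g t" unfolding k g_def by (simp add: exp_minus)
    finally show ?thesis .
  qed
  have contg: "continuous_on UNIV g"
    by (intro continuous_at_imp_continuous_on ballI DERIV_isCont[OF dg])
  obtain a d where ad: "a \<in> {0..T}" "d \<in> {0..T}" "\<And>t. g a \<le> g t" "\<And>t. g t \<le> g d"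
    by (rule periodic_bounds[where f=g, OF T gper contg]) (rule that)
  have "E a \<le> E T" using Emono[of a T] ad(1) by (cases "a = T") auto
  then have "0 < g a" unfolding g_def using kE by simp
  then show thesis by (intro that[OF dg gper _ ad(3,4)])
qed

text \<open>Let \<open>f\<^sub>n = min (2 g) (4 b n - 2 g)\<close>. Where \<open>b > 0\<close>, hence almost everywhere, \<open>f\<^sub>n\<close> tends to \<open>2 g\<close>, so the mean \<open>\<mu>\<close>
  of \<open>f\<^sub>n\<close> over a period is positive for some \<open>n\<close>. A periodic antiderivative of \<open>f\<^sub>n - \<mu>\<close>, raised above the level
  \<open>n\<close>, satisfies both inequalities: the second because \<open>4 b al \<ge> 4 b n\<close>.\<close>

lemma periodic_weight:
  fixes b g :: "real \<Rightarrow> real"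
  assumes T: "T > 0" and per: "\<And>t. b (t + T) = b t" and cont: "continuous_on UNIV b"
    and pos: "AE t in lborel. b t > 0"
    and gcont: "continuous_on UNIV g" and gper: "\<And>t. g (t + T) = g t"
    and g: "0 < m" "\<And>t. m \<le> g t" "\<And>t. g t \<le> M"
  obtains \<mu> al al' K where "\<mu> > 0" "\<And>t. (al has_real_derivative al' t) (at t)"
    "\<And>t. al' t \<le> 2 * g t - \<mu>" "\<And>t. al' t - 4 * b t * al t + 2 * g t \<le> - \<mu>"
    "\<And>t. L \<le> al t" "\<And>t. al t \<le> K"
proof -
  have b0: "0 \<le> b t" for t by (rule nonneg_if_AE_pos[OF cont pos])
  have g0: "0 < g t" for t using g(1) g(2)[of t] by linarith
  note [measurable] = borel_measurable_continuous_onI[OF cont] borel_measurable_continuous_onI[OF gcont]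
  define f where "f n t = min (2 * g t) (4 * b t * real n - 2 * g t)" for n :: nat and t
  have fcont: "continuous_on UNIV (f n)" for n
    unfolding f_def[abs_def] by (intro continuous_intros cont gcont)
  have fper: "f n (t + T) = f n t" for n t by (simp add: f_def per gper)
  have fle: "\<bar>f n t\<bar> \<le> 2 * M" for n t
  proof -
    have "0 \<le> 4 * b t * real n" using b0[of t] by simp
    then have "- (2 * g t) \<le> f n t" unfolding f_def using g0[of t] by (intro min.boundedI) linarith+
    moreover have "f n t \<le> 2 * g t" by (simp add: f_def)
    ultimately show ?thesis using g(3)[of t] by linarith
  qed
  have "(\<lambda>n. LINT t|lborel. f n t * indicator {0..T} t) \<longlonglongrightarrow> (LINT t|lborel. 2 * g t * indicator {0..T} t)"
  proof (rule integral_dominated_convergence)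
    show "integrable lborel (\<lambda>t. 2 * M * indicator {0..T} t)"
      by (intro integrable_mult_right integrable_real_indicator) (auto simp: T less_imp_le)
    show "AE t in lborel. norm (f n t * indicator {0..T} t) \<le> 2 * M * indicator {0..T} t" for n
      using fle by (intro AE_I2) (auto simp: indicator_def)
    show "AE t in lborel. (\<lambda>n. f n t * indicator {0..T} t) \<longlonglongrightarrow> 2 * g t * indicator {0..T} t"
      using pos
    proof eventually_elim
      case (elim t)
      have "filterlim (\<lambda>n. 4 * b t * real n) at_top sequentially" using elim by real_asymp
      then have "\<forall>\<^sub>F n in sequentially. 4 * g t \<le> 4 * b t * real n"
        unfolding filterlim_at_top by blast
      then have "\<forall>\<^sub>F n in sequentially. f n t * indicator {0..T} t = 2 * g t * indicator {0..T} t"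
        by eventually_elim (simp add: f_def)
      then show ?case by (rule tendsto_eventually)
    qed
  qed (auto simp: f_def[abs_def])
  moreover have "0 < (LINT t|lborel. 2 * g t * indicator {0..T} t)"
  proof -
    have "(LINT t|lborel. 2 * m * indicator {0..T} t) \<le> (LINT t|lborel. 2 * g t * indicator {0..T} t)"
    proof (rule Bochner_Integration.integral_mono)
      show "integrable lborel (\<lambda>t. 2 * m * indicator {0..T} t)"
        by (intro integrable_mult_right integrable_real_indicator) (auto simp: T less_imp_le)
      show "integrable lborel (\<lambda>t. 2 * g t * indicator {0..T} t)"
      proof (rule Bochner_Integration.integrable_bound)
        show "integrable lborel (\<lambda>t. 2 * M * indicator {0..T} t)"
          by (intro integrable_mult_right integrable_real_indicator) (auto simp: T less_imp_le)
        have "\<bar>g t\<bar> \<le> \<bar>M\<bar>" for t using g0[of t] g(3)[of t] by linarith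
        then show "AE t in lborel. norm (2 * g t * indicator {0..T} t) \<le> norm (2 * M * indicator {0..T} t)"
          by (intro AE_I2) (auto simp: indicator_def abs_mult)
      qed measurable
      show "2 * m * indicator {0..T} t \<le> 2 * g t * indicator {0..T} t" for t
        using g(2) by (auto simp: indicator_def)
    qed
    moreover have "0 < (LINT t|lborel. 2 * m * indicator {0..T} t)" using T g(1) by simp
    ultimately show ?thesis by linarith
  qed
  ultimately have "\<forall>\<^sub>F n in sequentially. 0 < (LINT t|lborel. f n t * indicator {0..T} t)"
    by (rule order_tendstoD(1))
  moreover have "\<forall>\<^sub>F n in sequentially. L \<le> real n"
    using filterlim_real_sequentially by (simp add: filterlim_at_top)
  ultimately have "\<exists>n. 0 < (LINT t|lborel. f n t * indicator {0..T} t) \<and> L \<le> real n"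
    by (intro eventually_happens'[OF trivial_limit_sequentially] eventually_conj)
  then obtain n where n: "0 < (LINT t|lborel. f n t * indicator {0..T} t)" "L \<le> real n" by blast
  obtain F where F: "\<And>x. (F has_real_derivative f n x) (at x)" "F 0 = 0"
    using continuous_antiderivative[OF fcont] by blast
  have "(LINT t|lborel. f n t * indicator {0..T} t) = F T - F 0"
    using T F(1) fcont[of n] by (intro integral_FTC_Icc_real) (auto simp: continuous_on_eq_continuous_at)
  then have FT: "0 < F T" using n F(2) by simp
  define \<mu> where "\<mu> = F T / T"
  have \<mu>: "0 < \<mu>" using FT T by (simp add: \<mu>_def)
  define H where "H t = F t - \<mu> * t" for t
  have H: "(H has_real_derivative f n t - \<mu>) (at t)" for t
    unfolding H_def[abs_def] using DERIV_diff[OF F(1)[of t] DERIV_cmult[OF DERIV_ident, of \<mu>]] by simp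
  have "H (t + T) = 1 * H t + H T" for t
    by (rule antiderivative_shift[OF H]) (auto simp: fper H_def F)
  then have Hper: "H (t + T) = H t" for t using T by (simp add: H_def \<mu>_def)
  have contH: "continuous_on UNIV H"
    by (intro continuous_at_imp_continuous_on ballI DERIV_isCont[OF H])
  obtain x y where "x \<in> {0..T}" "y \<in> {0..T}" and xy: "\<And>t. H x \<le> H t" "\<And>t. H t \<le> H y"
    by (rule periodic_bounds[where f=H, OF T Hper contH]) (rule that)
  define al where "al t = real n - H x + H t" for t
  have aln: "real n \<le> al t" for t using xy(1)[of t] by (simp add: al_def)
  show thesis
  proof (rule that[OF \<mu>])
    show "(al has_real_derivative f n t - \<mu>) (at t)" for t
      unfolding al_def[abs_def] using DERIV_add[OF DERIV_const[of "real n - H x"] H[of t]] by simp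
    show "f n t - \<mu> \<le> 2 * g t - \<mu>" for t by (simp add: f_def)
    show "f n t - \<mu> - 4 * b t * al t + 2 * g t \<le> - \<mu>" for t
    proof -
      have "4 * b t * real n \<le> 4 * b t * al t" using aln b0 by (intro mult_left_mono) auto
      moreover have "f n t \<le> 4 * b t * real n - 2 * g t" by (simp add: f_def)
      ultimately show ?thesis by linarith
    qed
    show "L \<le> al t" for t using aln n(2) order_trans by blast
    show "al t \<le> real n - H x + H y" for t using xy(2)[of t] by (simp add: al_def)
  qed
qed

section \<open>Weighted quadratic forms and their time derivatives\<close>

lemma L2_fun_norm_cmult: "L2_fun_norm (\<lambda>x. c * f x) = cmod c * L2_fun_norm f"
proof -
  have "(\<lambda>x. (cmod (c * f x))\<^sup>2) = (\<lambda>x. (cmod c)\<^sup>2 * (cmod (f x))\<^sup>2)"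
    by (simp add: norm_mult power_mult_distrib)
  then show ?thesis unfolding L2_fun_norm_def by (simp add: real_sqrt_mult)
qed

lemma L2_fun_norm_mono:
  assumes "f \<in> borel_measurable borel" "g \<in> L2_fun" "\<And>x. cmod (f x) \<le> cmod (g x)"
  shows "f \<in> L2_fun" "L2_fun_norm f \<le> L2_fun_norm g"
proof -
  have "nn2 f \<le> nn2 g" by (intro nn_integral_mono ennreal_leI power_mono assms) auto
  from L2_fun_norm_le[OF assms(1) this assms(2)] show "f \<in> L2_fun" "L2_fun_norm f \<le> L2_fun_norm g" .
qed

definition pairing :: "('a::euclidean_space \<Rightarrow> real) \<Rightarrow> ('a \<Rightarrow> complex) \<Rightarrow> ('a \<Rightarrow> complex) \<Rightarrow> real" where
  "pairing m f g = (LINT x|lborel. m x * Re (f x * cnj (g x)))"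

lemma pairing_integrable:
  assumes [measurable]: "m \<in> borel_measurable borel" and m: "\<And>x. \<bar>m x\<bar> \<le> c"
    and f: "f \<in> L2_fun" and g: "g \<in> L2_fun"
  shows "integrable lborel (\<lambda>x. m x * Re (f x * cnj (g x)))"
    and "integrable lborel (\<lambda>x. m x * (cmod (f x) * cmod (g x)))"
proof -
  note [measurable] = L2_fun_measurable[OF f] L2_fun_measurable[OF g]
  have i: "integrable lborel (\<lambda>x. c * cmod (f x * g x))"
    by (intro integrable_mult_right integrable_norm L2_fun_mult_integrable f g)
  have 1: "\<bar>m x\<bar> * (cmod (f x) * cmod (g x)) \<le> c * cmod (f x * g x)" for x
    using m[of x] by (simp add: norm_mult mult_right_mono)
  have c: "0 \<le> c" using m[of undefined] by (rule order_trans[OF abs_ge_zero])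
  show "integrable lborel (\<lambda>x. m x * (cmod (f x) * cmod (g x)))"
  proof (rule Bochner_Integration.integrable_bound[OF i])
    show "AE x in lborel. norm (m x * (cmod (f x) * cmod (g x))) \<le> norm (c * cmod (f x * g x))"
      using 1 c by (intro AE_I2) (simp add: abs_mult)
  qed measurable
  show "integrable lborel (\<lambda>x. m x * Re (f x * cnj (g x)))"
  proof (rule Bochner_Integration.integrable_bound[OF i])
    have "\<bar>m x\<bar> * \<bar>Re (f x * cnj (g x))\<bar> \<le> \<bar>m x\<bar> * (cmod (f x) * cmod (g x))" for x
      using abs_Re_le_cmod[of "f x * cnj (g x)"] by (intro mult_left_mono) (auto simp: norm_mult)
    then show "AE x in lborel. norm (m x * Re (f x * cnj (g x))) \<le> norm (c * cmod (f x * g x))"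
      using order_trans[OF _ 1] c by (intro AE_I2) (simp add: abs_mult)
  qed measurable
qed

lemma pairing_commute: "pairing m f g = pairing m g f"
  unfolding pairing_def by (intro Bochner_Integration.integral_cong refl) simp

lemma pairing_lincomb:
  assumes "m \<in> borel_measurable borel" "\<And>x. \<bar>m x\<bar> \<le> c" "f \<in> L2_fun" "f' \<in> L2_fun" "g \<in> L2_fun"
  shows "pairing m (\<lambda>x. f x + of_real a * f' x) g = pairing m f g + a * pairing m f' g"
proof -
  have "pairing m (\<lambda>x. f x + of_real a * f' x) g
      = (LINT x|lborel. m x * Re (f x * cnj (g x)) + a * (m x * Re (f' x * cnj (g x))))"
    unfolding pairing_def by (intro Bochner_Integration.integral_cong refl) (simp add: algebra_simps)
  also have "\<dots> = pairing m f g + a * pairing m f' g"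
    unfolding pairing_def
    by (subst Bochner_Integration.integral_add)
      (intro integrable_mult_right pairing_integrable(1)[OF assms(1,2)] assms | simp only: integral_mult_right_zero)+
  finally show ?thesis .
qed

text \<open>The best choice is \<open>l = y / x\<close>. If a factor vanishes, \<open>l\<close> tends to infinity or to zero instead.\<close>

lemma le_product_if_young:
  fixes a x y :: real
  assumes "0 \<le> x" "0 \<le> y" "\<And>l. l > 0 \<Longrightarrow> a \<le> l / 2 * x\<^sup>2 + (1 / l) / 2 * y\<^sup>2"
  shows "a \<le> x * y"
proof (cases "x = 0 \<or> y = 0")
  case False
  then have "0 < x" "0 < y" using assms by auto
  then have "a \<le> (y / x) / 2 * x\<^sup>2 + (1 / (y / x)) / 2 * y\<^sup>2" by (intro assms(3)) simp
  also have "\<dots> = x * y" using \<open>0 < x\<close> \<open>0 < y\<close> by (simp add: field_simps power2_eq_square)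
  finally show ?thesis .
next
  case True
  have "a \<le> 0"
  proof (rule field_le_epsilon)
    fix e :: real assume e: "0 < e"
    from True show "a \<le> 0 + e"
    proof
      assume "x = 0"
      have "a \<le> (1 / (y\<^sup>2 / e + 1)) / 2 * y\<^sup>2"
        using assms(3)[of "y\<^sup>2 / e + 1"] e \<open>x = 0\<close> by (simp add: add_nonneg_pos)
      also have "\<dots> = (y\<^sup>2 / (y\<^sup>2 / e + 1)) / 2" by simp
      also have "y\<^sup>2 / (y\<^sup>2 / e + 1) \<le> e"
        using e by (subst pos_divide_le_eq) (auto simp: add_nonneg_pos distrib_left)
      finally show ?thesis using e by simp
    next
      assume "y = 0"
      have "a \<le> (1 / (x\<^sup>2 / e + 1)) / 2 * x\<^sup>2"
        using assms(3)[of "1 / (x\<^sup>2 / e + 1)"] e \<open>y = 0\<close> by (simp add: add_nonneg_pos)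
      also have "\<dots> = (x\<^sup>2 / (x\<^sup>2 / e + 1)) / 2" by simp
      also have "x\<^sup>2 / (x\<^sup>2 / e + 1) \<le> e"
        using e by (subst pos_divide_le_eq) (auto simp: add_nonneg_pos distrib_left)
      finally show ?thesis using e by simp
    qed
  qed
  then show ?thesis using True by auto
qed

lemma Cauchy_Schwarz_L2:
  assumes f: "f \<in> L2_fun" and g: "g \<in> L2_fun"
  shows "(LINT x|lborel. cmod (f x) * cmod (g x)) \<le> L2_fun_norm f * L2_fun_norm g"
proof (rule le_product_if_young)
  fix l :: real assume l: "l > 0"
  have "(LINT x|lborel. cmod (f x) * cmod (g x))
      \<le> (LINT x|lborel. l / 2 * (cmod (f x))\<^sup>2 + (1 / l) / 2 * (cmod (g x))\<^sup>2)"
    using pairing_integrable(2)[of "\<lambda>x. 1" 1, OF _ _ f g]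
    by (intro Bochner_Integration.integral_mono young_weighted l Bochner_Integration.integrable_add
        integrable_mult_right L2_fun_integrable f g) auto
  also have "\<dots> = l / 2 * (L2_fun_norm f)\<^sup>2 + (1 / l) / 2 * (L2_fun_norm g)\<^sup>2"
    unfolding L2_fun_norm_power2
    by (subst Bochner_Integration.integral_add)
      (simp_all only: integral_mult_right_zero integrable_mult_right L2_fun_integrable f g)
  finally show "(LINT x|lborel. cmod (f x) * cmod (g x))
      \<le> l / 2 * (L2_fun_norm f)\<^sup>2 + (1 / l) / 2 * (L2_fun_norm g)\<^sup>2" .
qed auto

lemma pairing_bound:
  assumes m: "m \<in> borel_measurable borel" "\<And>x. \<bar>m x\<bar> \<le> c" and f: "f \<in> L2_fun" and g: "g \<in> L2_fun"
  shows "\<bar>pairing m f g\<bar> \<le> c * (L2_fun_norm f * L2_fun_norm g)"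
proof -
  have c: "0 \<le> c" using m(2)[of undefined] by (rule order_trans[OF abs_ge_zero])
  have "\<bar>pairing m f g\<bar> \<le> (LINT x|lborel. \<bar>m x * Re (f x * cnj (g x))\<bar>)"
    unfolding pairing_def by (rule integral_abs_bound)
  also have "\<dots> \<le> (LINT x|lborel. c * (cmod (f x) * cmod (g x)))"
  proof (rule Bochner_Integration.integral_mono)
    show "integrable lborel (\<lambda>x. \<bar>m x * Re (f x * cnj (g x))\<bar>)"
      by (intro integrable_abs pairing_integrable(1)[OF m f g])
    show "integrable lborel (\<lambda>x. c * (cmod (f x) * cmod (g x)))"
      using pairing_integrable(2)[of "\<lambda>x. c" "\<bar>c\<bar>", OF _ _ f g] by simp
    fix x
    show "\<bar>m x * Re (f x * cnj (g x))\<bar> \<le> c * (cmod (f x) * cmod (g x))"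
      unfolding abs_mult using abs_Re_le_cmod[of "f x * cnj (g x)"] m(2)[of x] c
      by (intro mult_mono) (auto simp: norm_mult)
  qed
  also have "\<dots> \<le> c * (L2_fun_norm f * L2_fun_norm g)"
    using Cauchy_Schwarz_L2[OF f g] c by (simp add: mult_left_mono)
  finally show ?thesis .
qed

text \<open>Differentiability on \<open>[0, \<infinity>)\<close> in the norm of \<open>L\<^sup>2\<close>, one-sided at zero.\<close>

definition L2_derivative :: "(real \<Rightarrow> 'a::euclidean_space \<Rightarrow> complex) \<Rightarrow> (real \<Rightarrow> 'a \<Rightarrow> complex) \<Rightarrow> bool" where
  "L2_derivative A A' \<longleftrightarrow> (\<forall>t\<ge>0. A t \<in> L2_fun \<and> A' t \<in> L2_fun \<and>
     ((\<lambda>\<tau>. L2_fun_norm (\<lambda>x. (A \<tau> x - A t x) / of_real (\<tau> - t) - A' t x)) \<longlongrightarrow> 0) (at t within {0..}))"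

text \<open>The product rule. The errors \<open>qA\<close> and \<open>qB\<close> of the two difference quotients tend to zero in norm, and each
  term of the remainder contains one of them or a factor \<open>\<tau> - t\<close>.\<close>

lemma pairing_has_derivative:
  assumes m: "m \<in> borel_measurable borel" "\<And>x. \<bar>m x\<bar> \<le> c"
    and A: "L2_derivative A A'" and B: "L2_derivative B B'" and t: "0 \<le> t"
  shows "((\<lambda>\<tau>. pairing m (A \<tau>) (B \<tau>)) has_real_derivative
      pairing m (A' t) (B t) + pairing m (A t) (B' t)) (at t within {0..})"
  unfolding has_field_derivative_iff
proof -
  have L: "A \<tau> \<in> L2_fun" "A' \<tau> \<in> L2_fun" "B \<tau> \<in> L2_fun" "B' \<tau> \<in> L2_fun" if "0 \<le> \<tau>" for \<tau>
    using A B that by (auto simp: L2_derivative_def)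
  note Lt = L[OF t]
  define qA where "qA \<tau> x = (A \<tau> x - A t x) / of_real (\<tau> - t) - A' t x" for \<tau> x
  define qB where "qB \<tau> x = (B \<tau> x - B t x) / of_real (\<tau> - t) - B' t x" for \<tau> x
  have qA0: "((\<lambda>\<tau>. L2_fun_norm (qA \<tau>)) \<longlongrightarrow> 0) (at t within {0..})"
    and qB0: "((\<lambda>\<tau>. L2_fun_norm (qB \<tau>)) \<longlongrightarrow> 0) (at t within {0..})"
    using A B t by (auto simp: L2_derivative_def qA_def[abs_def] qB_def[abs_def])
  have qL: "qA \<tau> \<in> L2_fun" "qB \<tau> \<in> L2_fun" if "0 \<le> \<tau>" for \<tau>
  proof -
    have "(\<lambda>x. (1 / of_real (\<tau> - t)) * (A \<tau> x - A t x) - A' t x) \<in> L2_fun"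
      "(\<lambda>x. (1 / of_real (\<tau> - t)) * (B \<tau> x - B t x) - B' t x) \<in> L2_fun"
      by (intro L2_fun_diff L2_fun_cmult L Lt that)+
    then show "qA \<tau> \<in> L2_fun" "qB \<tau> \<in> L2_fun" by (simp_all add: qA_def[abs_def] qB_def[abs_def])
  qed
  have lim0: "((\<lambda>\<tau>. pairing m (F \<tau>) (G \<tau>)) \<longlongrightarrow> 0) (at t within {0..})"
    if F: "\<And>\<tau>. 0 \<le> \<tau> \<Longrightarrow> F \<tau> \<in> L2_fun" and G: "\<And>\<tau>. 0 \<le> \<tau> \<Longrightarrow> G \<tau> \<in> L2_fun"
      and l: "((\<lambda>\<tau>. L2_fun_norm (F \<tau>) * L2_fun_norm (G \<tau>)) \<longlongrightarrow> 0) (at t within {0..})" for F G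
  proof (rule Lim_null_comparison)
    show "\<forall>\<^sub>F \<tau> in at t within {0..}. norm (pairing m (F \<tau>) (G \<tau>)) \<le> c * (L2_fun_norm (F \<tau>) * L2_fun_norm (G \<tau>))"
      unfolding eventually_at_filter real_norm_def
      by (intro always_eventually allI impI pairing_bound m F G) auto
    show "((\<lambda>\<tau>. c * (L2_fun_norm (F \<tau>) * L2_fun_norm (G \<tau>))) \<longlongrightarrow> 0) (at t within {0..})"
      using tendsto_mult_right_zero[OF l] by simp
  qed
  have tt: "((\<lambda>\<tau>. \<tau> - t) \<longlongrightarrow> 0) (at t within {0..})"
    using tendsto_diff[OF tendsto_ident_at tendsto_const, of t t "{0..}"] by simp
  let ?R = "\<lambda>\<tau>. pairing m (qA \<tau>) (B t) + (\<tau> - t) * (pairing m (A' t) (B' t) + pairing m (A' t) (qB \<tau>)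
      + pairing m (qA \<tau>) (B' t) + pairing m (qA \<tau>) (qB \<tau>)) + pairing m (A t) (qB \<tau>)"
  have "(?R \<longlongrightarrow> 0 + 0 * (pairing m (A' t) (B' t) + 0 + 0 + 0) + 0) (at t within {0..})"
  proof (intro tendsto_add tendsto_mult tt tendsto_const lim0)
    show "((\<lambda>\<tau>. L2_fun_norm (qA \<tau>) * L2_fun_norm (B t)) \<longlongrightarrow> 0) (at t within {0..})"
      "((\<lambda>\<tau>. L2_fun_norm (qA \<tau>) * L2_fun_norm (B' t)) \<longlongrightarrow> 0) (at t within {0..})"
      using tendsto_mult_left_zero[OF qA0] by auto
    show "((\<lambda>\<tau>. L2_fun_norm (A' t) * L2_fun_norm (qB \<tau>)) \<longlongrightarrow> 0) (at t within {0..})"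
      "((\<lambda>\<tau>. L2_fun_norm (A t) * L2_fun_norm (qB \<tau>)) \<longlongrightarrow> 0) (at t within {0..})"
      using tendsto_mult_right_zero[OF qB0] by auto
    show "((\<lambda>\<tau>. L2_fun_norm (qA \<tau>) * L2_fun_norm (qB \<tau>)) \<longlongrightarrow> 0) (at t within {0..})"
      using tendsto_mult[OF qA0 qB0] by simp
  qed (use Lt qL in auto)
  then have "((\<lambda>\<tau>. (pairing m (A' t) (B t) + pairing m (A t) (B' t)) + ?R \<tau>) \<longlongrightarrow>
      (pairing m (A' t) (B t) + pairing m (A t) (B' t)) + 0) (at t within {0..})"
    by (intro tendsto_add tendsto_const) simp
  then have lim: "((\<lambda>\<tau>. (pairing m (A' t) (B t) + pairing m (A t) (B' t)) + ?R \<tau>) \<longlongrightarrow>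
      pairing m (A' t) (B t) + pairing m (A t) (B' t)) (at t within {0..})"
    by simp
  have eq: "(pairing m (A \<tau>) (B \<tau>) - pairing m (A t) (B t)) / (\<tau> - t)
     = (pairing m (A' t) (B t) + pairing m (A t) (B' t)) + ?R \<tau>" if \<tau>: "0 \<le> \<tau>" "\<tau> \<noteq> t" for \<tau>
  proof -
    let ?h = "\<tau> - t"
    have h: "?h \<noteq> 0" using \<tau> by simp
    note q = qL[OF \<tau>(1)]
    have dL: "(\<lambda>x. A' t x + of_real 1 * qA \<tau> x) \<in> L2_fun" "(\<lambda>x. B' t x + of_real 1 * qB \<tau> x) \<in> L2_fun"
      by (intro L2_fun_add L2_fun_cmult Lt q)+
    have Aeq: "A \<tau> = (\<lambda>x. A t x + of_real ?h * (A' t x + of_real 1 * qA \<tau> x))"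
      using h by (simp add: qA_def fun_eq_iff del: of_real_diff)
    have Beq: "B \<tau> = (\<lambda>x. B t x + of_real ?h * (B' t x + of_real 1 * qB \<tau> x))"
      using h by (simp add: qB_def fun_eq_iff del: of_real_diff)
    have dA: "pairing m (\<lambda>x. A' t x + of_real 1 * qA \<tau> x) g = pairing m (A' t) g + pairing m (qA \<tau>) g"
      if "g \<in> L2_fun" for g
      using pairing_lincomb[OF m Lt(2) q(1) that, of 1] by simp
    have dB: "pairing m g (\<lambda>x. B' t x + of_real 1 * qB \<tau> x) = pairing m g (B' t) + pairing m g (qB \<tau>)"
      if "g \<in> L2_fun" for g
      using pairing_lincomb[OF m Lt(4) q(2) that, of 1] by (simp add: pairing_commute[of m g])
    have e1: "pairing m (A \<tau>) (B \<tau>) = pairing m (A t) (B \<tau>) + ?h * (pairing m (A' t) (B \<tau>) + pairing m (qA \<tau>) (B \<tau>))"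
      by (subst Aeq, subst pairing_lincomb[OF m Lt(1) dL(1) L(3)[OF \<tau>(1)]]) (simp only: dA[OF L(3)[OF \<tau>(1)]])
    have e2: "pairing m g (B \<tau>) = pairing m g (B t) + ?h * (pairing m g (B' t) + pairing m g (qB \<tau>))"
      if g: "g \<in> L2_fun" for g
      unfolding pairing_commute[of m g "B \<tau>"]
      by (subst Beq, subst pairing_lincomb[OF m Lt(3) dL(2) g])
        (simp only: dB[OF g] pairing_commute[of m _ g])
    have "pairing m (A \<tau>) (B \<tau>) - pairing m (A t) (B t)
      = ?h * ((pairing m (A' t) (B t) + pairing m (A t) (B' t)) + ?R \<tau>)"
      unfolding e1 e2[OF Lt(1)] e2[OF Lt(2)] e2[OF q(1)] by algebra
    then show ?thesis using h by simp
  qed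
  show "((\<lambda>\<tau>. (pairing m (A \<tau>) (B \<tau>) - pairing m (A t) (B t)) / (\<tau> - t)) \<longlongrightarrow>
      pairing m (A' t) (B t) + pairing m (A t) (B' t)) (at t within {0..})"
  proof (rule Lim_transform_eventually[OF lim])
    show "\<forall>\<^sub>F \<tau> in at t within {0..}. pairing m (A' t) (B t) + pairing m (A t) (B' t) + ?R \<tau>
        = (pairing m (A \<tau>) (B \<tau>) - pairing m (A t) (B t)) / (\<tau> - t)"
      unfolding eventually_at_filter by (intro always_eventually allI impI eq[symmetric]) auto
  qed
qed

lemma nonincreasing_if_derivative_nonpos:
  fixes f :: "real \<Rightarrow> real"
  assumes "\<And>t. 0 \<le> t \<Longrightarrow> (f has_real_derivative f' t) (at t within {0..})"
    and "\<And>t. 0 \<le> t \<Longrightarrow> f' t \<le> 0" and "0 \<le> t"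
  shows "f t \<le> f 0"
proof (cases "t = 0")
  case False
  then have t0: "0 < t" using \<open>0 \<le> t\<close> by simp
  show ?thesis
  proof (rule DERIV_nonpos_imp_decreasing_open[OF \<open>0 \<le> t\<close>])
    fix s assume s: "0 < s" "s < t"
    then have "at s within {0..} = at s" by (intro at_within_interior) simp
    then show "\<exists>y. (f has_real_derivative y) (at s) \<and> y \<le> 0" using assms(1,2)[of s] s by auto
  next
    have "continuous_on {0..} f" by (rule DERIV_continuous_on[of "{0..}" f f']) (use assms(1) in simp)
    then show "continuous_on {0..t} f" by (rule continuous_on_subset) auto
  qed
qed simp

text \<open>The function \<open>exp (a t) (f t - c / a)\<close> does not increase.\<close>

lemma gronwall_linear:
  fixes f :: "real \<Rightarrow> real"
  assumes d: "\<And>t. 0 \<le> t \<Longrightarrow> (f has_real_derivative f' t) (at t within {0..})"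
    and le: "\<And>t. 0 \<le> t \<Longrightarrow> f' t \<le> c - a * f t" and a: "0 < a" and t: "0 \<le> t"
  shows "f t \<le> exp (- a * t) * f 0 + (1 - exp (- a * t)) * (c / a)"
proof -
  have "exp (a * t) * (f t - c / a) \<le> exp (a * 0) * (f 0 - c / a)"
  proof (rule nonincreasing_if_derivative_nonpos[OF _ _ t])
    fix s :: real assume s: "0 \<le> s"
    have e: "((\<lambda>s. exp (a * s)) has_real_derivative exp (a * s) * a) (at s within {0..})"
      by (auto intro!: derivative_eq_intros)
    show "((\<lambda>s. exp (a * s) * (f s - c / a)) has_real_derivative
        exp (a * s) * a * (f s - c / a) + f' s * exp (a * s)) (at s within {0..})"
      using DERIV_mult[OF e DERIV_diff[OF d[OF s] DERIV_const[of "c / a"]]] by simp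
    have "exp (a * s) * a * (f s - c / a) + f' s * exp (a * s) = exp (a * s) * (f' s - (c - a * f s))"
      using a by (simp add: algebra_simps)
    also have "\<dots> \<le> 0" using le[OF s] by (simp add: mult_nonneg_nonpos)
    finally show "exp (a * s) * a * (f s - c / a) + f' s * exp (a * s) \<le> 0" .
  qed
  then have "exp (- a * t) * (exp (a * t) * (f t - c / a)) \<le> exp (- a * t) * (f 0 - c / a)"
    by (intro mult_left_mono) auto
  moreover have "exp (- a * t) * (exp (a * t) * (f t - c / a)) = f t - c / a"
    by (simp add: exp_minus)
  ultimately have "f t - c / a \<le> exp (- a * t) * (f 0 - c / a)" by linarith
  then show ?thesis unfolding left_diff_distrib right_diff_distrib by linarith
qed

section \<open>Moments of a solution at bounded frequencies\<close>

text \<open>\<open>U\<close>, \<open>V\<close> and \<open>W\<close> are the Fourier transforms of a solution and of its first two time derivatives, cut off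
  at \<open>\<bar>\<xi>\<bar> = R\<close>; the support of \<open>W\<close> follows from the equation. The equation holds for almost every \<open>\<xi>\<close>, with a null set that may depend on \<open>t\<close>.\<close>

locale frequency_solution =
  fixes b :: "real \<Rightarrow> real" and R :: real and U V W :: "real \<Rightarrow> 'a::euclidean_space \<Rightarrow> complex"
  assumes dU: "L2_derivative U V" and dV: "L2_derivative V W"
    and suppU: "0 \<le> t \<Longrightarrow> R < norm \<xi> \<Longrightarrow> U t \<xi> = 0"
    and suppV: "0 \<le> t \<Longrightarrow> R < norm \<xi> \<Longrightarrow> V t \<xi> = 0"
    and equation: "0 \<le> t \<Longrightarrow> AE \<xi> in lborel. W t \<xi> + of_real ((norm \<xi>)\<^sup>2) * U t \<xi> + of_real (2 * b t) * V t \<xi> = 0"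
begin

text \<open>Weights that are bounded on the ball outside of which the solution vanishes. Multiplication with
  \<open>\<bar>\<xi>\<bar>\<^sup>2\<close> preserves this class.\<close>

definition admissible :: "('a \<Rightarrow> real) \<Rightarrow> bool" where
  "admissible m \<longleftrightarrow> m \<in> borel_measurable borel \<and> (\<exists>c. \<forall>\<xi>. norm \<xi> \<le> R \<longrightarrow> \<bar>m \<xi>\<bar> \<le> c)"

definition lowpass :: "('a \<Rightarrow> real) \<Rightarrow> 'a \<Rightarrow> real" where
  "lowpass m \<xi> = indicator (cball 0 R) \<xi> * m \<xi>"

text \<open>The moments of \<open>\<bar>y\<bar>\<^sup>2\<close>, \<open>2 Re (y \<cdot> cnj y')\<close> and \<open>\<bar>y'\<bar>\<^sup>2\<close> with respect to a weight \<open>m\<close>.\<close>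

definition Y where "Y m t = pairing (lowpass m) (U t) (U t)"
definition C where "C m t = 2 * pairing (lowpass m) (U t) (V t)"
definition P where "P m t = pairing (lowpass m) (V t) (V t)"

lemma admissible_const: "admissible (\<lambda>\<xi>. c)"
  by (auto simp: admissible_def)

lemma admissible_norm: "admissible (\<lambda>\<xi>. (norm \<xi>)\<^sup>2)"
  unfolding admissible_def by (auto intro!: exI[of _ "R\<^sup>2"] power_mono)

lemma admissible_mult:
  assumes "admissible m" "admissible n" shows "admissible (\<lambda>\<xi>. m \<xi> * n \<xi>)"
proof -
  obtain c d where c: "\<And>\<xi>. norm \<xi> \<le> R \<Longrightarrow> \<bar>m \<xi>\<bar> \<le> c" and d: "\<And>\<xi>. norm \<xi> \<le> R \<Longrightarrow> \<bar>n \<xi>\<bar> \<le> d"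
    using assms by (auto simp: admissible_def)
  have "\<bar>m \<xi> * n \<xi>\<bar> \<le> c * d" if "norm \<xi> \<le> R" for \<xi>
    unfolding abs_mult using c[OF that] d[OF that] by (intro mult_mono) (auto intro: order_trans[OF abs_ge_zero])
  then show ?thesis using assms by (auto simp: admissible_def)
qed

lemma admissible_lowpass:
  assumes "admissible m"
  shows "lowpass m \<in> borel_measurable borel" "\<exists>c. \<forall>\<xi>. \<bar>lowpass m \<xi>\<bar> \<le> c"
proof -
  have [measurable]: "cball (0::'a) R \<in> sets borel" "m \<in> borel_measurable borel"
    using assms by (simp_all add: admissible_def)
  show "lowpass m \<in> borel_measurable borel"
    unfolding lowpass_def[abs_def] by measurable
  obtain c where "\<And>\<xi>. norm \<xi> \<le> R \<Longrightarrow> \<bar>m \<xi>\<bar> \<le> c" using assms by (auto simp: admissible_def)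
  then have "\<bar>lowpass m \<xi>\<bar> \<le> max c 0" for \<xi> by (auto simp: lowpass_def indicator_def le_max_iff_disj)
  then show "\<exists>c. \<forall>\<xi>. \<bar>lowpass m \<xi>\<bar> \<le> c" by blast
qed

lemma UL: "0 \<le> t \<Longrightarrow> U t \<in> L2_fun" and VL: "0 \<le> t \<Longrightarrow> V t \<in> L2_fun" and WL: "0 \<le> t \<Longrightarrow> W t \<in> L2_fun"
  using dU dV by (auto simp: L2_derivative_def)

lemma form_integrable:
  assumes "admissible m" "f \<in> L2_fun" "g \<in> L2_fun"
  shows "integrable lborel (\<lambda>\<xi>. lowpass m \<xi> * Re (f \<xi> * cnj (g \<xi>)))"
proof -
  obtain c where "\<And>\<xi>. \<bar>lowpass m \<xi>\<bar> \<le> c" using admissible_lowpass(2)[OF assms(1)] by blast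
  then show ?thesis by (rule pairing_integrable(1)[OF admissible_lowpass(1)[OF assms(1)] _ assms(2,3)])
qed

lemma form_le:
  assumes "admissible m" "admissible n" "f \<in> L2_fun" "g \<in> L2_fun" "f' \<in> L2_fun" "g' \<in> L2_fun"
    and "\<And>\<xi>. norm \<xi> \<le> R \<Longrightarrow> m \<xi> * Re (f \<xi> * cnj (g \<xi>)) \<le> n \<xi> * Re (f' \<xi> * cnj (g' \<xi>))"
  shows "pairing (lowpass m) f g \<le> pairing (lowpass n) f' g'"
  unfolding pairing_def
  by (intro Bochner_Integration.integral_mono form_integrable assms(1-6))
    (use assms(7) in \<open>auto simp: lowpass_def indicator_def\<close>)

lemma form_add:
  assumes "admissible m" "admissible n" "f \<in> L2_fun" "g \<in> L2_fun"
  shows "pairing (lowpass (\<lambda>\<xi>. m \<xi> + n \<xi>)) f g = pairing (lowpass m) f g + pairing (lowpass n) f g"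
proof -
  have "pairing (lowpass (\<lambda>\<xi>. m \<xi> + n \<xi>)) f g
      = (LINT \<xi>|lborel. lowpass m \<xi> * Re (f \<xi> * cnj (g \<xi>)) + lowpass n \<xi> * Re (f \<xi> * cnj (g \<xi>)))"
    unfolding pairing_def lowpass_def by (simp add: algebra_simps)
  also have "\<dots> = pairing (lowpass m) f g + pairing (lowpass n) f g"
    unfolding pairing_def by (intro Bochner_Integration.integral_add form_integrable assms)
  finally show ?thesis .
qed

lemma form_cmult: "pairing (lowpass (\<lambda>\<xi>. a * m \<xi>)) f g = a * pairing (lowpass m) f g"
proof -
  have "pairing (lowpass (\<lambda>\<xi>. a * m \<xi>)) f g = (LINT \<xi>|lborel. a * (lowpass m \<xi> * Re (f \<xi> * cnj (g \<xi>))))"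
    unfolding pairing_def lowpass_def by (simp add: mult_ac)
  then show ?thesis unfolding pairing_def by simp
qed

text \<open>The identities satisfied by \<open>\<bar>y\<bar>\<^sup>2\<close>, \<open>2 Re (y \<cdot> cnj y')\<close> and \<open>\<bar>y'\<bar>\<^sup>2\<close> when \<open>y'' = - r\<^sup>2 y - 2 b y'\<close>, integrated. The
  factor \<open>r\<^sup>2\<close> is absorbed into the weight.\<close>

lemma derivatives:
  assumes m: "admissible m" and t: "0 \<le> t"
  shows "(Y m has_real_derivative C m t) (at t within {0..})"
    and "(C m has_real_derivative 2 * P m t - 2 * Y (\<lambda>\<xi>. m \<xi> * (norm \<xi>)\<^sup>2) t - 2 * b t * C m t) (at t within {0..})"
    and "(P m has_real_derivative - C (\<lambda>\<xi>. m \<xi> * (norm \<xi>)\<^sup>2) t - 4 * b t * P m t) (at t within {0..})"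
proof -
  let ?m' = "\<lambda>\<xi>. m \<xi> * (norm \<xi>)\<^sup>2"
  have m': "admissible ?m'" by (intro admissible_mult m admissible_norm)
  obtain c where c: "\<And>\<xi>. \<bar>lowpass m \<xi>\<bar> \<le> c" using admissible_lowpass(2)[OF m] by blast
  note mm = admissible_lowpass(1)[OF m]
  have W: "pairing (lowpass m) (W t) g = - pairing (lowpass ?m') (U t) g - 2 * b t * pairing (lowpass m) (V t) g"
    if g: "g \<in> L2_fun" for g
  proof -
    note [measurable] = L2_fun_measurable[OF g] L2_fun_measurable[OF UL[OF t]] L2_fun_measurable[OF VL[OF t]]
      L2_fun_measurable[OF WL[OF t]] mm admissible_lowpass(1)[OF m']
    have "pairing (lowpass m) (W t) g = (LINT \<xi>|lborel. - (lowpass ?m' \<xi> * Re (U t \<xi> * cnj (g \<xi>)))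
       - 2 * b t * (lowpass m \<xi> * Re (V t \<xi> * cnj (g \<xi>))))"
      unfolding pairing_def
    proof (rule integral_cong_AE)
      show "AE \<xi> in lborel. lowpass m \<xi> * Re (W t \<xi> * cnj (g \<xi>)) = - (lowpass ?m' \<xi> * Re (U t \<xi> * cnj (g \<xi>)))
       - 2 * b t * (lowpass m \<xi> * Re (V t \<xi> * cnj (g \<xi>)))"
        using equation[OF t]
      proof eventually_elim
        case (elim \<xi>)
        then have W: "W t \<xi> = - (of_real ((norm \<xi>)\<^sup>2) * U t \<xi> + of_real (2 * b t) * V t \<xi>)"
          by (simp add: add_eq_0_iff add.assoc)
        have "Re (W t \<xi> * cnj (g \<xi>)) = - ((norm \<xi>)\<^sup>2 * Re (U t \<xi> * cnj (g \<xi>))) - 2 * b t * Re (V t \<xi> * cnj (g \<xi>))"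
          unfolding W by (simp add: algebra_simps flip: of_real_power)
        then show ?case unfolding lowpass_def by (simp only:) (simp add: algebra_simps)
      qed
    qed measurable
    also have "\<dots> = - pairing (lowpass ?m') (U t) g - 2 * b t * pairing (lowpass m) (V t) g"
      unfolding pairing_def
      using form_integrable[OF m' UL[OF t] g] form_integrable[OF m VL[OF t] g] by simp
    finally show ?thesis .
  qed
  show "(Y m has_real_derivative C m t) (at t within {0..})"
    using pairing_has_derivative[OF mm c dU dU t] pairing_commute[of "lowpass m" "V t" "U t"]
    by (simp add: Y_def[abs_def] C_def)
  have "((\<lambda>t. 2 * pairing (lowpass m) (U t) (V t)) has_real_derivative
      2 * (pairing (lowpass m) (V t) (V t) + pairing (lowpass m) (U t) (W t))) (at t within {0..})"
    by (rule DERIV_cmult[OF pairing_has_derivative[OF mm c dU dV t]])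
  moreover have "2 * (pairing (lowpass m) (V t) (V t) + pairing (lowpass m) (U t) (W t))
      = 2 * P m t - 2 * Y ?m' t - 2 * b t * C m t"
    unfolding pairing_commute[of "lowpass m" "U t" "W t"] W[OF UL[OF t]]
    by (simp add: P_def Y_def C_def pairing_commute[of "lowpass m" "V t" "U t"])
  ultimately show "(C m has_real_derivative 2 * P m t - 2 * Y ?m' t - 2 * b t * C m t) (at t within {0..})"
    by (simp add: C_def[abs_def])
  have "((\<lambda>t. pairing (lowpass m) (V t) (V t)) has_real_derivative
      (pairing (lowpass m) (W t) (V t) + pairing (lowpass m) (V t) (W t))) (at t within {0..})"
    by (rule pairing_has_derivative[OF mm c dV dV t])
  moreover have "pairing (lowpass m) (W t) (V t) + pairing (lowpass m) (V t) (W t)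
      = - C ?m' t - 4 * b t * P m t"
    unfolding pairing_commute[of "lowpass m" "V t" "W t"] W[OF VL[OF t]]
    by (simp add: P_def C_def)
  ultimately show "(P m has_real_derivative - C ?m' t - 4 * b t * P m t) (at t within {0..})"
    by (simp add: P_def[abs_def])
qed

lemma
  assumes "admissible m" "admissible n" "0 \<le> t" "\<And>\<xi>. norm \<xi> \<le> R \<Longrightarrow> m \<xi> \<le> n \<xi>"
  shows Y_mono: "Y m t \<le> Y n t" and P_mono: "P m t \<le> P n t"
  unfolding Y_def P_def
  by (intro form_le assms UL VL; simp add: complex_mult_cnj assms(4) mult_right_mono)+

lemma Y_zero [simp]: "Y (\<lambda>\<xi>. 0) t = 0" and P_zero [simp]: "P (\<lambda>\<xi>. 0) t = 0"
  by (simp_all add: Y_def P_def pairing_def lowpass_def)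

lemma
  assumes "admissible m" "0 \<le> t" "\<And>\<xi>. norm \<xi> \<le> R \<Longrightarrow> 0 \<le> m \<xi>"
  shows Y_nonneg: "0 \<le> Y m t" and P_nonneg: "0 \<le> P m t"
  using Y_mono[OF admissible_const[of 0] assms(1,2)] P_mono[OF admissible_const[of 0] assms(1,2)] assms(3)
  by simp_all

text \<open>Pointwise Young inequality. The factor \<open>n\<close> is kept together with \<open>y\<close>, which makes the estimate usable for
  \<open>n = 1\<close> and for the force term \<open>n = r\<^sup>2\<close>.\<close>

lemma C_bound:
  assumes m: "admissible m" and n: "admissible n" and t: "0 \<le> t" and l: "0 < l"
    and m0: "\<And>\<xi>. norm \<xi> \<le> R \<Longrightarrow> 0 \<le> m \<xi>"
  shows "\<bar>C (\<lambda>\<xi>. m \<xi> * n \<xi>) t\<bar> \<le> l * Y (\<lambda>\<xi>. m \<xi> * (n \<xi>)\<^sup>2) t + P m t / l"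
proof -
  note a = admissible_mult[OF m n]
  have a2: "admissible (\<lambda>\<xi>. m \<xi> * (n \<xi>)\<^sup>2)"
    unfolding power2_eq_square by (intro admissible_mult m n)
  have young: "2 * \<bar>n * x\<bar> \<le> l * (n\<^sup>2 * A) + B / l" if "x\<^sup>2 \<le> A * B" "0 \<le> A" "0 \<le> B" for n x A B :: real
  proof -
    have "(2 * \<bar>n * x\<bar>)\<^sup>2 \<le> (l * (n\<^sup>2 * A) + B / l)\<^sup>2"
    proof -
      have "(2 * \<bar>n * x\<bar>)\<^sup>2 = 4 * n\<^sup>2 * x\<^sup>2" by (simp add: power_mult_distrib)
      also have "\<dots> \<le> 4 * n\<^sup>2 * (A * B)" using that(1) by (intro mult_left_mono) auto
      also have "\<dots> = 4 * (l * (n\<^sup>2 * A)) * (B / l)" using l by simp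
      also have "\<dots> \<le> (l * (n\<^sup>2 * A) + B / l)\<^sup>2"
      proof -
        have "4 * x * y \<le> (x + y)\<^sup>2" for x y :: real
          using zero_le_power2[of "x - y"] by (simp add: power2_diff power2_sum)
        then show ?thesis .
      qed
      finally show ?thesis .
    qed
    then show ?thesis using that l by (elim power2_le_imp_le) simp
  qed
  have re: "(Re (u * cnj v))\<^sup>2 \<le> (cmod u)\<^sup>2 * (cmod v)\<^sup>2" for u v
    using abs_Re_le_cmod[of "u * cnj v"] by (simp add: norm_mult power_mult_distrib[symmetric] abs_le_square_iff[symmetric])
  have int: "integrable lborel (\<lambda>\<xi>. l * (lowpass (\<lambda>\<xi>. m \<xi> * (n \<xi>)\<^sup>2) \<xi> * Re (U t \<xi> * cnj (U t \<xi>))) + (lowpass m \<xi> * Re (V t \<xi> * cnj (V t \<xi>))) / l)"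
    by (intro Bochner_Integration.integrable_add integrable_mult_right integrable_divide form_integrable a2 m UL VL t)
  have "\<bar>C (\<lambda>\<xi>. m \<xi> * n \<xi>) t\<bar> = \<bar>LINT \<xi>|lborel. 2 * (lowpass (\<lambda>\<xi>. m \<xi> * n \<xi>) \<xi> * Re (U t \<xi> * cnj (V t \<xi>)))\<bar>"
    by (simp add: C_def pairing_def abs_mult)
  also have "\<dots> \<le> (LINT \<xi>|lborel. \<bar>2 * (lowpass (\<lambda>\<xi>. m \<xi> * n \<xi>) \<xi> * Re (U t \<xi> * cnj (V t \<xi>)))\<bar>)"
    by (rule integral_abs_bound)
  also have "\<dots> \<le> (LINT \<xi>|lborel. l * (lowpass (\<lambda>\<xi>. m \<xi> * (n \<xi>)\<^sup>2) \<xi> * Re (U t \<xi> * cnj (U t \<xi>))) + (lowpass m \<xi> * Re (V t \<xi> * cnj (V t \<xi>))) / l)"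
  proof (rule Bochner_Integration.integral_mono[OF _ int])
    show "integrable lborel (\<lambda>\<xi>. \<bar>2 * (lowpass (\<lambda>\<xi>. m \<xi> * n \<xi>) \<xi> * Re (U t \<xi> * cnj (V t \<xi>)))\<bar>)"
      by (intro integrable_abs integrable_mult_right form_integrable a UL VL t)
    fix \<xi>
    show "\<bar>2 * (lowpass (\<lambda>\<xi>. m \<xi> * n \<xi>) \<xi> * Re (U t \<xi> * cnj (V t \<xi>)))\<bar>
      \<le> l * (lowpass (\<lambda>\<xi>. m \<xi> * (n \<xi>)\<^sup>2) \<xi> * Re (U t \<xi> * cnj (U t \<xi>))) + (lowpass m \<xi> * Re (V t \<xi> * cnj (V t \<xi>))) / l"
    proof (cases "norm \<xi> \<le> R")
      case True
      have "m \<xi> * (2 * \<bar>n \<xi> * Re (U t \<xi> * cnj (V t \<xi>))\<bar>) \<le> m \<xi> * (l * ((n \<xi>)\<^sup>2 * (cmod (U t \<xi>))\<^sup>2) + (cmod (V t \<xi>))\<^sup>2 / l)"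
        by (intro mult_left_mono young re m0[OF True]) auto
      moreover have "Re (z * cnj z) = (cmod z)\<^sup>2" for z
        by (simp add: complex_mult_cnj cmod_power2)
      ultimately show ?thesis
        using True m0[OF True] unfolding lowpass_def
        by (simp only: abs_mult abs_of_nonneg[OF m0[OF True]]) (simp add: algebra_simps abs_mult)
    qed (simp add: lowpass_def)
  qed
  also have "\<dots> = l * Y (\<lambda>\<xi>. m \<xi> * (n \<xi>)\<^sup>2) t + P m t / l"
    unfolding Y_def P_def pairing_def integral_mult_right_zero[symmetric] integral_divide_zero[symmetric]
    by (intro Bochner_Integration.integral_add integrable_mult_right integrable_divide form_integrable a2 m UL VL t)
  finally show ?thesis .
qed

end

section \<open>The Lyapunov functional\<close>

text \<open>The time-dependent coefficients: \<open>ga\<close> and \<open>al\<close> are \<open>\<gamma>\<close> and \<open>\<alpha>\<close> of the functional \<open>q\<close>, and \<open>h\<close> is the weight of the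
  velocity at low frequencies. The lower bound for \<open>al\<close> makes \<open>q\<close> positive definite.\<close>

locale lyapunov =
  fixes b ga al al' h :: "real \<Rightarrow> real" and G K h0 H \<mu> :: real
  assumes b_nonneg: "0 \<le> b t"
    and ga_deriv: "(ga has_real_derivative 2 * b t * ga t - 1) (at t)"
    and ga_pos: "0 < ga t" and ga_le: "ga t \<le> G"
    and al_deriv: "(al has_real_derivative al' t) (at t)"
    and al'_le: "al' t \<le> 2 * ga t - \<mu>" and al'_damped: "al' t - 4 * b t * al t + 2 * ga t \<le> - \<mu>"
    and al_ge: "2 * G\<^sup>2 + 1 \<le> al t" and al_le: "al t \<le> K" and \<mu>_pos: "0 < \<mu>"
    and h_deriv: "(h has_real_derivative 4 * b t * h t - 1) (at t)"
    and h0_pos: "0 < h0" and h_ge: "h0 \<le> h t" and h_le: "h t \<le> H"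
begin

text \<open>\<open>Kq\<close> bounds \<open>q\<close> by the energy \<open>N\<close>, and \<open>\<kappa> \<rho>\<close> is the decay rate of \<open>q\<close>. The constants \<open>Kp\<close> and \<open>Kv\<close> belong to the
  estimates of the velocity, at low and at all frequencies.\<close>

definition Kq where "Kq = K + 2 * G\<^sup>2 + 2"
definition \<kappa> where "\<kappa> = \<mu> / Kq"

definition K2 where "K2 = (max 1 (8 * H))\<^sup>2"
definition Kp where "Kp = K2 * (H + 16 * H * (4 * H\<^sup>2) * (2 * Kq + 4 * Kq / \<kappa>\<^sup>2)) / h0"
definition Kv where "Kv = Kp + 4 * Kq + 32 * Kq / \<kappa>\<^sup>2"

lemma Kq_ge: "1 \<le> Kq"
proof -
  have "0 \<le> K" using al_ge[of 0] al_le[of 0] zero_le_power2[of G] by linarith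
  then show ?thesis using zero_le_power2[of G] unfolding Kq_def by linarith
qed

lemma \<kappa>_pos: "0 < \<kappa>"
  using Kq_ge \<mu>_pos by (simp add: \<kappa>_def)

lemma H_pos: "0 < H"
  using h0_pos h_ge[of 0] h_le[of 0] by linarith

lemma Kp_nonneg: "0 \<le> Kp"
  unfolding Kp_def K2_def using H_pos Kq_ge h0_pos
  by (intro divide_nonneg_nonneg mult_nonneg_nonneg add_nonneg_nonneg) auto

lemma Kv_nonneg: "0 \<le> Kv"
  unfolding Kv_def using Kp_nonneg Kq_ge by (intro add_nonneg_nonneg) auto

end

locale damped_mode = frequency_solution b R U V W + lyapunov b ga al al' h G K h0 H \<mu>
  for b R and U V W :: "real \<Rightarrow> 'a::euclidean_space \<Rightarrow> complex" and ga al al' h G K h0 H \<mu>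
begin

definition weight :: "('a \<Rightarrow> real) \<Rightarrow> bool" where
  "weight m \<longleftrightarrow> admissible m \<and> (\<forall>\<xi>. norm \<xi> \<le> R \<longrightarrow> 0 \<le> m \<xi>)"

abbreviation r2 :: "'a \<Rightarrow> real" where "r2 \<xi> \<equiv> (norm \<xi>)\<^sup>2"

text \<open>The decay rate up to a constant: of the order \<open>\<bar>\<xi>\<bar>\<^sup>2\<close> at low and of order one at high frequencies.\<close>

definition rho :: "'a \<Rightarrow> real" where "rho \<xi> = r2 \<xi> / (1 + r2 \<xi>)"

lemma rho_nonneg: "0 \<le> rho \<xi>" and rho_le_1: "rho \<xi> \<le> 1" and r2_eq_rho: "r2 \<xi> = rho \<xi> + rho \<xi> * r2 \<xi>"
proof -
  have p: "0 < 1 + r2 \<xi>" by (simp add: add_pos_nonneg)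
  show "0 \<le> rho \<xi>" "rho \<xi> \<le> 1" using p by (auto simp: rho_def)
  have "rho \<xi> + rho \<xi> * r2 \<xi> = rho \<xi> * (1 + r2 \<xi>)" by (simp add: algebra_simps)
  then show "r2 \<xi> = rho \<xi> + rho \<xi> * r2 \<xi>" using p by (simp add: rho_def)
qed

lemma weightD: "weight m \<Longrightarrow> admissible m" "weight m \<Longrightarrow> norm \<xi> \<le> R \<Longrightarrow> 0 \<le> m \<xi>"
  by (auto simp: weight_def)

lemma admissible_rho: "admissible rho"
proof -
  have "rho \<in> borel_measurable borel" unfolding rho_def[abs_def] by measurable
  moreover have "\<bar>rho \<xi>\<bar> \<le> 1" for \<xi> using rho_nonneg rho_le_1 by simp
  ultimately show ?thesis by (auto simp: admissible_def)
qed

lemma weight_r2: "weight m \<Longrightarrow> weight (\<lambda>\<xi>. m \<xi> * r2 \<xi>)"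
  and weight_rho: "weight m \<Longrightarrow> weight (\<lambda>\<xi>. m \<xi> * rho \<xi>)"
  unfolding weight_def by (auto intro!: admissible_mult admissible_norm admissible_rho mult_nonneg_nonneg rho_nonneg)

text \<open>The energy with the lower order term \<open>\<bar>y\<bar>\<^sup>2\<close>, and the Lyapunov functional.\<close>

definition N where "N m t = P m t + Y m t + Y (\<lambda>\<xi>. m \<xi> * r2 \<xi>) t"
definition q where "q m t = al t * P m t + ga t * C m t + al t * Y (\<lambda>\<xi>. m \<xi> * r2 \<xi>) t + Y m t"

lemma parts_nonneg:
  assumes "weight m" "0 \<le> t"
  shows "0 \<le> P m t" "0 \<le> Y m t" "0 \<le> Y (\<lambda>\<xi>. m \<xi> * r2 \<xi>) t" "0 \<le> N m t"
proof -
  show 1: "0 \<le> P m t" "0 \<le> Y m t" "0 \<le> Y (\<lambda>\<xi>. m \<xi> * r2 \<xi>) t"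
    using assms weight_r2[OF assms(1)] by (auto intro!: P_nonneg Y_nonneg simp: weight_def)
  then show "0 \<le> N m t" by (simp add: N_def)
qed

text \<open>Young's inequality splits the mixed term into \<open>\<bar>y\<bar>\<^sup>2 / 2\<close>, which the last summand of \<open>q\<close> dominates, and
  \<open>2 ga\<^sup>2 \<bar>y'\<bar>\<^sup>2\<close>, which is dominated because \<open>al \<ge> 2 G\<^sup>2 + 1\<close>.\<close>

lemma q_bounds:
  assumes m: "weight m" and t: "0 \<le> t"
  shows "N m t \<le> 2 * q m t" and "q m t \<le> Kq * N m t"
proof -
  note nn = parts_nonneg[OF m t]
  have ga: "0 < ga t" "ga t \<le> G" by (rule ga_pos, rule ga_le)
  \<comment> \<open>With \<open>l = 1 / (2 * ga t)\<close> the coefficient of \<open>Y\<close> becomes one half.\<close>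
  have "\<bar>C (\<lambda>\<xi>. m \<xi> * 1) t\<bar> \<le> 1 / (2 * ga t) * Y (\<lambda>\<xi>. m \<xi> * 1\<^sup>2) t + P m t / (1 / (2 * ga t))"
    by (rule C_bound[OF weightD(1)[OF m] admissible_const t _ weightD(2)[OF m]]) (use ga in auto)
  then have "ga t * \<bar>C m t\<bar> \<le> ga t * (1 / (2 * ga t) * Y m t + P m t * (2 * ga t))"
    using ga by (intro mult_left_mono) auto
  also have "\<dots> = Y m t / 2 + 2 * (ga t)\<^sup>2 * P m t"
    using ga by (simp add: power2_eq_square field_simps)
  also have "\<dots> \<le> Y m t / 2 + 2 * G\<^sup>2 * P m t"
    using ga nn by (intro add_left_mono mult_right_mono mult_left_mono power_mono) auto
  finally have "ga t * \<bar>C m t\<bar> \<le> Y m t / 2 + 2 * G\<^sup>2 * P m t" .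
  moreover have "\<bar>ga t * C m t\<bar> = ga t * \<bar>C m t\<bar>" using ga by (simp add: abs_mult)
  ultimately have gC: "ga t * C m t \<le> Y m t / 2 + 2 * G\<^sup>2 * P m t"
    "- (ga t * C m t) \<le> Y m t / 2 + 2 * G\<^sup>2 * P m t" by linarith+
  let ?Z = "Y (\<lambda>\<xi>. m \<xi> * r2 \<xi>) t"
  have a1: "(2 * G\<^sup>2 + 1) * P m t \<le> al t * P m t" using nn al_ge by (intro mult_right_mono) auto
  have "1 \<le> al t" using al_ge[of t] zero_le_power2[of G] by linarith
  then have a2: "1 * ?Z \<le> al t * ?Z" using nn by (intro mult_right_mono) auto
  have a3: "al t * P m t \<le> K * P m t" "al t * ?Z \<le> K * ?Z" using nn al_le by (auto intro!: mult_right_mono)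
  show "N m t \<le> 2 * q m t"
  proof -
    have "2 * q m t = 2 * (al t * P m t) + 2 * (ga t * C m t) + 2 * (al t * ?Z) + 2 * Y m t"
      by (simp add: q_def)
    then show ?thesis
      using gC(2) a1 a2 nn unfolding N_def distrib_right by linarith
  qed
  have "q m t \<le> K * P m t + K * ?Z + Y m t / 2 + 2 * G\<^sup>2 * P m t + Y m t"
    using gC(1) a3 unfolding q_def by linarith
  also have "\<dots> \<le> Kq * N m t"
  proof -
    have "0 \<le> K" using al_ge[of 0] al_le[of 0] zero_le_power2[of G] by linarith
    then have "0 \<le> K * Y m t" "0 \<le> 2 * G\<^sup>2 * Y m t" "0 \<le> 2 * G\<^sup>2 * ?Z" using nn by auto
    then show ?thesis using nn unfolding Kq_def N_def distrib_left distrib_right by linarith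
  qed
  finally show "q m t \<le> Kq * N m t" .
qed

lemma N_mono:
  assumes m: "weight m" and n: "weight n" and t: "0 \<le> t" and le: "\<And>\<xi>. norm \<xi> \<le> R \<Longrightarrow> m \<xi> \<le> n \<xi>"
  shows "N m t \<le> N n t"
proof -
  have "P m t \<le> P n t" "Y m t \<le> Y n t"
    by (intro P_mono Y_mono weightD(1) m n t le; assumption)+
  moreover have "Y (\<lambda>\<xi>. m \<xi> * r2 \<xi>) t \<le> Y (\<lambda>\<xi>. n \<xi> * r2 \<xi>) t"
    by (intro Y_mono weightD(1) weight_r2 m n t mult_right_mono le) auto
  ultimately show ?thesis by (simp add: N_def)
qed

lemma q_nonneg: "weight m \<Longrightarrow> 0 \<le> t \<Longrightarrow> 0 \<le> q m t"
  using q_bounds(1)[of m t] parts_nonneg(4)[of m t] by linarith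

text \<open>The derivative of \<open>q\<close>. The mixed terms have cancelled because of the differential equation for \<open>ga\<close>.\<close>

definition q' where
  "q' m t = (al' t - 4 * b t * al t + 2 * ga t) * P m t + (al' t - 2 * ga t) * Y (\<lambda>\<xi>. m \<xi> * r2 \<xi>) t"

lemma q_deriv:
  assumes m: "weight m" and t: "0 \<le> t"
  shows "(q m has_real_derivative q' m t) (at t within {0..})"
proof -
  note ad = weightD(1)[OF m] and ad2 = weightD(1)[OF weight_r2[OF m]]
  note dd = derivatives[OF ad t] and dZ = derivatives(1)[OF ad2 t]
  have w: "(al has_real_derivative al' t) (at t within {0..})"
    "(ga has_real_derivative 2 * b t * ga t - 1) (at t within {0..})"
    using al_deriv ga_deriv by (auto intro: has_field_derivative_at_within)
  have "(q m has_real_derivative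
      (al' t * P m t + (- C (\<lambda>\<xi>. m \<xi> * r2 \<xi>) t - 4 * b t * P m t) * al t)
      + ((2 * b t * ga t - 1) * C m t + (2 * P m t - 2 * Y (\<lambda>\<xi>. m \<xi> * r2 \<xi>) t - 2 * b t * C m t) * ga t)
      + (al' t * Y (\<lambda>\<xi>. m \<xi> * r2 \<xi>) t + C (\<lambda>\<xi>. m \<xi> * r2 \<xi>) t * al t) + C m t) (at t within {0..})"
    unfolding q_def[abs_def]
    by (intro DERIV_add DERIV_mult w dd dZ)
  then show ?thesis
    by (rule DERIV_cong) (simp add: q'_def algebra_simps)
qed

text \<open>The energy density \<open>\<bar>y'\<bar>\<^sup>2 + r\<^sup>2 \<bar>y\<bar>\<^sup>2\<close> lacks the term \<open>\<bar>y\<bar>\<^sup>2\<close> of \<open>N\<close>. The factor \<open>rho\<close> compensates for this, because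
  \<open>r\<^sup>2 = rho (1 + r\<^sup>2)\<close> and \<open>rho \<le> 1\<close>.\<close>

lemma dissipation:
  assumes m: "weight m" and t: "0 \<le> t"
  shows "N (\<lambda>\<xi>. m \<xi> * rho \<xi>) t \<le> P m t + Y (\<lambda>\<xi>. m \<xi> * r2 \<xi>) t"
proof -
  note mr = weight_rho[OF m]
  have "P (\<lambda>\<xi>. m \<xi> * rho \<xi>) t \<le> P m t"
    using weightD(2)[OF m] rho_le_1 rho_nonneg by (intro P_mono weightD(1) m mr t) (auto intro: mult_left_le)
  moreover have "Y (\<lambda>\<xi>. m \<xi> * r2 \<xi>) t = Y (\<lambda>\<xi>. m \<xi> * rho \<xi> + m \<xi> * rho \<xi> * r2 \<xi>) t"
  proof -
    have "m \<xi> * r2 \<xi> = m \<xi> * rho \<xi> + m \<xi> * rho \<xi> * r2 \<xi>" for \<xi>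
      using arg_cong[OF r2_eq_rho[of \<xi>], of "\<lambda>x. m \<xi> * x"] by (simp only: distrib_left mult.assoc)
    then show ?thesis by presburger
  qed
  moreover have "\<dots> = Y (\<lambda>\<xi>. m \<xi> * rho \<xi>) t + Y (\<lambda>\<xi>. m \<xi> * rho \<xi> * r2 \<xi>) t"
    unfolding Y_def by (intro form_add weightD(1) mr weight_r2 UL t)
  ultimately show ?thesis unfolding N_def by linarith
qed

lemma q'_le:
  assumes m: "weight m" and t: "0 \<le> t"
  shows "q' m t \<le> - \<kappa> * q (\<lambda>\<xi>. m \<xi> * rho \<xi>) t"
proof -
  note nn = parts_nonneg[OF m t]
  have "q' m t \<le> (- \<mu>) * P m t + (- \<mu>) * Y (\<lambda>\<xi>. m \<xi> * r2 \<xi>) t"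
    unfolding q'_def using nn al'_damped[of t] al'_le[of t] by (intro add_mono mult_right_mono) auto
  also have "\<dots> = - \<mu> * (P m t + Y (\<lambda>\<xi>. m \<xi> * r2 \<xi>) t)" by (simp add: algebra_simps)
  also have "\<dots> \<le> - \<mu> * N (\<lambda>\<xi>. m \<xi> * rho \<xi>) t"
    using dissipation[OF m t] \<mu>_pos by simp
  also have "\<dots> = - \<kappa> * (Kq * N (\<lambda>\<xi>. m \<xi> * rho \<xi>) t)" using Kq_ge by (simp add: \<kappa>_def)
  also have "\<dots> \<le> - \<kappa> * q (\<lambda>\<xi>. m \<xi> * rho \<xi>) t"
    using q_bounds(2)[OF weight_rho[OF m] t] \<kappa>_pos by simp
  finally show ?thesis .
qed

text \<open>The left hand side stands for \<open>exp (\<kappa> rho t) q\<close> with the exponential cut off after the quadratic term. Its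
  derivative telescopes: the derivative of each coefficient is compensated by the decay of the
  preceding term.\<close>

lemma polynomial_decay:
  assumes m: "weight m" and t: "0 \<le> t"
  shows "q m t + \<kappa> * t * q (\<lambda>\<xi>. m \<xi> * rho \<xi>) t + (\<kappa> * t)\<^sup>2 / 2 * q (\<lambda>\<xi>. m \<xi> * rho \<xi> * rho \<xi>) t \<le> q m 0"
proof -
  let ?m1 = "\<lambda>\<xi>. m \<xi> * rho \<xi>" and ?m2 = "\<lambda>\<xi>. m \<xi> * rho \<xi> * rho \<xi>"
  note m1 = weight_rho[OF m] and m2 = weight_rho[OF weight_rho[OF m]]
  let ?J = "\<lambda>t. q m t + \<kappa> * t * q ?m1 t + (\<kappa> * t)\<^sup>2 / 2 * q ?m2 t"
  have "?J t \<le> ?J 0"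
  proof (rule nonincreasing_if_derivative_nonpos[OF _ _ t])
    fix t :: real assume t: "0 \<le> t"
    have "((\<lambda>t. \<kappa> * t) has_real_derivative \<kappa>) (at t within {0..})"
      "((\<lambda>t. (\<kappa> * t)\<^sup>2 / 2) has_real_derivative \<kappa> * (\<kappa> * t)) (at t within {0..})"
      by (auto intro!: derivative_eq_intros)
    then show "(?J has_real_derivative q' m t + (\<kappa> * q ?m1 t + q' ?m1 t * (\<kappa> * t))
        + (\<kappa> * (\<kappa> * t) * q ?m2 t + q' ?m2 t * ((\<kappa> * t)\<^sup>2 / 2))) (at t within {0..})"
      by (intro DERIV_add DERIV_mult q_deriv m m1 m2 t)
    have kt: "0 \<le> \<kappa> * t" using \<kappa>_pos t by simp
    have 1: "q' m t \<le> - \<kappa> * q ?m1 t" by (rule q'_le[OF m t])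
    have "q' ?m1 t * (\<kappa> * t) \<le> - \<kappa> * q ?m2 t * (\<kappa> * t)" by (intro mult_right_mono q'_le[OF m1 t] kt)
    then have 2: "q' ?m1 t * (\<kappa> * t) \<le> - (\<kappa> * (\<kappa> * t) * q ?m2 t)" by (simp add: mult_ac)
    have "q' ?m2 t \<le> 0"
      using q'_le[OF m2 t] mult_nonneg_nonneg[OF less_imp_le[OF \<kappa>_pos] q_nonneg[OF weight_rho[OF m2] t]]
      by simp
    then have 3: "q' ?m2 t * ((\<kappa> * t)\<^sup>2 / 2) \<le> 0" by (simp add: mult_nonpos_nonneg)
    show "q' m t + (\<kappa> * q ?m1 t + q' ?m1 t * (\<kappa> * t))
        + (\<kappa> * (\<kappa> * t) * q ?m2 t + q' ?m2 t * ((\<kappa> * t)\<^sup>2 / 2)) \<le> 0"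
      using 1 2 3 by simp
  qed
  then show ?thesis by simp
qed

lemma energy_decay:
  assumes m: "weight m" and t: "0 \<le> t"
  shows "N m t \<le> 2 * Kq * N m 0"
    and "t * N (\<lambda>\<xi>. m \<xi> * rho \<xi>) t \<le> 2 * Kq / \<kappa> * N m 0"
    and "t\<^sup>2 * N (\<lambda>\<xi>. m \<xi> * rho \<xi> * rho \<xi>) t \<le> 4 * Kq / \<kappa>\<^sup>2 * N m 0"
proof -
  let ?m1 = "\<lambda>\<xi>. m \<xi> * rho \<xi>" and ?m2 = "\<lambda>\<xi>. m \<xi> * rho \<xi> * rho \<xi>"
  note m1 = weight_rho[OF m] and m2 = weight_rho[OF weight_rho[OF m]]
  have 0: "q m 0 \<le> Kq * N m 0" by (rule q_bounds(2)[OF m]) simp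
  have kt: "0 \<le> \<kappa> * t" using \<kappa>_pos t by simp
  have nn: "0 \<le> q m t" "0 \<le> \<kappa> * t * q ?m1 t" "0 \<le> (\<kappa> * t)\<^sup>2 / 2 * q ?m2 t"
    using q_nonneg[OF m t] q_nonneg[OF m1 t] q_nonneg[OF m2 t] kt by auto
  note J = polynomial_decay[OF m t]
  show "N m t \<le> 2 * Kq * N m 0" using q_bounds(1)[OF m t] J nn 0 by linarith
  have "\<kappa> * t * N ?m1 t \<le> \<kappa> * t * (2 * q ?m1 t)" by (intro mult_left_mono q_bounds m1 t kt)
  then have "\<kappa> * t * N ?m1 t \<le> 2 * Kq * N m 0" using J nn 0 by linarith
  then show "t * N ?m1 t \<le> 2 * Kq / \<kappa> * N m 0"
    using \<kappa>_pos by (simp add: field_simps)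
  have "(\<kappa> * t)\<^sup>2 / 2 * N ?m2 t \<le> (\<kappa> * t)\<^sup>2 / 2 * (2 * q ?m2 t)" by (intro mult_left_mono q_bounds m2 t) auto
  then have "(\<kappa> * t)\<^sup>2 / 2 * N ?m2 t \<le> 2 * Kq * N m 0" using J nn 0 by linarith
  then show "t\<^sup>2 * N ?m2 t \<le> 4 * Kq / \<kappa>\<^sup>2 * N m 0"
    using \<kappa>_pos by (simp add: field_simps)
qed

text \<open>On the support of \<open>m\<close> the factor \<open>rho\<close> is at least \<open>\<rho>\<^sub>0\<close>. The comparison of \<open>q\<close> with \<open>N\<close> in both directions costs the factor
  \<open>2 * Kq\<close>, once in the rate and once in front.\<close>

lemma exponential_decay:
  assumes m: "weight m" and t: "0 \<le> t" and r: "0 < \<rho>\<^sub>0"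
    and supp: "\<And>\<xi>. norm \<xi> \<le> R \<Longrightarrow> m \<xi> \<noteq> 0 \<Longrightarrow> \<rho>\<^sub>0 \<le> rho \<xi>"
  shows "N m t \<le> 2 * Kq * exp (- (\<kappa> * \<rho>\<^sub>0 / (2 * Kq)) * t) * N m 0"
proof -
  have le: "\<rho>\<^sub>0 * N m t \<le> N (\<lambda>\<xi>. m \<xi> * rho \<xi>) t" if t: "0 \<le> t" for t
  proof -
    have mul: "\<rho>\<^sub>0 * m \<xi> \<le> m \<xi> * rho \<xi>" if "norm \<xi> \<le> R" for \<xi>
    proof (cases "m \<xi> = 0")
      case False
      then have "m \<xi> * \<rho>\<^sub>0 \<le> m \<xi> * rho \<xi>"
        using supp[OF that] weightD(2)[OF m that] by (intro mult_left_mono) auto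
      then show ?thesis by (simp add: mult.commute)
    qed simp
    have a: "admissible (\<lambda>\<xi>. \<rho>\<^sub>0 * m \<xi>)" "admissible (\<lambda>\<xi>. \<rho>\<^sub>0 * (m \<xi> * r2 \<xi>))"
      by (intro admissible_mult admissible_const weightD(1) weight_r2 m)+
    have "P (\<lambda>\<xi>. \<rho>\<^sub>0 * m \<xi>) t \<le> P (\<lambda>\<xi>. m \<xi> * rho \<xi>) t" "Y (\<lambda>\<xi>. \<rho>\<^sub>0 * m \<xi>) t \<le> Y (\<lambda>\<xi>. m \<xi> * rho \<xi>) t"
      by (intro P_mono Y_mono a weightD(1) weight_rho m t mul; assumption)+
    moreover have "Y (\<lambda>\<xi>. \<rho>\<^sub>0 * (m \<xi> * r2 \<xi>)) t \<le> Y (\<lambda>\<xi>. m \<xi> * rho \<xi> * r2 \<xi>) t"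
    proof (intro Y_mono a weightD(1) weight_r2 weight_rho m t)
      fix \<xi> :: 'a assume "norm \<xi> \<le> R"
      from mult_right_mono[OF mul[OF this], of "r2 \<xi>"]
      show "\<rho>\<^sub>0 * (m \<xi> * r2 \<xi>) \<le> m \<xi> * rho \<xi> * r2 \<xi>" by (simp add: mult.assoc)
    qed
    ultimately show ?thesis
      unfolding N_def distrib_left P_def Y_def form_cmult by linarith
  qed
  define a where "a = \<kappa> * \<rho>\<^sub>0 / (2 * Kq)"
  have a: "0 < a" using \<kappa>_pos r Kq_ge by (simp add: a_def)
  have "q m t \<le> exp (- a * t) * q m 0 + (1 - exp (- a * t)) * (0 / a)"
  proof (rule gronwall_linear[OF _ _ a t])
    fix t :: real assume t: "0 \<le> t"
    show "(q m has_real_derivative q' m t) (at t within {0..})" by (rule q_deriv[OF m t])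
    have "a * q m t \<le> a * (Kq * N m t)" using a by (intro mult_left_mono q_bounds m t) auto
    also have "\<dots> = \<kappa> / 2 * (\<rho>\<^sub>0 * N m t)" using Kq_ge by (simp add: a_def)
    also have "\<dots> \<le> \<kappa> / 2 * N (\<lambda>\<xi>. m \<xi> * rho \<xi>) t" using \<kappa>_pos by (intro mult_left_mono le t) auto
    also have "\<dots> \<le> \<kappa> / 2 * (2 * q (\<lambda>\<xi>. m \<xi> * rho \<xi>) t)"
      using \<kappa>_pos by (intro mult_left_mono q_bounds weight_rho m t) auto
    finally show "q' m t \<le> 0 - a * q m t" using q'_le[OF m t] by simp
  qed
  then have "q m t \<le> exp (- a * t) * q m 0" by simp
  also have "\<dots> \<le> exp (- a * t) * (Kq * N m 0)" by (intro mult_left_mono q_bounds m) auto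
  finally have "2 * q m t \<le> 2 * Kq * exp (- a * t) * N m 0" by (simp add: mult_ac)
  with q_bounds(1)[OF m t] show ?thesis unfolding a_def[symmetric] by linarith
qed

text \<open>For \<open>r \<le> 1\<close> the equation \<open>y'' + 2 b y' = - r\<^sup>2 y\<close> is a damped first order equation for \<open>y'\<close> with a force of
  size \<open>r\<^sup>2 \<bar>y\<bar> \<lesssim> rho \<bar>y\<bar>\<close>, whose square is \<open>O((1 + t)\<^sup>-\<^sup>2)\<close> by the decay of the energy. The weight \<open>h\<close> averages the
  damping over a period, and the factor \<open>(A + t)\<^sup>2\<close> turns the decay into a bound. Its derivative \<open>2 (A + t)\<close>
  is harmless once \<open>A \<ge> 8 H\<close>.\<close>

lemma low_frequency_velocity:
  assumes m: "weight m" and t: "0 \<le> t"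
    and supp: "\<And>\<xi>. norm \<xi> \<le> R \<Longrightarrow> m \<xi> \<noteq> 0 \<Longrightarrow> norm \<xi> \<le> 1"
  shows "(1 + t)\<^sup>2 * P m t \<le> Kp * N m 0"
proof -
  let ?m2 = "\<lambda>\<xi>. m \<xi> * rho \<xi> * rho \<xi>" and ?m4 = "\<lambda>\<xi>. m \<xi> * (r2 \<xi>)\<^sup>2"
  define A where "A = max 1 (8 * H)"
  define D where "D = (2 * Kq + 4 * Kq / \<kappa>\<^sup>2) * N m 0"
  have A: "1 \<le> A" "8 * H \<le> A" by (auto simp: A_def)
  have m2: "weight ?m2" by (intro weight_rho m)
  have m4: "weight ?m4" unfolding power2_eq_square mult.assoc[symmetric]
    using weight_r2[OF weight_r2[OF m]] by (simp add: power2_eq_square mult.assoc)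
  have N0: "0 \<le> N m 0" by (intro parts_nonneg m) simp
  have D0: "0 \<le> D" unfolding D_def using N0 Kq_ge by (intro mult_nonneg_nonneg add_nonneg_nonneg) auto
  have Y4: "Y ?m4 t \<le> 2 * N ?m2 t" if t: "0 \<le> t" for t
  proof -
    have "Y ?m4 t \<le> Y (\<lambda>\<xi>. 2 * (?m2 \<xi> + ?m2 \<xi> * r2 \<xi>)) t"
    proof (intro Y_mono weightD(1)[OF m4] t admissible_mult admissible_const)
      show "admissible (\<lambda>\<xi>. ?m2 \<xi> + ?m2 \<xi> * r2 \<xi>)"
      proof -
        have "admissible (\<lambda>\<xi>. ?m2 \<xi> * (1 + r2 \<xi>))"
        proof (rule admissible_mult[OF weightD(1)[OF m2]])
          show "admissible (\<lambda>\<xi>. 1 + r2 \<xi>)"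
            unfolding admissible_def
            by (auto intro!: exI[of _ "1 + R\<^sup>2"] power_mono simp: abs_of_nonneg)
        qed
        then show ?thesis by (simp only: distrib_left mult_1_right)
      qed
      fix \<xi> :: 'a assume \<xi>: "norm \<xi> \<le> R"
      show "m \<xi> * (r2 \<xi>)\<^sup>2 \<le> 2 * (m \<xi> * rho \<xi> * rho \<xi> + m \<xi> * rho \<xi> * rho \<xi> * r2 \<xi>)"
      proof (cases "m \<xi> = 0")
        case False
        then have "norm \<xi> \<le> 1" by (rule supp[OF \<xi>])
        then have r: "1 + r2 \<xi> \<le> 2" using power_mono[of "norm \<xi>" 1 2] by simp
        have e: "r2 \<xi> = rho \<xi> * (1 + r2 \<xi>)" using r2_eq_rho[of \<xi>] by (simp only: distrib_left mult_1_right)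
        have "(r2 \<xi>)\<^sup>2 = (rho \<xi> * rho \<xi> * (1 + r2 \<xi>)) * (1 + r2 \<xi>)"
          by (subst e) (simp only: power2_eq_square mult_ac)
        also have "\<dots> \<le> (rho \<xi> * rho \<xi> * (1 + r2 \<xi>)) * 2"
          using r by (intro mult_left_mono mult_nonneg_nonneg rho_nonneg) auto
        finally have "m \<xi> * (r2 \<xi>)\<^sup>2 \<le> m \<xi> * ((rho \<xi> * rho \<xi> * (1 + r2 \<xi>)) * 2)"
          using weightD(2)[OF m \<xi>] by (rule mult_left_mono)
        then show ?thesis by (simp add: algebra_simps)
      qed simp
    qed
    also have "\<dots> = 2 * (Y ?m2 t + Y (\<lambda>\<xi>. ?m2 \<xi> * r2 \<xi>) t)"
      unfolding Y_def form_cmult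
      by (subst form_add[OF weightD(1)[OF m2] weightD(1)[OF weight_r2[OF m2]] UL[OF t] UL[OF t]]) simp
    also have "\<dots> \<le> 2 * N ?m2 t" unfolding N_def using parts_nonneg(1)[OF m2 t] by simp
    finally show ?thesis .
  qed
  have Y4D: "(A + t)\<^sup>2 * Y ?m4 t \<le> 4 * A\<^sup>2 * D" if t: "0 \<le> t" for t
  proof -
    have "N ?m2 t \<le> N m t"
    proof -
      have le: "?m2 \<xi> \<le> m \<xi>" if "norm \<xi> \<le> R" for \<xi>
      proof -
        have "rho \<xi> * rho \<xi> \<le> 1" using mult_mono[OF rho_le_1[of \<xi>] rho_le_1[of \<xi>]] rho_nonneg[of \<xi>] by simp
        from mult_left_mono[OF this weightD(2)[OF m that]] show ?thesis by (simp add: mult.assoc)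
      qed
      show ?thesis by (rule N_mono[OF m2 m t le])
    qed
    then have "N ?m2 t + t\<^sup>2 * N ?m2 t \<le> D"
      unfolding D_def distrib_right using energy_decay(1,3)[OF m t] by linarith
    moreover have "(A + t)\<^sup>2 \<le> 2 * A\<^sup>2 * (1 + t\<^sup>2)"
    proof -
      have "(A + t)\<^sup>2 \<le> 2 * A\<^sup>2 + 2 * t\<^sup>2"
        using zero_le_power2[of "A - t"] by (simp add: power2_diff power2_sum)
      also have "\<dots> \<le> 2 * A\<^sup>2 + 2 * (A\<^sup>2 * t\<^sup>2)"
        using A(1) power_mono[of 1 A 2] by (intro add_left_mono mult_left_mono) (auto simp: mult_right_mono[of 1 "A\<^sup>2" "t\<^sup>2", simplified])
      finally show ?thesis by (simp add: algebra_simps)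
    qed
    moreover have "0 \<le> Y ?m4 t" by (rule parts_nonneg(2)[OF m4 t])
    ultimately have "(A + t)\<^sup>2 * Y ?m4 t \<le> (2 * A\<^sup>2 * (1 + t\<^sup>2)) * (2 * N ?m2 t)"
      using Y4[OF t] by (intro mult_mono) auto
    also have "\<dots> = 4 * A\<^sup>2 * (N ?m2 t + t\<^sup>2 * N ?m2 t)" by (simp add: algebra_simps)
    also have "\<dots> \<le> 4 * A\<^sup>2 * D" using \<open>N ?m2 t + t\<^sup>2 * N ?m2 t \<le> D\<close> by (intro mult_left_mono) auto
    finally show ?thesis .
  qed
  let ?F = "\<lambda>t. (A + t)\<^sup>2 * (h t * P m t)"
  let ?F' = "\<lambda>t. 2 * (A + t) * (h t * P m t)
      + ((4 * b t * h t - 1) * P m t + (- C (\<lambda>\<xi>. m \<xi> * r2 \<xi>) t - 4 * b t * P m t) * h t) * (A + t)\<^sup>2"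
  define a where "a = 1 / (4 * H)"
  have a: "0 < a" using H_pos by (simp add: a_def)
  have "?F t \<le> exp (- a * t) * ?F 0 + (1 - exp (- a * t)) * ((2 * H\<^sup>2 * (4 * A\<^sup>2 * D)) / a)"
  proof (rule gronwall_linear[OF _ _ a t])
    fix t :: real assume t: "0 \<le> t"
    note nP = parts_nonneg(1)[OF m t]
    have hp: "0 < h t" using h0_pos h_ge[of t] by linarith
    have "((\<lambda>t. (A + t)\<^sup>2) has_real_derivative 2 * (A + t)) (at t within {0..})"
      by (auto intro!: derivative_eq_intros)
    moreover have "(h has_real_derivative 4 * b t * h t - 1) (at t within {0..})"
      using h_deriv by (rule has_field_derivative_at_within)
    ultimately show "(?F has_real_derivative ?F' t) (at t within {0..})"
      by (intro DERIV_mult derivatives(3)[OF weightD(1)[OF m] t])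
    \<comment> \<open>With \<open>l = 2 * h t\<close> half of the dissipation \<open>P m t\<close> absorbs the velocity part of the force term.\<close>
    have "\<bar>C (\<lambda>\<xi>. m \<xi> * r2 \<xi>) t\<bar> \<le> 2 * h t * Y ?m4 t + P m t / (2 * h t)"
      by (rule C_bound[OF weightD(1)[OF m] admissible_norm t _ weightD(2)[OF m]]) (use hp in auto)
    then have "\<bar>C (\<lambda>\<xi>. m \<xi> * r2 \<xi>) t\<bar> * h t \<le> (2 * h t * Y ?m4 t + P m t / (2 * h t)) * h t"
      using hp by (intro mult_right_mono) auto
    also have "\<dots> = 2 * (h t)\<^sup>2 * Y ?m4 t + P m t / 2"
      using hp by (simp add: field_simps power2_eq_square)
    also have "\<dots> \<le> 2 * H\<^sup>2 * Y ?m4 t + P m t / 2"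
      using hp h_le[of t] parts_nonneg(2)[OF m4 t] by (intro add_right_mono mult_right_mono mult_left_mono power_mono) auto
    finally have Ch: "- C (\<lambda>\<xi>. m \<xi> * r2 \<xi>) t * h t \<le> 2 * H\<^sup>2 * Y ?m4 t + P m t / 2"
      using abs_le_D2[of "C (\<lambda>\<xi>. m \<xi> * r2 \<xi>) t"] hp
      by (meson abs_ge_minus_self mult_right_mono less_imp_le order_trans)
    have "(4 * b t * h t - 1) * P m t + (- C (\<lambda>\<xi>. m \<xi> * r2 \<xi>) t - 4 * b t * P m t) * h t
        = - P m t + - C (\<lambda>\<xi>. m \<xi> * r2 \<xi>) t * h t" by (simp add: algebra_simps)
    also have "\<dots> \<le> 2 * H\<^sup>2 * Y ?m4 t - P m t / 2" using Ch by linarith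
    finally have 1: "((4 * b t * h t - 1) * P m t + (- C (\<lambda>\<xi>. m \<xi> * r2 \<xi>) t - 4 * b t * P m t) * h t) * (A + t)\<^sup>2
        \<le> (2 * H\<^sup>2 * Y ?m4 t - P m t / 2) * (A + t)\<^sup>2"
      by (intro mult_right_mono) auto
    have 2: "2 * (A + t) * (h t * P m t) \<le> (A + t)\<^sup>2 * P m t / 4"
    proof -
      have "8 * h t \<le> A + t" using h_le[of t] A(2) t by linarith
      then have "(8 * h t) * ((A + t) * P m t) \<le> (A + t) * ((A + t) * P m t)"
        using A t nP by (intro mult_right_mono) auto
      moreover have "2 * (A + t) * (h t * P m t) = (8 * h t) * ((A + t) * P m t) / 4" by simp
      moreover have "(A + t)\<^sup>2 * P m t / 4 = (A + t) * ((A + t) * P m t) / 4" by (simp add: power2_eq_square)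
      ultimately show ?thesis by linarith
    qed
    have 3: "a * ?F t \<le> (A + t)\<^sup>2 * P m t / 4"
    proof -
      have "a * h t \<le> 1 / 4" using h_le[of t] H_pos by (simp add: a_def divide_le_eq)
      then have "(a * h t) * ((A + t)\<^sup>2 * P m t) \<le> 1 / 4 * ((A + t)\<^sup>2 * P m t)"
        using nP by (intro mult_right_mono) auto
      then show ?thesis by (simp add: mult_ac)
    qed
    have 4: "2 * H\<^sup>2 * ((A + t)\<^sup>2 * Y ?m4 t) \<le> 2 * H\<^sup>2 * (4 * A\<^sup>2 * D)"
      by (intro mult_left_mono Y4D t) auto
    have 5: "(2 * H\<^sup>2 * Y ?m4 t - P m t / 2) * (A + t)\<^sup>2 = 2 * H\<^sup>2 * ((A + t)\<^sup>2 * Y ?m4 t) - (A + t)\<^sup>2 * P m t / 2"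
      by (simp add: algebra_simps)
    show "?F' t \<le> 2 * H\<^sup>2 * (4 * A\<^sup>2 * D) - a * ?F t"
      using 1 2 3 4 5 by linarith
  qed
  also have "\<dots> \<le> ?F 0 + 8 * H\<^sup>2 * A\<^sup>2 * D / a"
  proof (intro add_mono)
    have "exp (- a * t) \<le> 1" using a t by simp
    moreover have "0 \<le> ?F 0" using h_ge[of 0] h0_pos parts_nonneg(1)[OF m, of 0] by simp
    ultimately show "exp (- a * t) * ?F 0 \<le> ?F 0" by (rule mult_left_le_one_le[rotated 2]) simp
    have "(1 - exp (- a * t)) * ((2 * H\<^sup>2 * (4 * A\<^sup>2 * D)) / a) \<le> 1 * ((2 * H\<^sup>2 * (4 * A\<^sup>2 * D)) / a)"
      using D0 a by (intro mult_right_mono) auto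
    then show "(1 - exp (- a * t)) * ((2 * H\<^sup>2 * (4 * A\<^sup>2 * D)) / a) \<le> 8 * H\<^sup>2 * A\<^sup>2 * D / a" by (simp add: mult_ac)
  qed
  also have "\<dots> \<le> A\<^sup>2 * (H * N m 0) + A\<^sup>2 * (16 * H * (4 * H\<^sup>2) * D)"
  proof (intro add_mono)
    have nP: "0 \<le> P m 0" "P m 0 \<le> N m 0" using parts_nonneg[OF m, of 0] by (auto simp: N_def)
    have "h 0 * P m 0 \<le> H * N m 0" using h_le[of 0] nP H_pos by (intro mult_mono) auto
    then show "?F 0 \<le> A\<^sup>2 * (H * N m 0)" by (simp add: mult_left_mono)
    have "8 * H\<^sup>2 * A\<^sup>2 * D / a = 32 * (H * H\<^sup>2 * A\<^sup>2 * D)" using H_pos by (simp add: a_def)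
    also have "\<dots> \<le> 64 * (H * H\<^sup>2 * A\<^sup>2 * D)" using H_pos D0 by (intro mult_right_mono mult_nonneg_nonneg) auto
    finally show "8 * H\<^sup>2 * A\<^sup>2 * D / a \<le> A\<^sup>2 * (16 * H * (4 * H\<^sup>2) * D)" by (simp add: mult_ac)
  qed
  finally have F: "?F t \<le> A\<^sup>2 * (H * N m 0 + 16 * H * (4 * H\<^sup>2) * D)" by (simp only: distrib_left)
  have "h0 * ((1 + t)\<^sup>2 * P m t) \<le> ?F t"
  proof -
    have "(1 + t)\<^sup>2 \<le> (A + t)\<^sup>2" using A t by (intro power_mono) auto
    then have "(1 + t)\<^sup>2 * (h0 * P m t) \<le> (A + t)\<^sup>2 * (h t * P m t)"
      using h_ge[of t] h0_pos parts_nonneg(1)[OF m t] by (intro mult_mono mult_right_mono) auto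
    then show ?thesis by (simp add: mult_ac)
  qed
  also note F
  also have "A\<^sup>2 * (H * N m 0 + 16 * H * (4 * H\<^sup>2) * D) = h0 * (Kp * N m 0)"
  proof -
    have "h0 * Kp = A\<^sup>2 * (H + 16 * H * (4 * H\<^sup>2) * (2 * Kq + 4 * Kq / \<kappa>\<^sup>2))"
      using h0_pos by (simp add: Kp_def K2_def A_def)
    then have "h0 * (Kp * N m 0) = A\<^sup>2 * (H + 16 * H * (4 * H\<^sup>2) * (2 * Kq + 4 * Kq / \<kappa>\<^sup>2)) * N m 0"
      by (simp only: mult.assoc[symmetric])
    then show ?thesis unfolding D_def by (simp only: distrib_left distrib_right mult.assoc)
  qed
  finally show ?thesis using h0_pos by simp
qed

end

section \<open>Distributions and their Fourier densities\<close>

lemma L2_fun_cong_AE: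
  assumes "f \<in> L2_fun" "g \<in> borel_measurable borel" "AE x in lborel. f x = g x"
  shows "g \<in> L2_fun" "L2_fun_norm g = L2_fun_norm f"
proof -
  note [measurable] = L2_fun_measurable[OF assms(1)] assms(2)
  have "nn2 g = nn2 f" using assms(3) by (intro nn_integral_cong_AE) auto
  then show "g \<in> L2_fun" using assms by (simp add: L2_fun_iff)
  have "(LINT x|lborel. (cmod (g x))\<^sup>2) = (LINT x|lborel. (cmod (f x))\<^sup>2)"
    using assms(3) by (intro integral_cong_AE) auto
  then show "L2_fun_norm g = L2_fun_norm f" by (simp add: L2_fun_norm_def)
qed

lemma has_density_L2_fun:
  "f \<in> L2_fun \<Longrightarrow> (\<And>\<phi>. \<phi> \<in> schwartz \<Longrightarrow> v \<phi> = (LINT x|lborel. f x * \<phi> x)) \<Longrightarrow> has_density v f"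
  unfolding has_density_def by (auto intro: L2_fun_mult_integrable schwartz_L2 L2_fun_measurable)

lemma has_density_density_of: "has_density v g \<Longrightarrow> has_density v (density_of v)"
  unfolding density_of_def using someI[of "has_density v" g] by simp

lemma has_density_lincomb:
  assumes "has_density v g" "has_density w h"
  shows "has_density (\<lambda>\<phi>. v \<phi> + c * w \<phi>) (\<lambda>x. g x + c * h x)"
  using assms by (auto simp: has_density_def distrib_right mult.assoc)

lemma has_density_unique:
  assumes g: "has_density v g" and h: "has_density w h" and eq: "\<And>\<phi>. \<phi> \<in> schwartz \<Longrightarrow> v \<phi> = w \<phi>"
  shows "AE x in lborel. g x = h x"
proof -
  have d: "has_density (\<lambda>\<phi>. v \<phi> + - 1 * w \<phi>) (\<lambda>x. g x + - 1 * h x)"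
    by (rule has_density_lincomb[OF g h])
  have "AE x in lborel. g x + - 1 * h x = 0"
    by (rule density_zero_unique) (use d eq in \<open>auto simp: has_density_def\<close>)
  then show ?thesis by eventually_elim simp
qed

lemma L2I:
  assumes v: "has_density v f" and f: "f \<in> L2_fun"
  shows "v \<in> L2" "L2_norm v = L2_fun_norm f"
proof -
  show "v \<in> L2" using assms by (auto simp: L2_def)
  have d: "has_density v (density_of v)" by (rule has_density_density_of[OF v])
  show "L2_norm v = L2_fun_norm f" unfolding L2_norm_def
    by (rule L2_fun_cong_AE(2)[OF f _ has_density_unique[OF v d refl]]) (use d in \<open>simp add: has_density_def\<close>)
qed

lemma L2E:
  assumes "v \<in> L2"
  obtains f where "has_density v f" "f \<in> L2_fun" "L2_norm v = L2_fun_norm f"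
proof -
  obtain f where "f \<in> L2_fun" "has_density v f" using assms by (auto simp: L2_def)
  with that L2I(2) show thesis by blast
qed

text \<open>The Fourier transform as a function, determined up to a null set.\<close>

abbreviation hat :: "'a::euclidean_space distribution \<Rightarrow> 'a \<Rightarrow> complex" where
  "hat v \<equiv> density_of (dist_fourier v)"

text \<open>By inversion \<open>v \<phi>\<close> is the value of \<open>dist_fourier v\<close> at the inverse Fourier transform of \<open>\<phi>\<close>. Up to a
  reflection this is the transform of \<open>\<phi>\<close>, so the \<open>L\<^sup>2\<close> extension at the reflected \<open>g\<close> is a density of \<open>v\<close>.\<close>

lemma L2_if_fourier_density:
  fixes v :: "'a::euclidean_space distribution"
  assumes v: "has_density (dist_fourier v) g" and g: "g \<in> L2_fun"
  shows "v \<in> L2" "L2_norm v \<le> L2_fun_norm g"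
proof -
  note [measurable] = L2_fun_measurable[OF g]
  have gr: "(\<lambda>\<xi>. g (- \<xi>)) \<in> L2_fun" "L2_fun_norm (\<lambda>\<xi>. g (- \<xi>)) = L2_fun_norm g"
    using lborel_integral_reflect[of "\<lambda>\<xi>. (cmod (g \<xi>))\<^sup>2"] L2_fun_integrable[OF g]
    by (auto simp: L2_fun_def L2_fun_norm_def)
  obtain f where f: "f \<in> L2_fun" "L2_fun_norm f \<le> L2_fun_norm g"
    "\<And>\<phi>. \<phi> \<in> schwartz \<Longrightarrow> (LINT x|lborel. g (- x) * fourier \<phi> x) = (LINT x|lborel. f x * \<phi> x)"
    using fourier_L2_extension[OF gr(1)] unfolding gr(2) by blast
  have "has_density v f"
  proof (rule has_density_L2_fun[OF f(1)])
    fix \<phi> :: "'a \<Rightarrow> complex" assume \<phi>: "\<phi> \<in> schwartz"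
    note [measurable] = schwartz_measurable[OF fourier_schwartz[OF \<phi>]]
    have "v \<phi> = dist_fourier v (inverse_fourier \<phi>)"
      by (simp add: dist_fourier_def fourier_inversion(2)[OF \<phi>])
    also have "\<dots> = (LINT \<xi>|lborel. g \<xi> * inverse_fourier \<phi> \<xi>)"
      using v inverse_fourier_schwartz[OF \<phi>] by (simp add: has_density_def)
    also have "\<dots> = (LINT \<xi>|lborel. (\<lambda>\<xi>. g (- \<xi>) * fourier \<phi> \<xi>) (- \<xi>))"
      by (simp add: inverse_fourier_eq)
    also have "\<dots> = (LINT \<xi>|lborel. g (- \<xi>) * fourier \<phi> \<xi>)"
      by (rule lborel_integral_reflect) measurable
    finally show "v \<phi> = (LINT x|lborel. f x * \<phi> x)" using f(3)[OF \<phi>] by simp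
  qed
  from L2I[OF this f(1)] f(2) show "v \<in> L2" "L2_norm v \<le> L2_fun_norm g" by auto
qed

text \<open>Here the \<open>L\<^sup>2\<close> extension is applied to the density of \<open>v\<close>; the two lemmas together give equality of
  the norms.\<close>

lemma fourier_density_if_L2:
  assumes "v \<in> L2"
  obtains g where "has_density (dist_fourier v) g" "g \<in> L2_fun" "L2_fun_norm g \<le> L2_norm v"
proof -
  obtain f where f: "has_density v f" "f \<in> L2_fun" "L2_norm v = L2_fun_norm f"
    using L2E[OF assms] by blast
  obtain g where g: "g \<in> L2_fun" "L2_fun_norm g \<le> L2_fun_norm f"
    "\<And>\<phi>. \<phi> \<in> schwartz \<Longrightarrow> (LINT x|lborel. f x * fourier \<phi> x) = (LINT x|lborel. g x * \<phi> x)"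
    using fourier_L2_extension[OF f(2)] by blast
  have "has_density (dist_fourier v) g"
  proof (rule has_density_L2_fun[OF g(1)])
    fix \<phi> :: "'a \<Rightarrow> complex" assume \<phi>: "\<phi> \<in> schwartz"
    have "dist_fourier v \<phi> = (LINT x|lborel. f x * fourier \<phi> x)"
      using f(1) fourier_schwartz[OF \<phi>] by (simp add: dist_fourier_def has_density_def)
    then show "dist_fourier v \<phi> = (LINT x|lborel. g x * \<phi> x)" using g(3)[OF \<phi>] by simp
  qed
  then show thesis using that g f(3) by simp
qed

lemma sobolev_hat:
  assumes "v \<in> sobolev s"
  shows "has_density (dist_fourier v) (hat v)" "sobolev_weight s (hat v) \<in> L2_fun"
proof -
  obtain g where g: "has_density (dist_fourier v) g" "sobolev_weight s g \<in> L2_fun"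
    using assms by (auto simp: sobolev_def)
  show h: "has_density (dist_fourier v) (hat v)" by (rule has_density_density_of[OF g(1)])
  have m[measurable]: "hat v \<in> borel_measurable borel" using h by (simp add: has_density_def)
  show "sobolev_weight s (hat v) \<in> L2_fun"
  proof (rule L2_fun_cong_AE(1)[OF g(2)])
    show "AE x in lborel. sobolev_weight s g x = sobolev_weight s (hat v) x"
      using has_density_unique[OF g(1) h refl] by eventually_elim (simp add: sobolev_weight_def)
  qed (simp add: sobolev_weight_def[abs_def])
qed

lemma sobolev_norm_eq:
  assumes g: "has_density (dist_fourier v) g" and w: "sobolev_weight s g \<in> L2_fun"
  shows "sobolev_norm s v = L2_fun_norm (sobolev_weight s g)"
proof -
  have h: "has_density (dist_fourier v) (hat v)" by (rule has_density_density_of[OF g])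
  have m[measurable]: "hat v \<in> borel_measurable borel" using h by (simp add: has_density_def)
  show ?thesis unfolding sobolev_norm_def
  proof (rule L2_fun_cong_AE(2)[OF w])
    show "AE x in lborel. sobolev_weight s g x = sobolev_weight s (hat v) x"
      using has_density_unique[OF g h refl] by eventually_elim (simp add: sobolev_weight_def)
  qed (simp add: sobolev_weight_def[abs_def])
qed

lemma fourier_density_cong:
  assumes v: "has_density (dist_fourier v) g" and eq: "eq_dist v w"
  shows "has_density (dist_fourier w) g"
proof -
  have "dist_fourier w \<phi> = dist_fourier v \<phi>" if "\<phi> \<in> schwartz" for \<phi>
    using eq fourier_schwartz[OF that] by (simp add: eq_dist_def dist_fourier_def)
  with v show ?thesis by (simp add: has_density_def)
qed

lemma has_density_dist_partial:
  assumes g: "has_density (dist_fourier v) g" and e: "e \<in> Basis"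
  shows "has_density (dist_fourier (dist_partial e v)) (\<lambda>\<xi>. \<i> * of_real (\<xi> \<bullet> e) * g \<xi>)"
proof -
  have [measurable]: "g \<in> borel_measurable borel" using g by (simp add: has_density_def)
  have "integrable lborel (\<lambda>\<xi>. \<i> * of_real (\<xi> \<bullet> e) * g \<xi> * \<phi> \<xi>) \<and>
    dist_fourier (dist_partial e v) \<phi> = (LINT \<xi>|lborel. \<i> * of_real (\<xi> \<bullet> e) * g \<xi> * \<phi> \<xi>)"
    if \<phi>: "\<phi> \<in> schwartz" for \<phi>
  proof -
    let ?\<psi> = "\<lambda>\<xi>. - \<i> * (of_real (\<xi> \<bullet> e) * \<phi> \<xi>)"
    have \<psi>: "?\<psi> \<in> schwartz" by (intro schwartz_cmult schwartz_coord_mult \<phi>)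
    have i: "integrable lborel (\<lambda>\<xi>. g \<xi> * ?\<psi> \<xi>)" and d: "dist_fourier v ?\<psi> = (LINT \<xi>|lborel. g \<xi> * ?\<psi> \<xi>)"
      using g \<psi> by (auto simp: has_density_def simp del: mult_minus_left)
    have eq: "\<i> * of_real (\<xi> \<bullet> e) * g \<xi> * \<phi> \<xi> = - (g \<xi> * ?\<psi> \<xi>)" for \<xi> by (simp add: mult_ac)
    have "dist_fourier (dist_partial e v) \<phi> = - dist_fourier v ?\<psi>"
      unfolding dist_fourier_def dist_partial_def partial_fourier[OF \<phi>] ..
    then show ?thesis
      unfolding eq d using i by (simp del: mult_minus_left mult_minus_right)
  qed
  then show ?thesis by (auto simp: has_density_def)
qed

lemma has_density_fourier_multiplier:
  assumes g: "has_density (dist_fourier v) g" and m[measurable]: "m \<in> borel_measurable borel"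
    and mg: "(\<lambda>\<xi>. m \<xi> * g \<xi>) \<in> L2_fun"
  shows "has_density (dist_fourier (fourier_multiplier m v)) (\<lambda>\<xi>. m \<xi> * g \<xi>)"
proof (rule has_density_L2_fun[OF mg])
  fix \<phi> :: "'a \<Rightarrow> complex" assume \<phi>: "\<phi> \<in> schwartz"
  have h: "has_density (dist_fourier v) (hat v)" by (rule has_density_density_of[OF g])
  have [measurable]: "hat v \<in> borel_measurable borel" "g \<in> borel_measurable borel"
    using g h by (auto simp: has_density_def)
  note [measurable] = schwartz_measurable[OF \<phi>]
  have "dist_fourier (fourier_multiplier m v) \<phi> = fourier_multiplier m v (fourier \<phi>)"
    by (simp only: dist_fourier_def)
  also have "\<dots> = (LINT \<xi>|lborel. m \<xi> * hat v \<xi> * \<phi> \<xi>)"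
    by (simp only: fourier_multiplier_def fourier_inversion(1)[OF \<phi>])
  also have "\<dots> = (LINT \<xi>|lborel. m \<xi> * g \<xi> * \<phi> \<xi>)"
  proof (rule integral_cong_AE)
    show "AE \<xi> in lborel. m \<xi> * hat v \<xi> * \<phi> \<xi> = m \<xi> * g \<xi> * \<phi> \<xi>"
      using has_density_unique[OF g h refl] by eventually_elim simp
  qed measurable
  finally show "dist_fourier (fourier_multiplier m v) \<phi> = (LINT \<xi>|lborel. m \<xi> * g \<xi> * \<phi> \<xi>)" .
qed

section \<open>From the Cauchy problem to the Fourier side\<close>

lemma sobolev_weight_mono:
  assumes g[measurable]: "g \<in> borel_measurable borel" and w: "sobolev_weight s' g \<in> L2_fun" and s: "s \<le> s'"
  shows "sobolev_weight s g \<in> L2_fun"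
proof (rule L2_fun_norm_mono(1)[OF _ w])
  show "sobolev_weight s g \<in> borel_measurable borel" by (simp add: sobolev_weight_def[abs_def])
  show "cmod (sobolev_weight s g \<xi>) \<le> cmod (sobolev_weight s' g \<xi>)" for \<xi>
    using s by (simp add: sobolev_weight_def norm_mult mult_right_mono powr_mono)
qed

text \<open>The restriction to frequencies at most \<open>R\<close>, where all Sobolev weights are comparable.\<close>

definition band :: "real \<Rightarrow> ('a::euclidean_space \<Rightarrow> complex) \<Rightarrow> 'a \<Rightarrow> complex" where
  "band R g \<xi> = indicator (cball 0 R) \<xi> * g \<xi>"

lemma band_measurable [measurable]: "g \<in> borel_measurable borel \<Longrightarrow> band R g \<in> borel_measurable borel"
proof -
  assume [measurable]: "g \<in> borel_measurable borel"
  have [measurable]: "cball (0::'a) R \<in> sets borel" by simp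
  show ?thesis unfolding band_def[abs_def] by measurable
qed

lemma band_bound:
  assumes g: "g \<in> borel_measurable borel" and w: "sobolev_weight s g \<in> L2_fun" and s: "s \<le> 0"
  shows "band R g \<in> L2_fun"
    and "L2_fun_norm (band R g) \<le> (1 + R\<^sup>2) powr (- s / 2) * L2_fun_norm (sobolev_weight s g)"
proof -
  let ?c = "(1 + R\<^sup>2) powr (- s / 2)"
  have cw: "(\<lambda>\<xi>. of_real ?c * sobolev_weight s g \<xi>) \<in> L2_fun" by (rule L2_fun_cmult[OF w])
  have le: "cmod (band R g \<xi>) \<le> cmod (of_real ?c * sobolev_weight s g \<xi>)" for \<xi>
  proof (cases "norm \<xi> \<le> R")
    case True
    have "1 \<le> (1 + R\<^sup>2) powr (- s / 2) * (1 + (norm \<xi>)\<^sup>2) powr (s / 2)"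
    proof -
      have "(1 + (norm \<xi>)\<^sup>2) powr (- s / 2) \<le> (1 + R\<^sup>2) powr (- s / 2)"
        using True s by (intro powr_mono2) (auto intro!: power_mono)
      then have "(1 + (norm \<xi>)\<^sup>2) powr (- s / 2) * (1 + (norm \<xi>)\<^sup>2) powr (s / 2)
          \<le> (1 + R\<^sup>2) powr (- s / 2) * (1 + (norm \<xi>)\<^sup>2) powr (s / 2)"
        by (intro mult_right_mono) auto
      moreover have "(1 + (norm \<xi>)\<^sup>2) powr (- s / 2) * (1 + (norm \<xi>)\<^sup>2) powr (s / 2) = 1"
        using add_pos_nonneg[OF zero_less_one zero_le_power2[of "norm \<xi>"]]
        by (simp add: powr_add[symmetric])
      ultimately show ?thesis by simp
    qed
    from mult_right_mono[OF this norm_ge_zero[of "g \<xi>"]] show ?thesis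
      using True by (simp add: band_def sobolev_weight_def norm_mult mult.assoc)
  qed (simp add: band_def)
  note mono = L2_fun_norm_mono[OF band_measurable[OF g] cw le]
  show "band R g \<in> L2_fun" by (rule mono)
  have "L2_fun_norm (band R g) \<le> L2_fun_norm (\<lambda>\<xi>. of_real ?c * sobolev_weight s g \<xi>)" by (rule mono)
  then show "L2_fun_norm (band R g) \<le> ?c * L2_fun_norm (sobolev_weight s g)"
    by (simp only: L2_fun_norm_cmult norm_of_real abs_of_nonneg[OF powr_ge_zero])
qed

text \<open>On a bounded set of frequencies the norm of \<open>H\<^sup>s\<close> controls the \<open>L\<^sup>2\<close> norm, so derivatives in \<open>H\<^sup>s\<close> become
  derivatives in \<open>L\<^sup>2\<close>.\<close>

lemma band_L2_derivative:
  fixes v w :: "real \<Rightarrow> 'a::euclidean_space distribution"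
  assumes d: "sobolev_derivative s v w" and v: "\<And>t. 0 \<le> t \<Longrightarrow> v t \<in> sobolev s'"
    and w: "\<And>t. 0 \<le> t \<Longrightarrow> w t \<in> sobolev s" and s: "s \<le> s'" "s' \<le> 0"
  shows "L2_derivative (\<lambda>t. band R (hat (v t))) (\<lambda>t. band R (hat (w t)))"
  unfolding L2_derivative_def
proof (intro allI impI conjI)
  fix t :: real assume t: "0 \<le> t"
  have s0: "s \<le> 0" using s by simp
  have hm: "hat (v \<tau>) \<in> borel_measurable borel" "hat (w \<tau>) \<in> borel_measurable borel" if "0 \<le> \<tau>" for \<tau>
    using sobolev_hat(1)[OF v[OF that]] sobolev_hat(1)[OF w[OF that]] by (auto simp: has_density_def)
  have hv: "sobolev_weight s (hat (v \<tau>)) \<in> L2_fun" if "0 \<le> \<tau>" for \<tau>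
    by (rule sobolev_weight_mono[OF hm(1)[OF that] sobolev_hat(2)[OF v[OF that]] s(1)])
  note hw = sobolev_hat(2)[OF w]
  show "band R (hat (v t)) \<in> L2_fun" by (rule band_bound(1)[OF hm(1)[OF t] hv[OF t] s0])
  show "band R (hat (w t)) \<in> L2_fun" by (rule band_bound(1)[OF hm(2)[OF t] hw[OF t] s0])
  let ?d = "\<lambda>\<tau> \<phi>. (v \<tau> \<phi> - v t \<phi>) / of_real (\<tau> - t) - w t \<phi>"
  let ?g = "\<lambda>\<tau> \<xi>. (1 / of_real (\<tau> - t)) * (hat (v \<tau>) \<xi> - hat (v t) \<xi>) - hat (w t) \<xi>"
  have le: "L2_fun_norm (\<lambda>\<xi>. (band R (hat (v \<tau>)) \<xi> - band R (hat (v t)) \<xi>) / of_real (\<tau> - t) - band R (hat (w t)) \<xi>)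
      \<le> (1 + R\<^sup>2) powr (- s / 2) * sobolev_norm s (?d \<tau>)" if \<tau>: "0 \<le> \<tau>" for \<tau>
  proof -
    have "has_density (dist_fourier (?d \<tau>)) (?g \<tau>)"
    proof -
      have 0: "has_density (\<lambda>\<phi>. 0) (\<lambda>x. 0)" by (simp add: has_density_def)
      have 1: "has_density (\<lambda>\<phi>. dist_fourier (v \<tau>) \<phi> + - 1 * dist_fourier (v t) \<phi>) (\<lambda>\<xi>. hat (v \<tau>) \<xi> + - 1 * hat (v t) \<xi>)"
        by (rule has_density_lincomb[OF sobolev_hat(1)[OF v[OF \<tau>]] sobolev_hat(1)[OF v[OF t]]])
      have 2: "has_density (\<lambda>\<phi>. 0 + (1 / of_real (\<tau> - t)) * (dist_fourier (v \<tau>) \<phi> + - 1 * dist_fourier (v t) \<phi>))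
          (\<lambda>\<xi>. 0 + (1 / of_real (\<tau> - t)) * (hat (v \<tau>) \<xi> + - 1 * hat (v t) \<xi>))"
        by (rule has_density_lincomb[OF 0 1])
      from has_density_lincomb[OF 2 sobolev_hat(1)[OF w[OF t]], of "- 1"]
      show ?thesis by (simp add: dist_fourier_def)
    qed
    moreover have gw: "sobolev_weight s (?g \<tau>) \<in> L2_fun"
    proof -
      have "sobolev_weight s (?g \<tau>) = (\<lambda>\<xi>. (1 / of_real (\<tau> - t)) * (sobolev_weight s (hat (v \<tau>)) \<xi> - sobolev_weight s (hat (v t)) \<xi>)
          - sobolev_weight s (hat (w t)) \<xi>)"
        unfolding sobolev_weight_def by (rule ext) (simp only: right_diff_distrib mult.left_commute)
      then show ?thesis
        by (simp only:) (intro L2_fun_diff L2_fun_cmult hv hw \<tau> t)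
    qed
    ultimately have "sobolev_norm s (?d \<tau>) = L2_fun_norm (sobolev_weight s (?g \<tau>))"
      by (rule sobolev_norm_eq)
    moreover have "(\<lambda>\<xi>. (band R (hat (v \<tau>)) \<xi> - band R (hat (v t)) \<xi>) / of_real (\<tau> - t) - band R (hat (w t)) \<xi>) = band R (?g \<tau>)"
      by (rule ext) (simp add: band_def indicator_def)
    moreover have "?g \<tau> \<in> borel_measurable borel"
      using hm[OF \<tau>] hm[OF t] by measurable
    ultimately show ?thesis using band_bound(2)[OF _ gw s0] by simp
  qed
  show "((\<lambda>\<tau>. L2_fun_norm (\<lambda>\<xi>. (band R (hat (v \<tau>)) \<xi> - band R (hat (v t)) \<xi>) / of_real (\<tau> - t) - band R (hat (w t)) \<xi>)) \<longlongrightarrow> 0)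
      (at t within {0..})"
  proof (rule Lim_null_comparison)
    show "\<forall>\<^sub>F \<tau> in at t within {0..}. norm (L2_fun_norm (\<lambda>\<xi>. (band R (hat (v \<tau>)) \<xi> - band R (hat (v t)) \<xi>) / of_real (\<tau> - t) - band R (hat (w t)) \<xi>))
        \<le> (1 + R\<^sup>2) powr (- s / 2) * sobolev_norm s (?d \<tau>)"
      unfolding eventually_at_filter by (intro always_eventually allI impI) (use le in simp)
    show "((\<lambda>\<tau>. (1 + R\<^sup>2) powr (- s / 2) * sobolev_norm s (?d \<tau>)) \<longlongrightarrow> 0) (at t within {0..})"
      using d t unfolding sobolev_derivative_def by (intro tendsto_mult_right_zero) blast
  qed
qed

text \<open>The equation is tested with the Fourier transforms of Schwartz functions. The Laplacian then becomes
  multiplication with \<open>- \<bar>\<xi>\<bar>\<^sup>2\<close>, and uniqueness of densities gives the equation for almost every \<open>\<xi>\<close>, at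
  each time separately.\<close>

lemma damped_wave_solution_frequency:
  fixes u ut :: "real \<Rightarrow> 'a::euclidean_space distribution"
  assumes sol: "damped_wave_solution b u1 u2 u ut"
  obtains W where "\<And>R. frequency_solution b R (\<lambda>t. band R (hat (u t))) (\<lambda>t. band R (hat (ut t))) (W R)"
    and "\<And>t. 0 \<le> t \<Longrightarrow> u t \<in> sobolev 0" "\<And>t. 0 \<le> t \<Longrightarrow> ut t \<in> sobolev (-1)"
    "eq_dist (u 0) u1" "eq_dist (ut 0) u2"
proof -
  obtain utt where c: "sobolev_continuous 0 u" "sobolev_continuous (-1) ut" "sobolev_derivative (-1) u ut"
    "sobolev_continuous (-2) utt" "sobolev_derivative (-2) ut utt"
    and eq: "\<And>t. 0 \<le> t \<Longrightarrow> eq_dist (\<lambda>\<phi>. utt t \<phi> - dist_laplacian (u t) \<phi> + 2 * of_real (b t) * ut t \<phi>) (\<lambda>\<phi>. 0)"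
    and ini: "eq_dist (u 0) u1" "eq_dist (ut 0) u2"
    using sol unfolding damped_wave_solution_def by blast
  have mem: "u t \<in> sobolev 0" "ut t \<in> sobolev (-1)" "utt t \<in> sobolev (-2)" if "0 \<le> t" for t
    using c that unfolding sobolev_continuous_def by blast+
  show thesis
  proof (rule that[OF _ mem(1,2) ini])
    fix R
    show "frequency_solution b R (\<lambda>t. band R (hat (u t))) (\<lambda>t. band R (hat (ut t))) (\<lambda>t. band R (hat (utt t)))"
    proof
      show "L2_derivative (\<lambda>t. band R (hat (u t))) (\<lambda>t. band R (hat (ut t)))"
        by (rule band_L2_derivative[OF c(3) mem(1,2)]) auto
      show "L2_derivative (\<lambda>t. band R (hat (ut t))) (\<lambda>t. band R (hat (utt t)))"
        by (rule band_L2_derivative[OF c(5) mem(2,3)]) auto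
      show "band R (hat (u t)) \<xi> = 0" "band R (hat (ut t)) \<xi> = 0" if "R < norm \<xi>" for t \<xi>
        using that by (auto simp: band_def)
      fix t :: real assume t: "0 \<le> t"
      let ?g = "\<lambda>\<xi>. hat (utt t) \<xi> + of_real ((norm \<xi>)\<^sup>2) * hat (u t) \<xi> + of_real (2 * b t) * hat (ut t) \<xi>"
      note h = sobolev_hat(1)[OF mem(1)[OF t]] sobolev_hat(1)[OF mem(2)[OF t]] sobolev_hat(1)[OF mem(3)[OF t]]
      have [measurable]: "hat (u t) \<in> borel_measurable borel" "hat (ut t) \<in> borel_measurable borel" "hat (utt t) \<in> borel_measurable borel"
        using h by (auto simp: has_density_def)
      have z: "integrable lborel (\<lambda>\<xi>. ?g \<xi> * \<phi> \<xi>) \<and> (LINT \<xi>|lborel. ?g \<xi> * \<phi> \<xi>) = 0" if \<phi>: "\<phi> \<in> schwartz" for \<phi>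
      proof -
        let ?\<psi> = "\<lambda>x. - of_real ((norm x)\<^sup>2) * \<phi> x"
        have \<psi>: "?\<psi> \<in> schwartz" by (rule laplacian_fourier(2)[OF \<phi>])
        have 1: "integrable lborel (\<lambda>\<xi>. hat (utt t) \<xi> * \<phi> \<xi>)" "utt t (fourier \<phi>) = (LINT \<xi>|lborel. hat (utt t) \<xi> * \<phi> \<xi>)"
          and 2: "integrable lborel (\<lambda>\<xi>. hat (ut t) \<xi> * \<phi> \<xi>)" "ut t (fourier \<phi>) = (LINT \<xi>|lborel. hat (ut t) \<xi> * \<phi> \<xi>)"
          using h(2,3) \<phi> by (auto simp: has_density_def dist_fourier_def)
        have 3: "integrable lborel (\<lambda>\<xi>. hat (u t) \<xi> * ?\<psi> \<xi>)" "dist_fourier (u t) ?\<psi> = (LINT \<xi>|lborel. hat (u t) \<xi> * ?\<psi> \<xi>)"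
          using h(1)[unfolded has_density_def, THEN conjunct2, rule_format, OF \<psi>] by auto
        have e0: "utt t (fourier \<phi>) - u t (laplacian (fourier \<phi>)) + 2 * of_real (b t) * ut t (fourier \<phi>) = 0"
          using eq[OF t] fourier_schwartz[OF \<phi>] by (simp add: eq_dist_def dist_laplacian_def)
        have "(LINT \<xi>|lborel. hat (utt t) \<xi> * \<phi> \<xi>) - (LINT \<xi>|lborel. hat (u t) \<xi> * ?\<psi> \<xi>)
            + 2 * of_real (b t) * (LINT \<xi>|lborel. hat (ut t) \<xi> * \<phi> \<xi>) = 0"
        proof -
          have "dist_fourier (u t) ?\<psi> = u t (laplacian (fourier \<phi>))"
            by (simp only: dist_fourier_def laplacian_fourier(1)[OF \<phi>])
          then show ?thesis using e0 unfolding 1(2) 2(2) 3(2) by simp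
        qed
        moreover have e: "((\<lambda>\<xi>. hat (utt t) \<xi> * \<phi> \<xi> - hat (u t) \<xi> * ?\<psi> \<xi> + 2 * of_real (b t) * (hat (ut t) \<xi> * \<phi> \<xi>))) = (\<lambda>\<xi>. ?g \<xi> * \<phi> \<xi>)"
          by (simp add: fun_eq_iff algebra_simps)
        moreover have i: "integrable lborel (\<lambda>\<xi>. hat (utt t) \<xi> * \<phi> \<xi> - hat (u t) \<xi> * ?\<psi> \<xi> + 2 * of_real (b t) * (hat (ut t) \<xi> * \<phi> \<xi>))"
          by (intro Bochner_Integration.integrable_add Bochner_Integration.integrable_diff integrable_mult_right 1(1) 2(1) 3(1))
        moreover have "(LINT \<xi>|lborel. hat (utt t) \<xi> * \<phi> \<xi> - hat (u t) \<xi> * ?\<psi> \<xi> + 2 * of_real (b t) * (hat (ut t) \<xi> * \<phi> \<xi>))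
            = (LINT \<xi>|lborel. hat (utt t) \<xi> * \<phi> \<xi>) - (LINT \<xi>|lborel. hat (u t) \<xi> * ?\<psi> \<xi>)
            + 2 * of_real (b t) * (LINT \<xi>|lborel. hat (ut t) \<xi> * \<phi> \<xi>)"
          using 1(1) 2(1) 3(1)
          by (subst Bochner_Integration.integral_add, simp, simp,
              subst Bochner_Integration.integral_diff, simp, simp, subst integral_mult_right_zero) (rule refl)
        ultimately show ?thesis unfolding e[symmetric] using i by (simp only:)
      qed
      have "AE \<xi> in lborel. ?g \<xi> = 0"
        by (rule density_zero_unique) (use z in auto)
      then show "AE \<xi> in lborel. band R (hat (utt t)) \<xi> + of_real ((norm \<xi>)\<^sup>2) * band R (hat (u t)) \<xi>
          + of_real (2 * b t) * band R (hat (ut t)) \<xi> = 0"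
        by eventually_elim (simp add: band_def indicator_def)
    qed
  qed
qed

section \<open>Decay at bounded frequencies\<close>

context damped_mode
begin

lemma N_cmult: "N (\<lambda>\<xi>. a * m \<xi>) t = a * N m t"
  unfolding N_def P_def Y_def form_cmult mult.assoc distrib_left ..

lemma weight_1: "weight (\<lambda>\<xi>. 1)"
  by (simp add: weight_def admissible_const)

text \<open>The weight \<open>r\<^sup>2\<close> is \<open>rho + rho r\<^sup>2\<close>, so the gradient is part of the energy with weight \<open>rho\<close>, which decays
  like \<open>1 / t\<close>.\<close>

lemma gradient_estimate:
  assumes t: "0 \<le> t"
  shows "(1 + t) * Y r2 t \<le> (2 * Kq + 2 * Kq / \<kappa>) * N (\<lambda>\<xi>. 1) 0"
proof -
  have "Y r2 t \<le> N (\<lambda>\<xi>. 1) t" using parts_nonneg[OF weight_1 t] by (simp add: N_def)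
  also note energy_decay(1)[OF weight_1 t]
  finally have 1: "Y r2 t \<le> 2 * Kq * N (\<lambda>\<xi>. 1) 0" .
  note w = weight_rho[OF weight_1]
  have "Y r2 t = Y (\<lambda>\<xi>. 1 * rho \<xi> + 1 * rho \<xi> * r2 \<xi>) t"
    using r2_eq_rho by simp
  also have "\<dots> = Y (\<lambda>\<xi>. 1 * rho \<xi>) t + Y (\<lambda>\<xi>. 1 * rho \<xi> * r2 \<xi>) t"
    unfolding Y_def by (intro form_add weightD(1) w weight_r2 UL t)
  also have "\<dots> \<le> N (\<lambda>\<xi>. 1 * rho \<xi>) t" using parts_nonneg[OF w t] by (simp add: N_def)
  finally have "t * Y r2 t \<le> t * N (\<lambda>\<xi>. 1 * rho \<xi>) t" using t by (rule mult_left_mono)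
  also note energy_decay(2)[OF weight_1 t]
  finally show ?thesis using 1 unfolding distrib_right by simp
qed

text \<open>At frequencies above one \<open>rho \<ge> 1 / 2\<close>, and the decay of the energy with the weight \<open>rho\<^sup>2\<close> is enough; the
  other frequencies are covered by \<open>low_frequency_velocity\<close>.\<close>

lemma velocity_estimate:
  assumes t: "0 \<le> t"
  shows "(1 + t)\<^sup>2 * P (\<lambda>\<xi>. 1) t \<le> Kv * N (\<lambda>\<xi>. 1) 0"
proof -
  let ?lo = "\<lambda>\<xi>. indicator (cball 0 1) \<xi> :: real" and ?hi = "\<lambda>\<xi>. indicator (- cball 0 1) \<xi> :: real"
  have wl: "weight ?lo" "weight ?hi"
    unfolding weight_def admissible_def by (auto intro!: exI[of _ 1] simp: indicator_def borel_measurable_indicator)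
  have N0: "N ?lo 0 \<le> N (\<lambda>\<xi>. 1) 0" "N ?hi 0 \<le> N (\<lambda>\<xi>. 1) 0"
    by (intro N_mono wl weight_1; simp add: indicator_def)+
  have "P (\<lambda>\<xi>. 1) t = P (\<lambda>\<xi>. ?lo \<xi> + ?hi \<xi>) t"
  proof -
    have "(\<lambda>\<xi>::'a. ?lo \<xi> + ?hi \<xi>) = (\<lambda>\<xi>. 1)" by (auto simp: indicator_def)
    then show ?thesis by simp
  qed
  also have "\<dots> = P ?lo t + P ?hi t"
    unfolding P_def by (intro form_add weightD(1) wl VL t)
  finally have split: "P (\<lambda>\<xi>. 1) t = P ?lo t + P ?hi t" .
  have lo: "(1 + t)\<^sup>2 * P ?lo t \<le> Kp * N (\<lambda>\<xi>. 1) 0"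
    using low_frequency_velocity[OF wl(1) t] mult_left_mono[OF N0(1) Kp_nonneg] by (force simp: indicator_def split: if_splits)
  let ?h2 = "\<lambda>\<xi>. ?hi \<xi> * rho \<xi> * rho \<xi>"
  note wh2 = weight_rho[OF weight_rho[OF wl(2)]]
  have "P ?hi t \<le> N ?hi t" using parts_nonneg[OF wl(2) t] by (simp add: N_def)
  also note energy_decay(1)[OF wl(2) t]
  also have "2 * Kq * N ?hi 0 \<le> 2 * Kq * N (\<lambda>\<xi>. 1) 0"
    using Kq_ge by (intro mult_left_mono N0) auto
  finally have h1: "P ?hi t \<le> 2 * Kq * N (\<lambda>\<xi>. 1) 0" .
  have "P ?hi t \<le> P (\<lambda>\<xi>. 4 * ?h2 \<xi>) t"
  proof (intro P_mono weightD(1)[OF wl(2)] admissible_mult admissible_const admissible_rho t)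
    fix \<xi> :: 'a
    show "?hi \<xi> \<le> 4 * ?h2 \<xi>"
    proof (cases "norm \<xi> \<le> 1")
      case False
      then have "1 \<le> r2 \<xi>" by (simp add: one_le_power)
      then have "1 / 2 \<le> rho \<xi>" unfolding rho_def by (simp add: le_divide_eq)
      then have "1 / 2 * (1 / 2) \<le> rho \<xi> * rho \<xi>" by (intro mult_mono) auto
      then show ?thesis using False by (simp add: indicator_def)
    qed (simp add: indicator_def)
  qed
  also have "\<dots> = 4 * P ?h2 t" unfolding P_def form_cmult ..
  also have "\<dots> \<le> 4 * N ?h2 t" using parts_nonneg[OF wh2 t] by (simp add: N_def)
  finally have "t\<^sup>2 * P ?hi t \<le> t\<^sup>2 * (4 * N ?h2 t)" by (intro mult_left_mono) auto
  also have "\<dots> = 4 * (t\<^sup>2 * N ?h2 t)" by simp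
  also have "\<dots> \<le> 4 * (4 * Kq / \<kappa>\<^sup>2 * N ?hi 0)" by (intro mult_left_mono energy_decay(3)[OF wl(2) t]) auto
  also have "\<dots> \<le> 4 * (4 * Kq / \<kappa>\<^sup>2 * N (\<lambda>\<xi>. 1) 0)"
    using Kq_ge by (intro mult_left_mono N0) auto
  finally have h2: "t\<^sup>2 * P ?hi t \<le> 16 * Kq / \<kappa>\<^sup>2 * N (\<lambda>\<xi>. 1) 0" by simp
  have "(1 + t)\<^sup>2 * P ?hi t \<le> (2 + 2 * t\<^sup>2) * P ?hi t"
    using zero_le_power2[of "1 - t"] parts_nonneg(1)[OF wl(2) t]
    by (intro mult_right_mono) (auto simp: power2_diff power2_sum)
  also have "\<dots> = 2 * P ?hi t + 2 * (t\<^sup>2 * P ?hi t)" by (simp add: algebra_simps)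
  also have "\<dots> \<le> 2 * (2 * Kq * N (\<lambda>\<xi>. 1) 0) + 2 * (16 * Kq / \<kappa>\<^sup>2 * N (\<lambda>\<xi>. 1) 0)"
    using h1 h2 by (intro add_mono mult_left_mono) auto
  finally show ?thesis using lo unfolding split Kv_def by (simp add: algebra_simps)
qed

text \<open>With the weight \<open>w = 1 / (1 + r\<^sup>2)\<close> the energy is the sum of \<open>\<bar>y\<bar>\<^sup>2\<close> and \<open>\<bar>y'\<bar>\<^sup>2 / (1 + r\<^sup>2)\<close>, the squared norm of
  \<open>L\<^sup>2 \<times> H\<^sup>-\<^sup>1\<close>.\<close>

lemma solution_estimate:
  assumes t: "0 \<le> t" and w: "\<And>\<xi>. w \<xi> = 1 / (1 + r2 \<xi>)"
  shows "Y (\<lambda>\<xi>. 1) t \<le> 2 * Kq * (P w 0 + Y (\<lambda>\<xi>. 1) 0)"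
proof -
  have p: "0 < 1 + r2 \<xi>" for \<xi> by (simp add: add_pos_nonneg)
  have ww: "weight w"
  proof -
    have "w \<in> borel_measurable borel" unfolding w by measurable
    moreover have "\<bar>w \<xi>\<bar> \<le> 1" for \<xi> using p[of \<xi>] by (simp add: w)
    moreover have "0 \<le> w \<xi>" for \<xi> using p[of \<xi>] by (simp add: w)
    ultimately show ?thesis by (auto simp: weight_def admissible_def)
  qed
  have Y1: "Y (\<lambda>\<xi>. 1) t = Y w t + Y (\<lambda>\<xi>. w \<xi> * r2 \<xi>) t" if "0 \<le> t" for t
  proof -
    have "w \<xi> + w \<xi> * r2 \<xi> = 1" for \<xi>
      using p[of \<xi>] by (simp add: w add_divide_distrib[symmetric])
    then have "Y (\<lambda>\<xi>. 1) t = Y (\<lambda>\<xi>. w \<xi> + w \<xi> * r2 \<xi>) t" by simp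
    also have "\<dots> = Y w t + Y (\<lambda>\<xi>. w \<xi> * r2 \<xi>) t"
      unfolding Y_def by (intro form_add weightD(1) ww weight_r2 UL that)
    finally show ?thesis .
  qed
  have "Y (\<lambda>\<xi>. 1) t \<le> N w t" using Y1[OF t] parts_nonneg[OF ww t] by (simp add: N_def)
  also have "\<dots> \<le> 2 * Kq * N w 0" by (rule energy_decay(1)[OF ww t])
  also have "N w 0 = P w 0 + Y (\<lambda>\<xi>. 1) 0" using Y1[of 0] by (simp add: N_def)
  finally show ?thesis .
qed

lemma quadratic_as_norm:
  assumes "0 \<le> t"
  shows "Y (\<lambda>\<xi>. (w \<xi>)\<^sup>2) t = (L2_fun_norm (\<lambda>\<xi>. of_real (w \<xi>) * U t \<xi>))\<^sup>2"
    and "P (\<lambda>\<xi>. (w \<xi>)\<^sup>2) t = (L2_fun_norm (\<lambda>\<xi>. of_real (w \<xi>) * V t \<xi>))\<^sup>2"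
proof -
  have *: "pairing (lowpass (\<lambda>\<xi>. (w \<xi>)\<^sup>2)) f f = (L2_fun_norm (\<lambda>\<xi>. of_real (w \<xi>) * f \<xi>))\<^sup>2"
    if "\<And>\<xi>. R < norm \<xi> \<Longrightarrow> f \<xi> = 0" for f
  proof -
    have re: "Re (z * cnj z) = (cmod z)\<^sup>2" for z by (simp add: complex_mult_cnj cmod_power2)
    show ?thesis
      unfolding pairing_def L2_fun_norm_power2 re norm_mult power_mult_distrib using that
      by (intro Bochner_Integration.integral_cong refl) (auto simp: lowpass_def indicator_def)
  qed
  show "Y (\<lambda>\<xi>. (w \<xi>)\<^sup>2) t = (L2_fun_norm (\<lambda>\<xi>. of_real (w \<xi>) * U t \<xi>))\<^sup>2"
    "P (\<lambda>\<xi>. (w \<xi>)\<^sup>2) t = (L2_fun_norm (\<lambda>\<xi>. of_real (w \<xi>) * V t \<xi>))\<^sup>2"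
    unfolding Y_def P_def by (intro * suppU suppV assms; assumption)+
qed

end

section \<open>Passing to all frequencies\<close>

lemma L2_fun_if_bands_bounded:
  fixes f :: "'a::euclidean_space \<Rightarrow> complex"
  assumes f[measurable]: "f \<in> borel_measurable borel"
    and b: "\<And>R. band R f \<in> L2_fun" "\<And>R. (L2_fun_norm (band R f))\<^sup>2 \<le> B"
  shows "f \<in> L2_fun" "(L2_fun_norm f)\<^sup>2 \<le> B"
proof -
  have "ennreal ((cmod (f x))\<^sup>2) = liminf (\<lambda>n. ennreal ((cmod (band (real n) f x))\<^sup>2))" for x
  proof -
    have "\<forall>\<^sub>F n in sequentially. norm x \<le> real n"
      using filterlim_real_sequentially by (simp add: filterlim_at_top)
    then have "\<forall>\<^sub>F n in sequentially. ennreal ((cmod (band (real n) f x))\<^sup>2) = ennreal ((cmod (f x))\<^sup>2)"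
      by eventually_elim (simp add: band_def)
    then have "(\<lambda>n. ennreal ((cmod (band (real n) f x))\<^sup>2)) \<longlonglongrightarrow> ennreal ((cmod (f x))\<^sup>2)"
      by (rule tendsto_eventually)
    then show ?thesis by (rule lim_imp_Liminf[OF trivial_limit_sequentially, symmetric])
  qed
  then have "nn2 f = (\<integral>\<^sup>+x. liminf (\<lambda>n. ennreal ((cmod (band (real n) f x))\<^sup>2)) \<partial>lborel)" by simp
  also have "\<dots> \<le> liminf (\<lambda>n. nn2 (band (real n) f))"
    by (rule nn_integral_liminf) measurable
  also have "\<dots> \<le> ennreal B"
    by (rule Liminf_le) (auto intro!: always_eventually ennreal_leI b(2) simp: nn2_eq[OF b(1)])
  finally have le: "nn2 f \<le> ennreal B" .
  then show fL: "f \<in> L2_fun" by (auto simp: L2_fun_iff intro: le_less_trans)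
  have "0 \<le> B" using b(2)[of 0] zero_le_power2[of "L2_fun_norm (band 0 f)"] by linarith
  then show "(L2_fun_norm f)\<^sup>2 \<le> B" using le by (simp add: nn2_eq[OF fL])
qed

lemma band_norm_le: "f \<in> L2_fun \<Longrightarrow> L2_fun_norm (band R f) \<le> L2_fun_norm f"
  by (rule L2_fun_norm_mono[of "band R f" f]; simp add: L2_fun_measurable band_def indicator_def)

lemma band_weighted_L2:
  assumes f: "f \<in> borel_measurable borel" "band R f \<in> L2_fun"
    and w: "w \<in> borel_measurable borel" "\<And>\<xi>. norm \<xi> \<le> R \<Longrightarrow> \<bar>w \<xi>\<bar> \<le> c"
  shows "band R (\<lambda>\<xi>. of_real (w \<xi>) * f \<xi>) \<in> L2_fun"
proof (rule L2_fun_norm_mono(1))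
  note [measurable] = f(1) w(1)
  show "(\<lambda>\<xi>. of_real c * band R f \<xi>) \<in> L2_fun" by (rule L2_fun_cmult[OF f(2)])
  show "band R (\<lambda>\<xi>. of_real (w \<xi>) * f \<xi>) \<in> borel_measurable borel" by measurable
  show "cmod (band R (\<lambda>\<xi>. of_real (w \<xi>) * f \<xi>) \<xi>) \<le> cmod (of_real c * band R f \<xi>)" for \<xi>
    using w(2)[of \<xi>] by (auto simp: band_def indicator_def norm_mult intro!: mult_right_mono)
qed

lemma band_sobolev_weight:
  "(\<lambda>\<xi>. of_real ((1 + (norm \<xi>)\<^sup>2) powr (s / 2)) * band R g \<xi>) = band R (sobolev_weight s g)"
  by (rule ext) (simp add: band_def sobolev_weight_def)

text \<open>The components have the Fourier transforms \<open>\<i> \<xi>\<^sub>e g\<close>, and \<open>\<Sum> \<xi>\<^sub>e\<^sup>2 = \<bar>\<xi>\<bar>\<^sup>2\<close>.\<close>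

lemma gradient_L2:
  fixes v :: "'a::euclidean_space distribution"
  assumes d: "\<And>e. e \<in> Basis \<Longrightarrow> (\<lambda>\<xi>. \<i> * of_real (\<xi> \<bullet> e) * g \<xi>) \<in> L2_fun \<Longrightarrow>
      has_density (dist_fourier (A (dist_partial e v))) (\<lambda>\<xi>. \<i> * of_real (\<xi> \<bullet> e) * g \<xi>)"
    and g[measurable]: "g \<in> borel_measurable borel"
    and f: "(\<lambda>\<xi>. of_real (norm \<xi>) * g \<xi>) \<in> L2_fun"
  shows "grad_in_L2 A v" "grad_L2_norm A v \<le> L2_fun_norm (\<lambda>\<xi>. of_real (norm \<xi>) * g \<xi>)"
proof -
  have h: "(\<lambda>\<xi>. \<i> * of_real (\<xi> \<bullet> e) * g \<xi>) \<in> L2_fun" if "e \<in> Basis" for e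
  proof (rule L2_fun_norm_mono(1)[OF _ f])
    show "cmod (\<i> * of_real (\<xi> \<bullet> e) * g \<xi>) \<le> cmod (of_real (norm \<xi>) * g \<xi>)" for \<xi>
      using Basis_le_norm[OF that, of \<xi>] by (simp add: norm_mult mult_right_mono)
  qed measurable
  note L = L2_if_fourier_density[OF d h]
  show "grad_in_L2 A v" unfolding grad_in_L2_def using L(1) h by blast
  have "(\<Sum>e\<in>Basis. (L2_norm (A (dist_partial e v)))\<^sup>2)
      \<le> (\<Sum>e\<in>Basis. (L2_fun_norm (\<lambda>\<xi>. \<i> * of_real (\<xi> \<bullet> e) * g \<xi>))\<^sup>2)"
  proof (rule sum_mono)
    fix e :: 'a assume e: "e \<in> Basis"
    show "(L2_norm (A (dist_partial e v)))\<^sup>2 \<le> (L2_fun_norm (\<lambda>\<xi>. \<i> * of_real (\<xi> \<bullet> e) * g \<xi>))\<^sup>2"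
      by (intro power_mono L(2) e h) (simp_all add: L2_norm_def)
  qed
  also have "\<dots> = (LINT \<xi>|lborel. (\<Sum>e\<in>Basis. (cmod (\<i> * of_real (\<xi> \<bullet> e) * g \<xi>))\<^sup>2))"
    unfolding L2_fun_norm_power2
    by (rule Bochner_Integration.integral_sum[symmetric]) (rule L2_fun_integrable[OF h])
  also have "\<dots> = (L2_fun_norm (\<lambda>\<xi>. of_real (norm \<xi>) * g \<xi>))\<^sup>2"
  proof -
    have "(\<Sum>e\<in>Basis. (cmod (\<i> * of_real (\<xi> \<bullet> e) * g \<xi>))\<^sup>2) = (cmod (of_real (norm \<xi>) * g \<xi>))\<^sup>2" for \<xi>
    proof -
      have "(norm \<xi>)\<^sup>2 = (\<Sum>e\<in>Basis. (\<xi> \<bullet> e)\<^sup>2)"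
        unfolding power2_norm_eq_inner by (subst euclidean_inner) (simp only: power2_eq_square)
      then show ?thesis by (simp add: norm_mult power_mult_distrib sum_distrib_right)
    qed
    then show ?thesis unfolding L2_fun_norm_power2 by (simp only:)
  qed
  finally show "grad_L2_norm A v \<le> L2_fun_norm (\<lambda>\<xi>. of_real (norm \<xi>) * g \<xi>)"
    unfolding grad_L2_norm_def by (intro real_le_lsqrt) auto
qed

lemma cutoff_facts:
  assumes "cutoff \<eta>"
  obtains B r where "continuous_on UNIV \<eta>" "1 \<le> B" "\<And>s. 0 \<le> s \<Longrightarrow> \<bar>\<eta> s\<bar> \<le> B"
    "0 < r" "\<And>s. \<bar>s\<bar> < r \<Longrightarrow> \<eta> s = 0"
proof -
  have "\<eta> differentiable (at s)" for s
    using assms unfolding cutoff_def smooth_real_def by (auto dest: spec[of _ "0::nat"])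
  then have cont: "continuous_on UNIV \<eta>"
    by (intro continuous_at_imp_continuous_on ballI differentiable_imp_continuous_within)
  obtain r where r: "0 < r" "\<And>s. \<bar>s\<bar> < r \<Longrightarrow> \<eta> s = 0"
    using assms unfolding cutoff_def eventually_nhds_metric by (auto simp: dist_real_def)
  obtain S where S: "\<And>s. S \<le> s \<Longrightarrow> \<eta> s = 1"
    using assms unfolding cutoff_def eventually_at_top_linorder by blast
  have "compact (\<eta> ` {0..S})"
    by (intro compact_continuous_image continuous_on_subset[OF cont]) auto
  then have "bounded (\<eta> ` {0..S})" by (rule compact_imp_bounded)
  then obtain B where "\<forall>x\<in>\<eta> ` {0..S}. norm x \<le> B" unfolding bounded_iff by blast
  then have B: "\<bar>\<eta> s\<bar> \<le> B" if "s \<in> {0..S}" for s using that by simp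
  have "\<bar>\<eta> s\<bar> \<le> max B 1" if "0 \<le> s" for s
    using B[of s] S[of s] that by (cases "s \<le> S") (auto simp: le_max_iff_disj)
  with cont r show thesis by (intro that[of "max B 1" r]) auto
qed

lemma norm_le_if_square_le:
  fixes n K D :: real
  assumes "n\<^sup>2 \<le> K * D\<^sup>2" "0 \<le> K" "0 \<le> D"
  shows "n \<le> sqrt K * D"
proof (rule power2_le_imp_le)
  show "n\<^sup>2 \<le> (sqrt K * D)\<^sup>2" using assms by (simp add: power_mult_distrib)
qed (use assms in simp)

section \<open>Estimates for the wave equation\<close>

context lyapunov
begin

lemma Kq_nonneg: "0 \<le> Kq" using Kq_ge by simp

lemma wave_solution_bound:
  fixes u1 :: "'a::euclidean_space distribution"
  assumes u1: "u1 \<in> L2" and u2: "u2 \<in> sobolev (-1)" and sol: "damped_wave_solution b u1 u2 u ut" and t: "0 \<le> t"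
  shows "u t \<in> L2 \<and> L2_norm (u t) \<le> sqrt (2 * Kq) * (L2_norm u1 + sobolev_norm (-1) u2)"
proof -
  obtain W where fs: "\<And>R. frequency_solution b R (\<lambda>t. band R (hat (u t))) (\<lambda>t. band R (hat (ut t))) (W R)"
    and mem: "\<And>t. 0 \<le> t \<Longrightarrow> u t \<in> sobolev 0" "\<And>t. 0 \<le> t \<Longrightarrow> ut t \<in> sobolev (-1)"
    and ini: "eq_dist (u 0) u1" "eq_dist (ut 0) u2"
    by (rule damped_wave_solution_frequency[OF sol]) (rule that)
  note hu = sobolev_hat(1)[OF mem(1)] and hut = sobolev_hat(1)[OF mem(2)]
  have [measurable]: "hat (u 0) \<in> borel_measurable borel" "hat (u t) \<in> borel_measurable borel"
    using hu[of 0] hu[OF t] by (auto simp: has_density_def)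
  obtain g where g: "has_density (dist_fourier u1) g" "g \<in> L2_fun" "L2_fun_norm g \<le> L2_norm u1"
    using fourier_density_if_L2[OF u1] by blast
  have "AE \<xi> in lborel. g \<xi> = hat (u 0) \<xi>"
    by (rule has_density_unique[OF g(1) fourier_density_cong[OF hu[of 0] ini(1)] refl]) simp
  from L2_fun_cong_AE[OF g(2) _ this] g(3)
  have x0: "hat (u 0) \<in> L2_fun" "L2_fun_norm (hat (u 0)) \<le> L2_norm u1" by auto
  have z0: "sobolev_weight (-1) (hat (ut 0)) \<in> L2_fun" by (rule sobolev_hat(2)[OF mem(2)]) simp
  have z0n: "sobolev_norm (-1) u2 = L2_fun_norm (sobolev_weight (-1) (hat (ut 0)))"
    by (rule sobolev_norm_eq[OF fourier_density_cong[OF hut[of 0] ini(2)] z0]) simp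
  let ?D = "L2_norm u1 + sobolev_norm (-1) u2"
  have nn: "0 \<le> L2_norm u1" "0 \<le> sobolev_norm (-1) u2"
    by (simp_all add: L2_norm_def sobolev_norm_def)
  have bnd: "(L2_fun_norm (band R (hat (u t))))\<^sup>2 \<le> (2 * Kq) * ?D\<^sup>2" "band R (hat (u t)) \<in> L2_fun" for R
  proof -
    interpret F: frequency_solution b R "\<lambda>t. band R (hat (u t))" "\<lambda>t. band R (hat (ut t))" "W R"
      by (rule fs)
    interpret D: damped_mode b R "\<lambda>t. band R (hat (u t))" "\<lambda>t. band R (hat (ut t))" "W R" ga al al' h G K h0 H \<mu> ..
    show "band R (hat (u t)) \<in> L2_fun" by (rule F.UL[OF t])
    let ?w = "\<lambda>\<xi>::'a. (1 + (norm \<xi>)\<^sup>2) powr (-1 / 2)"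
    have w: "(?w \<xi>)\<^sup>2 = 1 / (1 + (norm \<xi>)\<^sup>2)" for \<xi>
    proof -
      have p: "0 < 1 + (norm \<xi>)\<^sup>2" by (simp add: add_pos_nonneg)
      have "(?w \<xi>)\<^sup>2 = (1 + (norm \<xi>)\<^sup>2) powr (-1)"
        unfolding power2_eq_square powr_add[symmetric] by simp
      also have "\<dots> = 1 / (1 + (norm \<xi>)\<^sup>2)" using p by (simp add: powr_minus_divide)
      finally show ?thesis .
    qed
    have "F.Y (\<lambda>\<xi>. 1) t \<le> 2 * Kq * (F.P (\<lambda>\<xi>. (?w \<xi>)\<^sup>2) 0 + F.Y (\<lambda>\<xi>. 1) 0)"
      by (rule D.solution_estimate[OF t w])
    moreover have "F.Y (\<lambda>\<xi>. 1) s = (L2_fun_norm (band R (hat (u s))))\<^sup>2" if "0 \<le> s" for s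
      using D.quadratic_as_norm(1)[OF that, of "\<lambda>\<xi>. 1"] by simp
    moreover have "F.P (\<lambda>\<xi>. (?w \<xi>)\<^sup>2) 0 = (L2_fun_norm (band R (sobolev_weight (-1) (hat (ut 0)))))\<^sup>2"
      using D.quadratic_as_norm(2)[of 0 ?w] by (simp only: band_sobolev_weight order_refl) 
    ultimately have "(L2_fun_norm (band R (hat (u t))))\<^sup>2
        \<le> 2 * Kq * ((L2_fun_norm (band R (sobolev_weight (-1) (hat (ut 0)))))\<^sup>2 + (L2_fun_norm (band R (hat (u 0))))\<^sup>2)"
      using t by simp
    also have "\<dots> \<le> 2 * Kq * ((sobolev_norm (-1) u2)\<^sup>2 + (L2_norm u1)\<^sup>2)"
      using band_norm_le[OF z0, of R] order_trans[OF band_norm_le[OF x0(1), of R] x0(2)] Kq_nonneg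
      unfolding z0n by (intro mult_left_mono add_mono power_mono) auto
    also have "\<dots> \<le> 2 * Kq * ?D\<^sup>2"
      using Kq_nonneg nn by (intro mult_left_mono) (auto simp: power2_sum)
    finally show "(L2_fun_norm (band R (hat (u t))))\<^sup>2 \<le> (2 * Kq) * ?D\<^sup>2" .
  qed
  have "hat (u t) \<in> borel_measurable borel" by measurable
  note x = L2_fun_if_bands_bounded[OF this bnd(2) bnd(1)]
  note L = L2_if_fourier_density[OF hu[OF t] x(1)]
  have "L2_fun_norm (hat (u t)) \<le> sqrt (2 * Kq) * ?D"
    using x(2) Kq_nonneg nn by (intro norm_le_if_square_le) auto
  then show ?thesis using L by linarith
qed

text \<open>What the estimates for data in \<open>H\<^sup>1 \<times> L\<^sup>2\<close> share. The initial values agree with \<open>u1\<close> and \<open>u2\<close> as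
  distributions, hence their Fourier transforms agree almost everywhere; that of
  \<open>u2\<close> is bounded in \<open>L\<^sup>2\<close> by \<open>fourier_density_if_L2\<close>.\<close>

lemma energy_data:
  fixes u1 :: "'a::euclidean_space distribution"
  assumes u1: "u1 \<in> sobolev 1" and u2: "u2 \<in> L2" and sol: "damped_wave_solution b u1 u2 u ut"
  obtains W where "\<And>R. damped_mode b R (\<lambda>t. band R (hat (u t))) (\<lambda>t. band R (hat (ut t))) (W R) ga al al' h G K h0 H \<mu>"
    and "\<And>t. 0 \<le> t \<Longrightarrow> has_density (dist_fourier (u t)) (hat (u t))"
    and "\<And>t. 0 \<le> t \<Longrightarrow> has_density (dist_fourier (ut t)) (hat (ut t))"
    and "\<And>R. damped_mode.N R (\<lambda>t. band R (hat (u t))) (\<lambda>t. band R (hat (ut t))) (\<lambda>\<xi>. 1) 0 \<le> (sobolev_norm 1 u1 + L2_norm u2)\<^sup>2"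
proof -
  obtain W where fs: "\<And>R. frequency_solution b R (\<lambda>t. band R (hat (u t))) (\<lambda>t. band R (hat (ut t))) (W R)"
    and mem: "\<And>t. 0 \<le> t \<Longrightarrow> u t \<in> sobolev 0" "\<And>t. 0 \<le> t \<Longrightarrow> ut t \<in> sobolev (-1)"
    and ini: "eq_dist (u 0) u1" "eq_dist (ut 0) u2"
    by (rule damped_wave_solution_frequency[OF sol]) (rule that)
  note hu = sobolev_hat(1)[OF mem(1)] and hut = sobolev_hat(1)[OF mem(2)]
  have [measurable]: "hat (u 0) \<in> borel_measurable borel" "hat (ut 0) \<in> borel_measurable borel"
    using hu[of 0] hut[of 0] by (auto simp: has_density_def)
  obtain g where g: "has_density (dist_fourier u2) g" "g \<in> L2_fun" "L2_fun_norm g \<le> L2_norm u2"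
    using fourier_density_if_L2[OF u2] by blast
  have "AE \<xi> in lborel. g \<xi> = hat (ut 0) \<xi>"
    by (rule has_density_unique[OF g(1) fourier_density_cong[OF hut[of 0] ini(2)] refl]) simp
  from L2_fun_cong_AE[OF g(2) _ this] g(3)
  have z0: "hat (ut 0) \<in> L2_fun" "L2_fun_norm (hat (ut 0)) \<le> L2_norm u2" by auto
  have hu1: "has_density (dist_fourier u1) (hat (u 0))"
    by (rule fourier_density_cong[OF hu[of 0] ini(1)]) simp
  have x0: "sobolev_weight 1 (hat (u 0)) \<in> L2_fun"
  proof (rule L2_fun_cong_AE(1)[OF sobolev_hat(2)[OF u1]])
    show "AE \<xi> in lborel. sobolev_weight 1 (hat u1) \<xi> = sobolev_weight 1 (hat (u 0)) \<xi>"
      using has_density_unique[OF sobolev_hat(1)[OF u1] hu1 refl]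
      by eventually_elim (simp add: sobolev_weight_def)
  qed (simp add: sobolev_weight_def[abs_def])
  have x0n: "sobolev_norm 1 u1 = L2_fun_norm (sobolev_weight 1 (hat (u 0)))"
    by (rule sobolev_norm_eq[OF hu1 x0])
  have nn: "0 \<le> L2_norm u2" "0 \<le> sobolev_norm 1 u1"
    by (simp_all add: L2_norm_def sobolev_norm_def)
  show thesis
  proof (rule that[of W, OF _ hu hut])
    fix R
    interpret F: frequency_solution b R "\<lambda>t. band R (hat (u t))" "\<lambda>t. band R (hat (ut t))" "W R"
      by (rule fs)
    interpret D: damped_mode b R "\<lambda>t. band R (hat (u t))" "\<lambda>t. band R (hat (ut t))" "W R" ga al al' h G K h0 H \<mu> ..
    show "damped_mode b R (\<lambda>t. band R (hat (u t))) (\<lambda>t. band R (hat (ut t))) (W R) ga al al' h G K h0 H \<mu>"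
      by (rule D.damped_mode_axioms)
    let ?w = "\<lambda>\<xi>::'a. (1 + (norm \<xi>)\<^sup>2) powr (1 / 2)"
    have w: "(?w \<xi>)\<^sup>2 = 1 + (norm \<xi>)\<^sup>2" for \<xi>
      unfolding power2_eq_square powr_add[symmetric] by (simp add: add_nonneg_nonneg)
    have "F.Y (\<lambda>\<xi>. 1) 0 + F.Y (\<lambda>\<xi>. 1 * (norm \<xi>)\<^sup>2) 0 = F.Y (\<lambda>\<xi>. 1 + 1 * (norm \<xi>)\<^sup>2) 0"
      unfolding F.Y_def
      by (rule F.form_add[symmetric]) (auto intro!: F.admissible_const F.admissible_norm F.UL)
    also have "\<dots> = F.Y (\<lambda>\<xi>. (?w \<xi>)\<^sup>2) 0" by (simp only: w mult_1)
    also have "\<dots> = (L2_fun_norm (band R (sobolev_weight 1 (hat (u 0)))))\<^sup>2"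
      using D.quadratic_as_norm(1)[of 0 ?w] by (simp only: band_sobolev_weight order_refl)
    finally have Y: "F.Y (\<lambda>\<xi>. 1) 0 + F.Y (\<lambda>\<xi>. 1 * (norm \<xi>)\<^sup>2) 0 = (L2_fun_norm (band R (sobolev_weight 1 (hat (u 0)))))\<^sup>2" .
    have "F.P (\<lambda>\<xi>. 1) 0 = (L2_fun_norm (band R (hat (ut 0))))\<^sup>2"
      using D.quadratic_as_norm(2)[of 0 "\<lambda>\<xi>. 1"] by simp
    then have "D.N (\<lambda>\<xi>. 1) 0 = (L2_fun_norm (band R (hat (ut 0))))\<^sup>2 + (L2_fun_norm (band R (sobolev_weight 1 (hat (u 0)))))\<^sup>2"
      unfolding D.N_def using Y by linarith
    also have "\<dots> \<le> (L2_norm u2)\<^sup>2 + (sobolev_norm 1 u1)\<^sup>2"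
      using band_norm_le[OF x0, of R] order_trans[OF band_norm_le[OF z0(1), of R] z0(2)]
      unfolding x0n by (intro add_mono power_mono) auto
    also have "\<dots> \<le> (sobolev_norm 1 u1 + L2_norm u2)\<^sup>2"
      using nn by (simp add: power2_sum)
    finally show "D.N (\<lambda>\<xi>. 1) 0 \<le> (sobolev_norm 1 u1 + L2_norm u2)\<^sup>2" .
  qed
qed

end

lemma band_times: "(\<lambda>\<xi>. of_real (w \<xi>) * band R f \<xi>) = band R (\<lambda>\<xi>. of_real (w \<xi>) * f \<xi>)"
  by (rule ext) (simp add: band_def)

context lyapunov
begin

definition Kg where "Kg = 2 * Kq + 2 * Kq / \<kappa>"

lemma Kg_nonneg: "0 \<le> Kg"
  unfolding Kg_def using Kq_nonneg \<kappa>_pos by simp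

lemma wave_gradient_bound:
  fixes u1 :: "'a::euclidean_space distribution"
  assumes u1: "u1 \<in> sobolev 1" and u2: "u2 \<in> L2" and sol: "damped_wave_solution b u1 u2 u ut" and t: "0 \<le> t"
  shows "grad_in_L2 id (u t) \<and>
    grad_L2_norm id (u t) \<le> sqrt Kg * (1 + t) powr (-1/2) * (sobolev_norm 1 u1 + L2_norm u2)"
proof -
  let ?D = "sobolev_norm 1 u1 + L2_norm u2"
  have D: "0 \<le> ?D" by (simp add: L2_norm_def sobolev_norm_def)
  obtain W where dm: "\<And>R. damped_mode b R (\<lambda>t. band R (hat (u t))) (\<lambda>t. band R (hat (ut t))) (W R) ga al al' h G K h0 H \<mu>"
    and hu: "\<And>t. 0 \<le> t \<Longrightarrow> has_density (dist_fourier (u t)) (hat (u t))"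
    and hut: "\<And>t. 0 \<le> t \<Longrightarrow> has_density (dist_fourier (ut t)) (hat (ut t))"
    and N0: "\<And>R. damped_mode.N R (\<lambda>t. band R (hat (u t))) (\<lambda>t. band R (hat (ut t))) (\<lambda>\<xi>. 1) 0 \<le> ?D\<^sup>2"
    by (rule energy_data[OF u1 u2 sol]) (rule that)
  have m[measurable]: "hat (u t) \<in> borel_measurable borel" using hu[OF t] by (simp add: has_density_def)
  let ?f = "\<lambda>\<xi>. of_real (norm \<xi>) * hat (u t) \<xi>"
  have fm: "?f \<in> borel_measurable borel" by measurable
  have bnd: "band R ?f \<in> L2_fun" "(L2_fun_norm (band R ?f))\<^sup>2 \<le> Kg / (1 + t) * ?D\<^sup>2" for R
  proof -
    interpret D: damped_mode b R "\<lambda>t. band R (hat (u t))" "\<lambda>t. band R (hat (ut t))" "W R" ga al al' h G K h0 H \<mu>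
      by (rule dm)
    show "band R ?f \<in> L2_fun"
      by (rule band_weighted_L2[OF m D.UL[OF t], of norm R]) auto
    have "(1 + t) * (L2_fun_norm (band R ?f))\<^sup>2 = (1 + t) * D.Y D.r2 t"
      unfolding D.quadratic_as_norm(1)[OF t, of norm] band_times ..
    also have "\<dots> \<le> Kg * D.N (\<lambda>\<xi>. 1) 0" unfolding Kg_def by (rule D.gradient_estimate[OF t])
    also have "\<dots> \<le> Kg * ?D\<^sup>2" by (intro mult_left_mono N0 Kg_nonneg)
    finally show "(L2_fun_norm (band R ?f))\<^sup>2 \<le> Kg / (1 + t) * ?D\<^sup>2"
      using t by (simp add: pos_le_divide_eq mult.commute)
  qed
  note f = L2_fun_if_bands_bounded[OF fm bnd]
  have "grad_in_L2 id (u t)" "grad_L2_norm id (u t) \<le> L2_fun_norm ?f"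
    using gradient_L2[of "hat (u t)" id "u t", OF _ m f(1)] has_density_dist_partial[OF hu[OF t]] by simp_all
  moreover have "L2_fun_norm ?f \<le> sqrt (Kg / (1 + t)) * ?D"
    by (rule norm_le_if_square_le[OF f(2) _ D]) (use t Kg_nonneg in simp)
  moreover have "sqrt (Kg / (1 + t)) = sqrt Kg * (1 + t) powr (-1/2)"
    using t by (simp add: real_sqrt_divide powr_minus_divide powr_half_sqrt)
  ultimately show ?thesis by simp
qed

lemma wave_velocity_bound:
  fixes u1 :: "'a::euclidean_space distribution"
  assumes u1: "u1 \<in> sobolev 1" and u2: "u2 \<in> L2" and sol: "damped_wave_solution b u1 u2 u ut" and t: "0 \<le> t"
  shows "ut t \<in> L2 \<and> L2_norm (ut t) \<le> sqrt Kv * (1 + t) powr (-1) * (sobolev_norm 1 u1 + L2_norm u2)"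
proof -
  let ?D = "sobolev_norm 1 u1 + L2_norm u2"
  have D: "0 \<le> ?D" by (simp add: L2_norm_def sobolev_norm_def)
  obtain W where dm: "\<And>R. damped_mode b R (\<lambda>t. band R (hat (u t))) (\<lambda>t. band R (hat (ut t))) (W R) ga al al' h G K h0 H \<mu>"
    and hu: "\<And>t. 0 \<le> t \<Longrightarrow> has_density (dist_fourier (u t)) (hat (u t))"
    and hut: "\<And>t. 0 \<le> t \<Longrightarrow> has_density (dist_fourier (ut t)) (hat (ut t))"
    and N0: "\<And>R. damped_mode.N R (\<lambda>t. band R (hat (u t))) (\<lambda>t. band R (hat (ut t))) (\<lambda>\<xi>. 1) 0 \<le> ?D\<^sup>2"
    by (rule energy_data[OF u1 u2 sol]) (rule that)
  have m: "hat (ut t) \<in> borel_measurable borel" using hut[OF t] by (simp add: has_density_def)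
  have bnd: "band R (hat (ut t)) \<in> L2_fun" "(L2_fun_norm (band R (hat (ut t))))\<^sup>2 \<le> Kv / (1 + t)\<^sup>2 * ?D\<^sup>2" for R
  proof -
    interpret D: damped_mode b R "\<lambda>t. band R (hat (u t))" "\<lambda>t. band R (hat (ut t))" "W R" ga al al' h G K h0 H \<mu>
      by (rule dm)
    show "band R (hat (ut t)) \<in> L2_fun" by (rule D.VL[OF t])
    have "(1 + t)\<^sup>2 * (L2_fun_norm (band R (hat (ut t))))\<^sup>2 = (1 + t)\<^sup>2 * D.P (\<lambda>\<xi>. 1) t"
      using D.quadratic_as_norm(2)[OF t, of "\<lambda>\<xi>. 1"] by simp
    also have "\<dots> \<le> Kv * D.N (\<lambda>\<xi>. 1) 0" by (rule D.velocity_estimate[OF t])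
    also have "\<dots> \<le> Kv * ?D\<^sup>2" by (intro mult_left_mono N0 Kv_nonneg)
    finally show "(L2_fun_norm (band R (hat (ut t))))\<^sup>2 \<le> Kv / (1 + t)\<^sup>2 * ?D\<^sup>2"
      using t by (simp add: pos_le_divide_eq mult.commute)
  qed
  note f = L2_fun_if_bands_bounded[OF m bnd]
  note L = L2_if_fourier_density[OF hut[OF t] f(1)]
  have "L2_fun_norm (hat (ut t)) \<le> sqrt (Kv / (1 + t)\<^sup>2) * ?D"
    by (rule norm_le_if_square_le[OF f(2) _ D]) (use t Kv_nonneg in simp)
  moreover have "sqrt (Kv / (1 + t)\<^sup>2) = sqrt Kv * (1 + t) powr (-1)"
    using t by (simp add: real_sqrt_divide powr_minus_divide)
  ultimately show ?thesis using L by simp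
qed

text \<open>The weight is \<open>\<eta>(\<bar>\<xi>\<bar>)\<^sup>2\<close>. It is bounded, and on its support \<open>rho\<close> is at least \<open>\<rho>\<^sub>0 = r\<^sup>2 / (1 + r\<^sup>2)\<close> when \<open>\<eta>\<close> vanishes
  below \<open>r\<close>. The energy with this weight thus decays with the rate \<open>a\<close>, and the norms, being its square
  roots, with the rate \<open>a / 2\<close>.\<close>

lemma wave_cutoff_bound:
  assumes \<eta>: "cutoff \<eta>"
  shows "\<exists>\<delta>>0. \<exists>C. \<forall>(u1 :: 'a::euclidean_space distribution) u2 u ut.
    u1 \<in> sobolev 1 \<and> u2 \<in> L2 \<and> damped_wave_solution b u1 u2 u ut \<longrightarrow>
    (\<forall>t\<ge>0. cutoff_multiplier \<eta> (u t) \<in> L2 \<and> grad_in_L2 (cutoff_multiplier \<eta>) (u t) \<and>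
      cutoff_multiplier \<eta> (ut t) \<in> L2 \<and>
      L2_norm (cutoff_multiplier \<eta> (u t)) + grad_L2_norm (cutoff_multiplier \<eta>) (u t)
        + L2_norm (cutoff_multiplier \<eta> (ut t)) \<le> C * exp (- \<delta> * t) * (sobolev_norm 1 u1 + L2_norm u2))"
proof -
  obtain B r where \<eta>c: "continuous_on UNIV \<eta>" and B: "1 \<le> B" "\<And>s. 0 \<le> s \<Longrightarrow> \<bar>\<eta> s\<bar> \<le> B"
    and r: "0 < r" "\<And>s. \<bar>s\<bar> < r \<Longrightarrow> \<eta> s = 0"
    by (rule cutoff_facts[OF \<eta>]) (rule that)
  have \<eta>m: "\<eta> \<in> borel_measurable borel" by (rule borel_measurable_continuous_onI[OF \<eta>c])
  let ?\<eta> = "\<lambda>\<xi>::'a. \<eta> (norm \<xi>)"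
  note [measurable] = \<eta>m
  have wm[measurable]: "?\<eta> \<in> borel_measurable borel" by measurable
  define \<rho>\<^sub>0 where "\<rho>\<^sub>0 = r\<^sup>2 / (1 + r\<^sup>2)"
  have \<rho>\<^sub>0: "0 < \<rho>\<^sub>0" using r(1) by (simp add: \<rho>\<^sub>0_def add_pos_pos)
  define a where "a = \<kappa> * \<rho>\<^sub>0 / (2 * Kq)"
  have a: "0 < a" unfolding a_def using \<kappa>_pos \<rho>\<^sub>0 Kq_ge by simp
  define C where "C = 2 * Kq * B\<^sup>2"
  have C: "0 \<le> C" unfolding C_def using Kq_nonneg by simp
  have main: "cutoff_multiplier \<eta> (u t) \<in> L2 \<and> grad_in_L2 (cutoff_multiplier \<eta>) (u t) \<and>
      cutoff_multiplier \<eta> (ut t) \<in> L2 \<and>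
      L2_norm (cutoff_multiplier \<eta> (u t)) + grad_L2_norm (cutoff_multiplier \<eta>) (u t)
        + L2_norm (cutoff_multiplier \<eta> (ut t)) \<le> 3 * sqrt C * exp (- (a / 2) * t) * (sobolev_norm 1 u1 + L2_norm u2)"
    if u1: "u1 \<in> sobolev 1" and u2: "u2 \<in> L2" and sol: "damped_wave_solution b u1 u2 u ut" and t: "0 \<le> t"
    for u1 u2 :: "'a distribution" and u ut t
  proof -
    let ?D = "sobolev_norm 1 u1 + L2_norm u2"
    have D: "0 \<le> ?D" by (simp add: L2_norm_def sobolev_norm_def)
    obtain W where dm: "\<And>R. damped_mode b R (\<lambda>t. band R (hat (u t))) (\<lambda>t. band R (hat (ut t))) (W R) ga al al' h G K h0 H \<mu>"
      and hu: "\<And>t. 0 \<le> t \<Longrightarrow> has_density (dist_fourier (u t)) (hat (u t))"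
      and hut: "\<And>t. 0 \<le> t \<Longrightarrow> has_density (dist_fourier (ut t)) (hat (ut t))"
      and N0: "\<And>R. damped_mode.N R (\<lambda>t. band R (hat (u t))) (\<lambda>t. band R (hat (ut t))) (\<lambda>\<xi>. 1) 0 \<le> ?D\<^sup>2"
      by (rule energy_data[OF u1 u2 sol]) (rule that)
    have m[measurable]: "hat (u t) \<in> borel_measurable borel" "hat (ut t) \<in> borel_measurable borel"
      using hu[OF t] hut[OF t] by (auto simp: has_density_def)
    let ?f = "\<lambda>\<xi>. of_real (?\<eta> \<xi>) * hat (u t) \<xi>"
    let ?g = "\<lambda>\<xi>. of_real (norm \<xi> * ?\<eta> \<xi>) * hat (u t) \<xi>"
    let ?k = "\<lambda>\<xi>. of_real (?\<eta> \<xi>) * hat (ut t) \<xi>"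
    define Q where "Q = C * exp (- a * t)"
    have Q: "0 \<le> Q" using C by (simp add: Q_def)
    have bnd: "band R ?f \<in> L2_fun" "(L2_fun_norm (band R ?f))\<^sup>2 \<le> Q * ?D\<^sup>2"
      "band R ?g \<in> L2_fun" "(L2_fun_norm (band R ?g))\<^sup>2 \<le> Q * ?D\<^sup>2"
      "band R ?k \<in> L2_fun" "(L2_fun_norm (band R ?k))\<^sup>2 \<le> Q * ?D\<^sup>2" for R
    proof -
      interpret D: damped_mode b R "\<lambda>t. band R (hat (u t))" "\<lambda>t. band R (hat (ut t))" "W R" ga al al' h G K h0 H \<mu>
        by (rule dm)
      have Bn: "\<bar>?\<eta> \<xi>\<bar> \<le> B" for \<xi> by (rule B(2)) simp
      show "band R ?f \<in> L2_fun" "band R ?k \<in> L2_fun"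
        by (rule band_weighted_L2[OF m(1) D.UL[OF t] wm Bn], rule band_weighted_L2[OF m(2) D.VL[OF t] wm Bn])
      have "\<bar>norm \<xi> * ?\<eta> \<xi>\<bar> \<le> R * B" if "norm \<xi> \<le> R" for \<xi> :: 'a
      proof -
        have "0 \<le> R" using that norm_ge_zero[of \<xi>] by linarith
        then show ?thesis unfolding abs_mult using that Bn[of \<xi>] by (intro mult_mono) auto
      qed
      then show "band R ?g \<in> L2_fun"
        by (intro band_weighted_L2[OF m(1) D.UL[OF t]]) measurable
      let ?m = "\<lambda>\<xi>. (?\<eta> \<xi>)\<^sup>2"
      have \<eta>2: "(?\<eta> \<xi>)\<^sup>2 \<le> B\<^sup>2" for \<xi> using power_mono[OF Bn[of \<xi>], of 2] by simp
      have wt: "D.weight ?m"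
        unfolding D.weight_def D.admissible_def using \<eta>2 by auto
      have "D.N ?m 0 \<le> D.N (\<lambda>\<xi>. B\<^sup>2 * 1) 0"
        using \<eta>2 by (intro D.N_mono wt) (auto simp: D.weight_def D.admissible_const)
      also have "\<dots> = B\<^sup>2 * D.N (\<lambda>\<xi>. 1) 0" by (rule D.N_cmult)
      also have "\<dots> \<le> B\<^sup>2 * ?D\<^sup>2" by (intro mult_left_mono N0) auto
      finally have Nm0: "D.N ?m 0 \<le> B\<^sup>2 * ?D\<^sup>2" .
      have "D.N ?m t \<le> 2 * Kq * exp (- (\<kappa> * \<rho>\<^sub>0 / (2 * Kq)) * t) * D.N ?m 0"
      proof (rule D.exponential_decay[OF wt t \<rho>\<^sub>0])
        fix \<xi> :: 'a assume "(?\<eta> \<xi>)\<^sup>2 \<noteq> 0"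
        then have "r \<le> norm \<xi>" using r(2)[of "norm \<xi>"] by (cases "norm \<xi> < r") auto
        then have "r\<^sup>2 \<le> (norm \<xi>)\<^sup>2" using r(1) by (intro power_mono) auto
        then show "\<rho>\<^sub>0 \<le> D.rho \<xi>"
          unfolding \<rho>\<^sub>0_def D.rho_def
          by (subst frac_le_eq) (auto simp: add_pos_nonneg add_nonneg_eq_0_iff intro!: divide_nonpos_pos mult_pos_pos, simp add: algebra_simps)
      qed
      also have "\<dots> \<le> 2 * Kq * exp (- (\<kappa> * \<rho>\<^sub>0 / (2 * Kq)) * t) * (B\<^sup>2 * ?D\<^sup>2)"
        using Kq_nonneg by (intro mult_left_mono Nm0) auto
      also have "\<dots> = Q * ?D\<^sup>2" by (simp add: Q_def C_def a_def)
      finally have N: "D.N ?m t \<le> Q * ?D\<^sup>2" .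
      have "D.Y ?m t = (L2_fun_norm (band R ?f))\<^sup>2" "D.P ?m t = (L2_fun_norm (band R ?k))\<^sup>2"
        unfolding D.quadratic_as_norm[OF t] band_times by (rule refl)+
      moreover have "D.Y (\<lambda>\<xi>. ?m \<xi> * D.r2 \<xi>) t = (L2_fun_norm (band R ?g))\<^sup>2"
        using D.quadratic_as_norm(1)[OF t, of "\<lambda>\<xi>. norm \<xi> * ?\<eta> \<xi>"]
        unfolding band_times power_mult_distrib by (simp only: mult.commute)
      ultimately show "(L2_fun_norm (band R ?f))\<^sup>2 \<le> Q * ?D\<^sup>2" "(L2_fun_norm (band R ?g))\<^sup>2 \<le> Q * ?D\<^sup>2"
        "(L2_fun_norm (band R ?k))\<^sup>2 \<le> Q * ?D\<^sup>2"
        using N D.parts_nonneg[OF wt t] unfolding D.N_def by linarith+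
    qed
    have fm: "?f \<in> borel_measurable borel" "?g \<in> borel_measurable borel" "?k \<in> borel_measurable borel"
      by measurable
    note f = L2_fun_if_bands_bounded[OF fm(1) bnd(1,2)]
    note g = L2_fun_if_bands_bounded[OF fm(2) bnd(3,4)]
    note k = L2_fun_if_bands_bounded[OF fm(3) bnd(5,6)]
    have cm: "(\<lambda>\<xi>::'a. complex_of_real (?\<eta> \<xi>)) \<in> borel_measurable borel" by measurable
    have Lf: "cutoff_multiplier \<eta> (u t) \<in> L2" "L2_norm (cutoff_multiplier \<eta> (u t)) \<le> L2_fun_norm ?f"
      using L2_if_fourier_density[OF has_density_fourier_multiplier[OF hu[OF t] cm f(1)] f(1)]
      by (simp_all add: cutoff_multiplier_def)
    have Lk: "cutoff_multiplier \<eta> (ut t) \<in> L2" "L2_norm (cutoff_multiplier \<eta> (ut t)) \<le> L2_fun_norm ?k"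
      using L2_if_fourier_density[OF has_density_fourier_multiplier[OF hut[OF t] cm k(1)] k(1)]
      by (simp_all add: cutoff_multiplier_def)
    have g': "(\<lambda>\<xi>. of_real (norm \<xi>) * ?f \<xi>) = ?g" by (simp add: mult.assoc)
    have "grad_in_L2 (cutoff_multiplier \<eta>) (u t) \<and> grad_L2_norm (cutoff_multiplier \<eta>) (u t) \<le> L2_fun_norm (\<lambda>\<xi>. of_real (norm \<xi>) * ?f \<xi>)"
    proof -
      have d: "has_density (dist_fourier (cutoff_multiplier \<eta> (dist_partial e (u t)))) (\<lambda>\<xi>. \<i> * of_real (\<xi> \<bullet> e) * ?f \<xi>)"
        if e: "e \<in> Basis" and l: "(\<lambda>\<xi>. \<i> * of_real (\<xi> \<bullet> e) * ?f \<xi>) \<in> L2_fun" for e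
      proof -
        have eq: "(\<lambda>\<xi>. of_real (?\<eta> \<xi>) * (\<i> * of_real (\<xi> \<bullet> e) * hat (u t) \<xi>)) = (\<lambda>\<xi>. \<i> * of_real (\<xi> \<bullet> e) * ?f \<xi>)"
          by (simp add: fun_eq_iff mult_ac)
        from has_density_fourier_multiplier[OF has_density_dist_partial[OF hu[OF t] e] cm]
        show ?thesis unfolding eq cutoff_multiplier_def using l by blast
      qed
      have g1: "(\<lambda>\<xi>. of_real (norm \<xi>) * ?f \<xi>) \<in> L2_fun" unfolding g' by (rule g(1))
      show ?thesis
        using gradient_L2[of ?f "cutoff_multiplier \<eta>" "u t", OF d fm(1) g1] by blast
    qed
    then have Lg: "grad_in_L2 (cutoff_multiplier \<eta>) (u t)" "grad_L2_norm (cutoff_multiplier \<eta>) (u t) \<le> L2_fun_norm ?g"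
      unfolding g' by auto
    have "L2_fun_norm ?f \<le> sqrt Q * ?D" "L2_fun_norm ?g \<le> sqrt Q * ?D" "L2_fun_norm ?k \<le> sqrt Q * ?D"
      by (rule norm_le_if_square_le[OF f(2) Q D] norm_le_if_square_le[OF g(2) Q D] norm_le_if_square_le[OF k(2) Q D])+
    then have "L2_norm (cutoff_multiplier \<eta> (u t)) + grad_L2_norm (cutoff_multiplier \<eta>) (u t)
        + L2_norm (cutoff_multiplier \<eta> (ut t)) \<le> 3 * (sqrt Q * ?D)"
      using Lf(2) Lg(2) Lk(2) by linarith
    moreover have "sqrt Q = sqrt C * exp (- (a / 2) * t)"
    proof -
      have "exp (- a * t) = (exp (- (a / 2) * t))\<^sup>2" by (simp add: power2_eq_square exp_add[symmetric])
      then show ?thesis by (simp add: Q_def real_sqrt_mult)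
    qed
    ultimately show ?thesis using Lf(1) Lg(1) Lk(1) by (simp add: mult.assoc)
  qed
  show ?thesis
    by (rule exI[of _ "a / 2"], rule conjI, use a in simp, rule exI[of _ "3 * sqrt C"])
      (intro allI impI, elim conjE, rule main; assumption)
qed

end

section \<open>Existence of the coefficients and conclusion\<close>

text \<open>The bound \<open>G\<close> of \<open>ga\<close> is known before \<open>al\<close> is chosen, so \<open>al\<close> can be required to exceed \<open>2 G\<^sup>2 + 1\<close>.\<close>

lemma lyapunov_exists:
  fixes b :: "real \<Rightarrow> real" and T :: real
  assumes T: "T > 0" and per: "\<And>t. b (t + T) = b t" and cont: "continuous_on UNIV b"
    and pos: "AE t in lborel. b t > 0"
  obtains ga al al' h G K h0 H \<mu> where "lyapunov b ga al al' h G K h0 H \<mu>"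
proof -
  have scaled: "\<And>t. c * b (t + T) = c * b t" "continuous_on UNIV (\<lambda>t. c * b t)" "AE t in lborel. c * b t > 0"
    if "0 < c" for c
  proof -
    show "c * b (t + T) = c * b t" for t by (simp add: per)
    show "continuous_on UNIV (\<lambda>t. c * b t)" by (intro continuous_intros cont)
    show "AE t in lborel. c * b t > 0" using pos by eventually_elim (use that in simp)
  qed
  have p2: "(0::real) < 2" and p4: "(0::real) < 4" by simp_all
  obtain ga m G where ga: "\<And>t. (ga has_real_derivative 2 * b t * ga t - 1) (at t)" "\<And>t. ga (t + T) = ga t"
    "0 < m" "\<And>t. m \<le> ga t" "\<And>t. ga t \<le> G"
    by (rule periodic_backward_solution[where c="\<lambda>t. 2 * b t", OF T scaled[OF p2]]) (rule that)
  obtain h h0 H where h: "\<And>t. (h has_real_derivative 4 * b t * h t - 1) (at t)" "\<And>t. h (t + T) = h t"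
    "0 < h0" "\<And>t. h0 \<le> h t" "\<And>t. h t \<le> H"
    by (rule periodic_backward_solution[where c="\<lambda>t. 4 * b t", OF T scaled[OF p4]]) (rule that)
  have gcont: "continuous_on UNIV ga"
    by (intro continuous_at_imp_continuous_on ballI DERIV_isCont[OF ga(1)])
  obtain \<mu> al al' K where al: "\<mu> > 0" "\<And>t. (al has_real_derivative al' t) (at t)"
    "\<And>t. al' t \<le> 2 * ga t - \<mu>" "\<And>t. al' t - 4 * b t * al t + 2 * ga t \<le> - \<mu>"
    "\<And>t. 2 * G\<^sup>2 + 1 \<le> al t" "\<And>t. al t \<le> K"
    by (rule periodic_weight[where b=b and g=ga and L="2 * G\<^sup>2 + 1", OF T per cont pos gcont ga(2-5)]) (rule that)
  have "lyapunov b ga al al' h G K h0 H \<mu>"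
  proof
    show "0 \<le> b t" for t by (rule nonneg_if_AE_pos[OF cont pos])
    show "0 < ga t" for t using ga(3) ga(4)[of t] by linarith
  qed (rule ga al h)+
  then show thesis by (rule that)
qed

theorem theorem2p1:
  fixes b :: "real \<Rightarrow> real" and T :: real
  assumes "T > 0"
    and "\<And>t. b (t + T) = b t"
    and "continuous_on UNIV b"
    and "bounded_variation_on b 0 T"
    and "AE t in lborel. b t > 0"
  shows
    "(\<exists>C. \<forall>(u1 :: 'a::euclidean_space distribution) u2 u ut.
        u1 \<in> L2 \<and> u2 \<in> sobolev (-1) \<and> damped_wave_solution b u1 u2 u ut \<longrightarrow>
        (\<forall>t\<ge>0. u t \<in> L2 \<and> L2_norm (u t) \<le> C * (L2_norm u1 + sobolev_norm (-1) u2)))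
     \<and>
     (\<exists>C. \<forall>(u1 :: 'a::euclidean_space distribution) u2 u ut.
        u1 \<in> sobolev 1 \<and> u2 \<in> L2 \<and> damped_wave_solution b u1 u2 u ut \<longrightarrow>
        (\<forall>t\<ge>0. grad_in_L2 id (u t) \<and>
           grad_L2_norm id (u t) \<le> C * (1 + t) powr (-1/2) * (sobolev_norm 1 u1 + L2_norm u2)))
     \<and>
     (\<exists>C. \<forall>(u1 :: 'a::euclidean_space distribution) u2 u ut.
        u1 \<in> sobolev 1 \<and> u2 \<in> L2 \<and> damped_wave_solution b u1 u2 u ut \<longrightarrow>
        (\<forall>t\<ge>0. ut t \<in> L2 \<and>
           L2_norm (ut t) \<le> C * (1 + t) powr (-1) * (sobolev_norm 1 u1 + L2_norm u2)))
     \<and>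
     (\<forall>\<eta>. cutoff \<eta> \<longrightarrow> (\<exists>\<delta>>0. \<exists>C. \<forall>(u1 :: 'a::euclidean_space distribution) u2 u ut.
        u1 \<in> sobolev 1 \<and> u2 \<in> L2 \<and> damped_wave_solution b u1 u2 u ut \<longrightarrow>
        (\<forall>t\<ge>0.
           cutoff_multiplier \<eta> (u t) \<in> L2 \<and>
           grad_in_L2 (cutoff_multiplier \<eta>) (u t) \<and>
           cutoff_multiplier \<eta> (ut t) \<in> L2 \<and>
           L2_norm (cutoff_multiplier \<eta> (u t)) + grad_L2_norm (cutoff_multiplier \<eta>) (u t)
             + L2_norm (cutoff_multiplier \<eta> (ut t))
           \<le> C * exp (- \<delta> * t) * (sobolev_norm 1 u1 + L2_norm u2))))"
proof -
  obtain ga al al' h G K h0 H \<mu> where "lyapunov b ga al al' h G K h0 H \<mu>"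
    by (rule lyapunov_exists[where b=b, OF assms(1,2,3,5)]) (rule that)
  then interpret lyapunov b ga al al' h G K h0 H \<mu> .
  show ?thesis
  proof (intro conjI allI impI)
    show "\<exists>C. \<forall>(u1 :: 'a distribution) u2 u ut.
        u1 \<in> L2 \<and> u2 \<in> sobolev (-1) \<and> damped_wave_solution b u1 u2 u ut \<longrightarrow>
        (\<forall>t\<ge>0. u t \<in> L2 \<and> L2_norm (u t) \<le> C * (L2_norm u1 + sobolev_norm (-1) u2))"
      by (rule exI[of _ "sqrt (2 * Kq)"], intro allI impI, elim conjE, rule wave_solution_bound; assumption)
    show "\<exists>C. \<forall>(u1 :: 'a distribution) u2 u ut.
        u1 \<in> sobolev 1 \<and> u2 \<in> L2 \<and> damped_wave_solution b u1 u2 u ut \<longrightarrow>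
        (\<forall>t\<ge>0. grad_in_L2 id (u t) \<and>
           grad_L2_norm id (u t) \<le> C * (1 + t) powr (-1/2) * (sobolev_norm 1 u1 + L2_norm u2))"
      by (rule exI[of _ "sqrt Kg"], intro allI impI, elim conjE, rule wave_gradient_bound; assumption)
    show "\<exists>C. \<forall>(u1 :: 'a distribution) u2 u ut.
        u1 \<in> sobolev 1 \<and> u2 \<in> L2 \<and> damped_wave_solution b u1 u2 u ut \<longrightarrow>
        (\<forall>t\<ge>0. ut t \<in> L2 \<and>
           L2_norm (ut t) \<le> C * (1 + t) powr (-1) * (sobolev_norm 1 u1 + L2_norm u2))"
      by (rule exI[of _ "sqrt Kv"], intro allI impI, elim conjE, rule wave_velocity_bound; assumption)
  qed (rule wave_cutoff_bound)
qed

end
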